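(* Let $\mathbb{F}$ be a field and let $V$ be a vector space over $\mathbb{F}$ with countable dimension. Let $u\in\mathrm{GL}(V)$ be locally finite. The following conditions are equivalent: (i) $u$ is the product of two involutions in the group $\mathrm{GL}(V)$; (ii) $u$ is similar to its inverse; (iii) for every $p\in\mathrm{Irr}(\mathbb{F})\setminus\{t\}$ and every $\alpha\in\omega_1\cup\{\infty\}$, one has $\kappa_\alpha(u,p)=\kappa_\alpha(u,p^\sharp)$.
   Context: "Countable" includes finite. An endomorphism $u$ of $V$ is locally finite if for every $x\in V$ the sequence $(u^k(x))_{k\ge 0}$ is linearly dependent over $\mathbb{F}$. An involution is an element $a$ with $a^2=\mathrm{id}_V$ (so $\pm\mathrm{id}_V$ are allowed). Two endomorphisms $u,v$ of $V$ are similar if $v=\varphi u\varphi^{-1}$ for some $\varphi\in\mathrm{GL}(V)$. $\mathrm{Irr}(\mathbb{F})$ is the set of monic irreducible polynomials of $\mathbb{F}[t]$. For a monic polynomial $p$ of degree $d$ with $p(0)\neq 0$, its reciprocal polynomial is $p^\sharp:=p(0)^{-1}t^d p(t^{-1})$. Kaplansky invariants: $\omega_1$ is the first uncountable ordinal and $\infty$ is a symbol that is not an ordinal. Let $u\in\mathrm{End}(V)$ and $p\in\mathrm{Irr}(\mathbb{F})$; $V^u$ denotes $V$ with the $\mathbb{F}[t]$-module structure $r\cdot x=r(u)[x]$. Define submodules by transfinite induction: $p^0(V^u):=V$; $p^{\alpha+1}(V^u):=p(u)\bigl(p^\alpha(V^u)\bigr)$; $p^\alpha(V^u):=\bigcap_{\beta<\alpha}p^\beta(V^u)$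 for limit $\alpha$. This non-increasing sequence is eventually constant; $p^\infty(V^u)$ is its final value. For an ordinal $\alpha$, $\kappa_\alpha(u,p)$ is the dimension over the field $\mathbb{F}[t]/(p)$ of the kernel of the linear map $p^\alpha(V^u)/p^{\alpha+1}(V^u)\to p^{\alpha+1}(V^u)/p^{\alpha+2}(V^u)$ induced by $p(u)$; and $\kappa_\infty(u,p)$ is the dimension over $\mathbb{F}[t]/(p)$ of $\ker p(u)\cap p^\infty(V^u)$. Dimensions are cardinals. *)

theory Defs
  imports
    "HOL-Library.Countable_Set"
    "HOL-Computational_Algebra.Polynomial_Factorial"
    "HOL-Algebra.QuotRing"
    "Jordan_Normal_Form.Missing_VectorSpace"
begin

unbundle cardinal_syntax

section \<open>Countable ordinals\<close>

text \<open>The type \<^typ>\<open>nat suc\<close> of \<^theory>\<open>Main\<close> carries the cardinal successor of \<open>\<aleph>\<^sub>0\<close>, a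
  well-order of type \<open>\<omega>\<^sub>1\<close>; its elements are the countable ordinals.\<close>

instantiation suc :: (type) wellorder
begin

definition less_eq_suc :: "'a suc \<Rightarrow> 'a suc \<Rightarrow> bool"
  where "x \<le> y \<longleftrightarrow> (x, y) \<in> card_suc |UNIV :: 'a set|"

definition less_suc :: "'a suc \<Rightarrow> 'a suc \<Rightarrow> bool"
  where "(x :: 'a suc) < y \<longleftrightarrow> x \<le> y \<and> \<not> y \<le> x"

instance
proof
  have wo: "Well_order (card_suc |UNIV :: 'a set| )"
    using Card_order_card_suc[of "|UNIV :: 'a set|"] card_of_card_order_on
    unfolding card_order_on_def by blast
  then have lin: "Linear_order (card_suc |UNIV :: 'a set| )"
    and wf: "wf (card_suc |UNIV :: 'a set| - Id)"
    unfolding well_order_on_def by auto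
  from lin have r: "refl (card_suc |UNIV :: 'a set| )"
    and t: "trans (card_suc |UNIV :: 'a set| )"
    and a: "antisym (card_suc |UNIV :: 'a set| )"
    and tot: "total (card_suc |UNIV :: 'a set| )"
    unfolding order_on_defs Field_card_suc by auto
  fix x y z :: "'a suc"
  show "x < y \<longleftrightarrow> x \<le> y \<and> \<not> y \<le> x" by (simp add: less_suc_def)
  show "x \<le> x" using r unfolding less_eq_suc_def refl_on_def by blast
  show "x \<le> y \<Longrightarrow> y \<le> z \<Longrightarrow> x \<le> z" using t unfolding less_eq_suc_def trans_def by blast
  show "x \<le> y \<Longrightarrow> y \<le> x \<Longrightarrow> x = y" using a unfolding less_eq_suc_def antisym_def by blast
  show "x \<le> y \<or> y \<le> x"
    unfolding less_eq_suc_def by (cases "x = y") (use tot r in \<open>auto simp: total_on_def dest: reflD\<close>)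
  fix P :: "'a suc \<Rightarrow> bool" and b :: "'a suc"
  assume step: "\<And>x. (\<And>y. y < x \<Longrightarrow> P y) \<Longrightarrow> P x"
  show "P b"
  proof (induction b rule: wf_induct_rule[OF wf])
    case (1 x)
    show ?case
      by (rule step, rule 1) (auto simp: less_suc_def less_eq_suc_def)
  qed
qed

end

type_synonym omega1 = "nat suc"

definition ozero :: omega1 where "ozero = (LEAST \<alpha>. True)"

definition osucc :: "omega1 \<Rightarrow> omega1" where "osucc \<alpha> = (LEAST \<beta>. \<alpha> < \<beta>)"

definition is_successor :: "omega1 \<Rightarrow> bool"
  where "is_successor \<alpha> \<longleftrightarrow> (\<exists>\<beta>. \<alpha> = osucc \<beta>)"

definition is_limit :: "omega1 \<Rightarrow> bool"
  where "is_limit \<alpha> \<longleftrightarrow> \<alpha> \<noteq> ozero \<and> \<not> is_successor \<alpha>"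

lemma ozero_le: "ozero \<le> \<alpha>"
  unfolding ozero_def by (rule Least_le) simp

lemma less_osucc: "\<alpha> < osucc \<alpha>"
proof -
  let ?r = "card_suc |UNIV :: nat set|"
  have C: "Card_order ?r" by (rule Card_order_card_suc) (rule card_of_card_order_on)
  have "|UNIV :: nat set| <o ?r"
    by (rule card_suc_greater) (rule card_of_card_order_on)
  then have "infinite (Field ?r)"
    by (metis C Field_card_of card_of_ordLeq_infinite infinite_UNIV_nat ordLess_imp_ordLeq
        card_of_Field_ordIso ordLeq_ordIso_trans ordIso_symmetric)
  from infinite_Card_order_limit[OF C this, of \<alpha>]
  have "\<exists>\<beta>. \<alpha> < \<beta>"
    using antisym_conv2[of \<alpha>] by (auto simp: Field_card_suc less_eq_suc_def[symmetric] le_less)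
  then show ?thesis unfolding osucc_def by (rule LeastI_ex)
qed

lemma osucc_le_iff: "osucc \<alpha> \<le> \<beta> \<longleftrightarrow> \<alpha> < \<beta>"
  using less_osucc[of \<alpha>] unfolding osucc_def by (auto intro: Least_le)

lemma osucc_inject [simp]: "osucc \<alpha> = osucc \<beta> \<longleftrightarrow> \<alpha> = \<beta>"
  by (metis less_osucc linorder_neqE osucc_le_iff not_less)

section \<open>The transfinite sequence of iterated images\<close>

function iterated_image :: "('v \<Rightarrow> 'v) \<Rightarrow> omega1 \<Rightarrow> 'v set" where
  "iterated_image f \<alpha> =
    (if \<alpha> = ozero then UNIV
     else if is_successor \<alpha> then f ` iterated_image f (THE \<beta>. \<alpha> = osucc \<beta>)
     else (\<Inter>\<beta>\<in>{..<\<alpha>}. iterated_image f \<beta>))"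
  by auto
termination
  by (relation "inv_image {(x, y). x < y} snd")
    (auto simp: wf_inv_image wf is_successor_def less_osucc)

declare iterated_image.simps [simp del]

lemma iterated_image_ozero: "iterated_image f ozero = UNIV"
  by (simp add: iterated_image.simps)

lemma iterated_image_osucc: "iterated_image f (osucc \<alpha>) = f ` iterated_image f \<alpha>"
proof -
  have "osucc \<alpha> \<noteq> ozero" using less_osucc[of \<alpha>] ozero_le[of \<alpha>] by auto
  then show ?thesis
    by (subst iterated_image.simps) (auto simp: is_successor_def)
qed

lemma iterated_image_limit:
  "is_limit \<alpha> \<Longrightarrow> iterated_image f \<alpha> = (\<Inter>\<beta>\<in>{..<\<alpha>}. iterated_image f \<beta>)"
  by (subst iterated_image.simps) (simp add: is_limit_def)

text \<open>The final value. When \<open>f\<close> is an endomorphism of a space of countable dimension, the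
  sequence over all ordinals is already constant from some countable ordinal on: choosing
  \<open>x\<^sub>\<alpha>\<close> in the \<open>\<alpha>\<close>-th term but not in the next one, for each \<open>\<alpha>\<close> at which the sequence drops,
  gives a linearly independent family. For larger spaces this can fail, and
  the definition is not meant for them.\<close>

definition iterated_image_final :: "('v \<Rightarrow> 'v) \<Rightarrow> 'v set"
  where "iterated_image_final f = (THE W. \<exists>\<alpha>. \<forall>\<beta>\<ge>\<alpha>. iterated_image f \<beta> = W)"

section \<open>Polynomials\<close>

definition Irr :: "'a::field poly set"
  where "Irr = {p. irreducible p \<and> lead_coeff p = 1}"

text \<open>The library's \<^const>\<open>reflect_poly\<close> sends \<open>p\<close> to \<open>t\<^sup>d p(t\<^sup>-\<^sup>1)\<close> with \<open>d = degree p\<close>.\<close>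

definition reciprocal :: "'a::field poly \<Rightarrow> 'a poly"
  where "reciprocal p = Polynomial.smult (inverse (poly p 0)) (reflect_poly p)"

text \<open>Since \<open>\<bbbF>[t]/(p)\<close> depends on \<open>p\<close>, it cannot be a type; it is built with the carrier-based
  rings, modules and vector spaces.\<close>

definition polynomial_ring :: "'a::field poly ring"
  where "polynomial_ring = \<lparr>carrier = UNIV, mult = (*), one = 1, zero = 0, add = (+)\<rparr>"

definition residue_field :: "'a::field poly \<Rightarrow> 'a poly set ring"
  where "residue_field p = polynomial_ring Quot (PIdl\<^bsub>polynomial_ring\<^esub> p)"

section \<open>Quotients of modules, and dimensions\<close>

text \<open>The fields \<^const>\<open>mult\<close> and \<^const>\<open>one\<close> of a module record have no meaning.\<close>

definition quotient_module :: "('r, 'm) module \<Rightarrow> 'm set \<Rightarrow> ('r, 'm set) module"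
  where "quotient_module M N =
    \<lparr>carrier = a_rcosets\<^bsub>M\<^esub> N, mult = undefined, one = undefined, zero = N, add = set_add M,
     smult = (\<lambda>r X. \<Union>x\<in>X. N +>\<^bsub>M\<^esub> (r \<odot>\<^bsub>M\<^esub> x))\<rparr>"

text \<open>The map \<open>x + N \<mapsto> f(x) + N'\<close> into a quotient of \<open>M'\<close>.\<close>

definition induced_map :: "('r, 'm) module \<Rightarrow> 'm set \<Rightarrow> ('m \<Rightarrow> 'm) \<Rightarrow> 'm set \<Rightarrow> 'm set"
  where "induced_map M' N' f X = (\<Union>x\<in>X. N' +>\<^bsub>M'\<^esub> f x)"

text \<open>An \<open>\<bbbF>[t]\<close>-module that is annihilated by \<open>p\<close>, regarded as an \<open>\<bbbF>[t]/(p)\<close>-vector space: a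
  residue class acts through any of its representatives.\<close>

definition over_residue_field :: "('a::field poly, 'm) module \<Rightarrow> ('a poly set, 'm) module"
  where "over_residue_field M =
    \<lparr>carrier = carrier M, mult = undefined, one = undefined, zero = zero M, add = add M,
     smult = (\<lambda>R x. (SOME r. r \<in> R) \<odot>\<^bsub>M\<^esub> x)\<rparr>"

text \<open>The dimension, as a cardinal.\<close>

definition dimension :: "'k ring \<Rightarrow> ('k, 'm) module \<Rightarrow> 'm rel"
  where "dimension K W = |SOME B. vectorspace.basis K W B|"

section \<open>Endomorphisms of a vector space\<close>

type_synonym ('a, 'v) scaling = "'a \<Rightarrow> 'v \<Rightarrow> 'v"

definition countable_dimension :: "('a::field, 'v::ab_group_add) scaling \<Rightarrow> bool"
  where "countable_dimension scale \<longleftrightarrow>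
    (\<exists>B. countable B \<and> \<not> Modules.module.dependent scale B \<and> Modules.module.span scale B = UNIV)"

definition GL :: "('a::field, 'v::ab_group_add) scaling \<Rightarrow> ('v \<Rightarrow> 'v) set"
  where "GL scale = {f. Vector_Spaces.linear scale scale f \<and> bij f}"

text \<open>Linear dependence of \<open>(u\<^sup>k(x))\<^sub>k\<close> is that of a family, not of the set of its values
  (for \<open>u = id\<close> and \<open>x \<noteq> 0\<close> the set \<open>{x}\<close> is independent).\<close>

definition locally_finite :: "('a::field, 'v::ab_group_add) scaling \<Rightarrow> ('v \<Rightarrow> 'v) \<Rightarrow> bool"
  where "locally_finite scale u \<longleftrightarrow>
    (\<forall>x. \<exists>n c. (\<exists>k\<le>n. c k \<noteq> 0) \<and> (\<Sum>k\<le>n. scale (c k) ((u ^^ k) x)) = 0)"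

definition involutions :: "('a::field, 'v::ab_group_add) scaling \<Rightarrow> ('v \<Rightarrow> 'v) set"
  where "involutions scale = {a \<in> GL scale. a \<circ> a = id}"

definition similar ::
    "('a::field, 'v::ab_group_add) scaling \<Rightarrow> ('v \<Rightarrow> 'v) \<Rightarrow> ('v \<Rightarrow> 'v) \<Rightarrow> bool"
  where "similar scale u v \<longleftrightarrow> (\<exists>\<phi>\<in>GL scale. v = \<phi> \<circ> u \<circ> inv_into UNIV \<phi>)"

text \<open>\<open>poly_apply scale r u\<close> is \<open>r(u)\<close>, and \<open>endo_module scale u\<close> is \<open>V\<^sup>u\<close>.\<close>

definition poly_apply ::
    "('a::field, 'v::ab_group_add) scaling \<Rightarrow> 'a poly \<Rightarrow> ('v \<Rightarrow> 'v) \<Rightarrow> 'v \<Rightarrow> 'v"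
  where "poly_apply scale r u x = (\<Sum>k\<le>degree r. scale (coeff r k) ((u ^^ k) x))"

definition endo_module ::
    "('a::field, 'v::ab_group_add) scaling \<Rightarrow> ('v \<Rightarrow> 'v) \<Rightarrow> ('a poly, 'v) module"
  where "endo_module scale u =
    \<lparr>carrier = UNIV, mult = undefined, one = undefined, zero = 0, add = (+),
     smult = (\<lambda>r. poly_apply scale r u)\<rparr>"

section \<open>Kaplansky invariants\<close>

definition power_submodule ::
    "('a::field, 'v::ab_group_add) scaling \<Rightarrow> 'a poly \<Rightarrow> ('v \<Rightarrow> 'v) \<Rightarrow> omega1 \<Rightarrow> 'v set"
  where "power_submodule scale p u \<alpha> = iterated_image (poly_apply scale p u) \<alpha>"

definition power_submodule_infinity ::
    "('a::field, 'v::ab_group_add) scaling \<Rightarrow> 'a poly \<Rightarrow> ('v \<Rightarrow> 'v) \<Rightarrow> 'v set"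
  where "power_submodule_infinity scale p u = iterated_image_final (poly_apply scale p u)"

text \<open>The quotient of \<open>p\<^sup>\<alpha>(V\<^sup>u)\<close> by \<open>p\<^sup>\<alpha>\<^sup>+\<^sup>1(V\<^sup>u)\<close>, and the kernel of the map that \<open>p(u)\<close>
  induces from it to the next such quotient.\<close>

definition layer ::
    "('a::field, 'v::ab_group_add) scaling \<Rightarrow> 'a poly \<Rightarrow> ('v \<Rightarrow> 'v) \<Rightarrow> omega1
      \<Rightarrow> ('a poly, 'v set) module"
  where "layer scale p u \<alpha> =
    quotient_module (endo_module scale u\<lparr>carrier := power_submodule scale p u \<alpha>\<rparr>)
      (power_submodule scale p u (osucc \<alpha>))"

definition layer_map ::
    "('a::field, 'v::ab_group_add) scaling \<Rightarrow> 'a poly \<Rightarrow> ('v \<Rightarrow> 'v) \<Rightarrow> omega1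
      \<Rightarrow> 'v set \<Rightarrow> 'v set"
  where "layer_map scale p u \<alpha> =
    induced_map (endo_module scale u\<lparr>carrier := power_submodule scale p u (osucc \<alpha>)\<rparr>)
      (power_submodule scale p u (osucc (osucc \<alpha>))) (poly_apply scale p u)"

definition layer_kernel ::
    "('a::field, 'v::ab_group_add) scaling \<Rightarrow> 'a poly \<Rightarrow> ('v \<Rightarrow> 'v) \<Rightarrow> omega1 \<Rightarrow> 'v set set"
  where "layer_kernel scale p u \<alpha> =
    {X \<in> carrier (layer scale p u \<alpha>).
      layer_map scale p u \<alpha> X = \<zero>\<^bsub>layer scale p u (osucc \<alpha>)\<^esub>}"

definition kappa ::
    "('a::field, 'v::ab_group_add) scaling \<Rightarrow> omega1 \<Rightarrow> ('v \<Rightarrow> 'v) \<Rightarrow> 'a poly \<Rightarrow> 'v set rel"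
  where "kappa scale \<alpha> u p =
    dimension (residue_field p)
      (over_residue_field (layer scale p u \<alpha>\<lparr>carrier := layer_kernel scale p u \<alpha>\<rparr>))"

definition kappa_infinity ::
    "('a::field, 'v::ab_group_add) scaling \<Rightarrow> ('v \<Rightarrow> 'v) \<Rightarrow> 'a poly \<Rightarrow> 'v rel"
  where "kappa_infinity scale u p =
    dimension (residue_field p)
      (over_residue_field (endo_module scale u
        \<lparr>carrier := {x. poly_apply scale p u x = 0} \<inter> power_submodule_infinity scale p u\<rparr>))"

end

theory Submission
  imports Defs "HOL-Library.Product_Plus"
begin

text \<open>If \<open>u = a b\<close> with involutions \<open>a\<close>, \<open>b\<close>, then \<open>a\<close> conjugates \<open>u\<close> to its inverse \<open>v\<close>. Up to a
  bijection commuting with \<open>p(v)\<close>, the endomorphism \<open>p\<^sup>\<sharp>(u)\<close> is \<open>p(v)\<close>, so the Kaplansky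
  invariants of \<open>u\<close> at \<open>p\<^sup>\<sharp>\<close> are those of \<open>v\<close> at \<open>p\<close>; in particular they agree with those of \<open>u\<close> at \<open>p\<close>
  when \<open>u\<close> and \<open>v\<close> are similar.

  Conversely, \<open>V\<close> is the direct sum of its \<open>p\<close>-primary parts, and an involution \<open>a\<close> with
  \<open>a u a = v\<close>, whence \<open>u = a (a u)\<close>, is glued from graphs of isomorphisms between the
  \<open>p\<close>-primary parts for \<open>u\<close> and for \<open>v\<close>, where the graph at \<open>p\<^sup>\<sharp>\<close> is the converse of the graph at \<open>p\<close>.
  If \<open>p \<noteq> p\<^sup>\<sharp>\<close>, Ulm's theorem provides such a graph. Its back-and-forth proof is run with finite
  sets \<open>Z\<close> of pairs that are mapped to \<open>Z \<union> {0}\<close> by \<open>p\<close> and that determine heights on both sides, so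
  that it also shows the primary parts to be simply presented. If \<open>p = p\<^sup>\<sharp>\<close>, the basis
  elements \<open>x\<close> of a simple presentation can be sent to \<open>E(u)\<^sup>k x\<close>, where \<open>E = t\<^sup>d / p(0)\<close> with
  \<open>d = degree p\<close> and \<open>p\<^sup>k\<close> is the order of \<open>x\<close>; this extends to an isomorphism that is an involution.\<close>

section \<open>Modules over a polynomial ring with a height function\<close>

text \<open>The invariants at \<open>p\<close> and at its reciprocal are dimensions over two
  different residue fields. They are compared through ranks over the ground field: both residue
  fields have dimension \<open>degree p\<close> over it, and as all dimensions are countable, these
  ranks determine the cardinals. One countable ordinal \<open>lam\<close> stabilises the images of
  both p(u) and p(v). Capping heights there makes the invariant at infinity one more layer, so
  divisible and reduced parts are never separated. Heights are taken in all of V; a layer element is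
  first corrected to one annihilated by \<open>p\<close> before it is matched. The obstacle is a
  self-reciprocal \<open>p\<close>: a graph from Ulm's theorem need not be its own converse. A
  canonical choice on generators is then required, and it only has to respect the relations among
  them. In a simple presentation these merely say which generator or zero \<open>p x\<close> is. To
  obtain one, each extension step must enlarge a basis, not just a finitely generated submodule;
  hence the explicit supply of predecessors (elements \<open>w\<close> with
  \<open>p w = z\<close>).\<close>

lemma irreducible_poly_degree_pos:
  fixes p :: "'a::field poly"
  assumes "irreducible p"
  shows "degree p > 0"
proof -
  have "p \<noteq> 0" "\<not> p dvd 1" using assms by (auto simp: irreducible_def)
  then show ?thesis by (auto simp: is_unit_iff_degree)
qed

lemma poly_bezout:
  fixes f g :: "'a::field poly"
  shows "\<exists>a b. (a * f + b * g) dvd f \<and> (a * f + b * g) dvd g"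
proof (induction g arbitrary: f rule: measure_induct_rule[where f = "\<lambda>g. if g = 0 then 0 else Suc (degree g)"])
  case (less g)
  show ?case
  proof (cases "g = 0")
    case True
    then show ?thesis by (intro exI[of _ 1] exI[of _ 0]) auto
  next
    case False
    have "(if f mod g = 0 then 0 else Suc (degree (f mod g))) < (if g = 0 then 0 else Suc (degree g))"
      using False degree_mod_less[of g f] by auto
    from less.IH[OF this, of g] obtain a b where
      ab: "(a * g + b * (f mod g)) dvd g" "(a * g + b * (f mod g)) dvd f mod g" by blast
    have "f = f div g * g + f mod g" by simp
    then have f: "(a * g + b * (f mod g)) dvd f" using ab by (metis dvd_add dvd_mult)
    have e: "a * g + b * (f mod g) = b * f + (a - b * (f div g)) * g"
      by (simp add: minus_div_mult_eq_mod[symmetric] algebra_simps)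
    show ?thesis using ab(1) f unfolding e by blast
  qed
qed

lemma irreducible_poly_bezout:
  fixes p f :: "'a::field poly"
  assumes "irreducible p" "\<not> p dvd f"
  shows "\<exists>a b. a * p + b * f = 1"
proof -
  obtain a b where ab: "(a * p + b * f) dvd p" "(a * p + b * f) dvd f" using poly_bezout by blast
  then obtain k where k: "p = (a * p + b * f) * k" by (auto elim: dvdE)
  with assms(1) have "(a * p + b * f) dvd 1 \<or> k dvd 1" unfolding irreducible_def by blast
  then show ?thesis
  proof
    assume "k dvd 1"
    then have "p dvd a * p + b * f" using k by (metis dvd_def dvd_refl mult_unit_dvd_iff)
    then show ?thesis using ab(2) assms(2) dvd_trans by blast
  next
    assume "(a * p + b * f) dvd 1"
    then obtain k where "1 = (a * p + b * f) * k" by (auto elim: dvdE)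
    then have "(k * a) * p + (k * b) * f = 1" by (simp add: algebra_simps)
    then show ?thesis by blast
  qed
qed

text \<open>Modulo \<open>f\<close> the product \<open>a * p\<close> is 1, hence so are all its
  powers.\<close>

lemma irreducible_poly_bezout_power:
  fixes p f :: "'a::field poly"
  assumes "irreducible p" "\<not> p dvd f"
  shows "\<exists>a b. a * p ^ k + b * f = 1"
proof -
  obtain a b where ab: "a * p + b * f = 1" using irreducible_poly_bezout[OF assms] by blast
  have "\<exists>c. (a * p) ^ k = 1 - c * f"
  proof (induction k)
    case 0
    show ?case by (rule exI[of _ 0]) simp
  next
    case (Suc k)
    then obtain c where c: "(a * p) ^ k = 1 - c * f" by blast
    have "a * p = 1 - b * f" using ab by (simp add: algebra_simps)
    then have "(a * p) ^ Suc k = (1 - b * f) * (1 - c * f)" using c by simp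
    also have "\<dots> = 1 - (b + c - b * c * f) * f" by (simp add: algebra_simps)
    finally show ?case by blast
  qed
  then obtain c where "(a * p) ^ k = 1 - c * f" by blast
  then have "a ^ k * p ^ k + c * f = 1" by (simp add: power_mult_distrib)
  then show ?thesis by blast
qed

text \<open>The height guaranteed for \<open>p x\<close> when \<open>x\<close> has height
  \<open>a\<close>: one step is gained below the ordinal \<open>l\<close> at which the images become
  stationary, none from there on.\<close>

definition capped_succ :: "omega1 \<Rightarrow> omega1 \<Rightarrow> omega1"
  where "capped_succ l a = (if a < l then osucc a else l)"

lemma le_osucc_cases: "a \<le> osucc b \<longleftrightarrow> a \<le> b \<or> a = osucc b"
  by (metis le_less_linear less_osucc not_le order.order_iff_strict order.trans osucc_le_iff)

lemma less_osucc_iff: "a < osucc b \<longleftrightarrow> a \<le> b"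
  by (metis not_le osucc_le_iff)

lemma capped_succ_mono: "a \<le> b \<Longrightarrow> capped_succ l a \<le> capped_succ l b"
  by (auto simp: capped_succ_def osucc_le_iff less_osucc_iff)

lemma capped_succ_le: "capped_succ l a \<le> l"
  by (auto simp: capped_succ_def osucc_le_iff)

lemma capped_succ_self [simp]: "capped_succ l l = l"
  by (simp add: capped_succ_def)

definition reduced :: "'a::field poly \<Rightarrow> ('b \<Rightarrow> 'a poly) \<Rightarrow> bool"
  where "reduced p c \<longleftrightarrow> (\<forall>z. degree (c z) < degree p)"

locale poly_module = Modules.module act
  for act :: "'a::field poly \<Rightarrow> 'm::ab_group_add \<Rightarrow> 'm"

lemma (in Modules.module) span_UN_incseq:
  assumes X: "incseq X"
  shows "(\<Union>n::nat. span (X n)) = span (\<Union>n. X n)"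
proof
  show "(\<Union>n. span (X n)) \<subseteq> span (\<Union>n. X n)" by (intro UN_least span_mono) blast
  show "span (\<Union>n. X n) \<subseteq> (\<Union>n. span (X n))"
  proof
    fix w assume "w \<in> span (\<Union>n. X n)"
    then show "w \<in> (\<Union>n. span (X n))"
    proof (induction rule: span_induct_alt)
      case base
      show ?case using span_zero by blast
    next
      case (step r x y)
      then obtain m n where "x \<in> X m" "y \<in> span (X n)" by blast
      then have "x \<in> span (X (max m n))" "y \<in> span (X (max m n))"
        using span_mono[OF incseqD[OF X, of n "max m n"]] incseqD[OF X, of m "max m n"]
        by (auto intro: span_base)
      then show ?case using span_add[OF span_scale] by blast
    qed
  qed
qed

locale torsion_base = poly_module act
  for act :: "'a::field poly \<Rightarrow> 'm::ab_group_add \<Rightarrow> 'm" +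
  fixes p :: "'a poly"
  assumes irr: "irreducible p"
begin

definition comb :: "('m \<Rightarrow> 'a poly) \<Rightarrow> 'm set \<Rightarrow> 'm"
  where "comb c Z = (\<Sum>z\<in>Z. act (c z) z)"

definition p_closed :: "'m set \<Rightarrow> bool"
  where "p_closed Z \<longleftrightarrow> (\<forall>z\<in>Z. act p z \<in> insert 0 Z)"

lemma degree_p: "degree p > 0"
  by (rule irreducible_poly_degree_pos[OF irr])

lemma reduced_add: "reduced p c \<Longrightarrow> reduced p e \<Longrightarrow> reduced p (\<lambda>z. c z + e z)"
  by (auto simp: reduced_def intro: degree_add_less)

lemma reduced_sum: "(\<And>i. i \<in> I \<Longrightarrow> reduced p (f i)) \<Longrightarrow> reduced p (\<lambda>z. \<Sum>i\<in>I. f i z)"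
proof (induction I rule: infinite_finite_induct)
  case (insert x F)
  have "reduced p (\<lambda>z. f x z + (\<Sum>i\<in>F. f i z))" using insert by (intro reduced_add) auto
  then show ?case using insert by simp
qed (auto simp: reduced_def degree_p)

lemma comb_in_span: "comb c Z \<in> span Z"
  unfolding comb_def by (intro span_sum span_scale span_base)

lemma comb_add: "comb c Z + comb e Z = comb (\<lambda>z. c z + e z) Z"
  by (simp add: comb_def sum.distrib scale_left_distrib)

lemma comb_single: "finite Z \<Longrightarrow> w \<in> Z \<Longrightarrow> comb (\<lambda>z. if z = w then r else 0) Z = act r w"
  unfolding comb_def by (subst sum.remove[of Z w]) (auto intro!: sum.neutral)

text \<open>Since \<open>p\<close> maps \<open>Z\<close> into itself and 0, multiplying by
  \<open>p\<close> only moves coefficients along this map: the new coefficient at \<open>z\<close>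
  collects those of the predecessors of \<open>z\<close>. No degree grows. The explicit formula
  later serves to detect predecessors.\<close>

lemma act_p_comb:
  assumes Z: "finite Z" "p_closed Z" and c: "reduced p c"
  shows "\<exists>e. reduced p e \<and> act p (comb c Z) = comb e Z
    \<and> (\<forall>z. e z = (\<Sum>w | w \<in> Z \<and> act p w = z. c w))"
proof (intro exI conjI allI)
  let ?e = "\<lambda>z. \<Sum>w | w \<in> Z \<and> act p w = z. c w"
  have "reduced p (\<lambda>z. \<Sum>w\<in>Z. (\<lambda>w z. if act p w = z then c w else 0) w z)"
    by (rule reduced_sum) (use c degree_p in \<open>auto simp: reduced_def\<close>)
  moreover have "(\<Sum>w\<in>Z. if act p w = z then c w else 0) = ?e z" for z
    using Z(1) by (simp add: sum.If_cases Int_def)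
  ultimately show "reduced p ?e" by simp
  have "act p (comb c Z) = (\<Sum>w\<in>Z. act (c w) (act p w))"
    unfolding comb_def scale_sum_right by (simp add: mult.commute)
  also have "\<dots> = (\<Sum>z\<in>insert 0 Z. \<Sum>w | w \<in> Z \<and> act p w = z. act (c w) (act p w))"
    by (rule sum.group[symmetric]) (use Z in \<open>auto simp: p_closed_def\<close>)
  also have "\<dots> = (\<Sum>z\<in>insert 0 Z. act (?e z) z)"
    by (intro sum.cong refl) (auto simp: scale_sum_left intro!: sum.cong)
  also have "\<dots> = comb ?e Z"
    unfolding comb_def using Z(1) by (cases "0 \<in> Z") (auto simp: insert_absorb)
  finally show "act p (comb c Z) = comb ?e Z" .
qed simp

text \<open>Division with remainder writes \<open>t * c z\<close> as \<open>p * q z + r z\<close>;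
  the carry \<open>q\<close> is pushed one step along \<open>Z\<close> by
  \<open>act_p_comb\<close>.\<close>

lemma act_shift_comb:
  assumes Z: "finite Z" "p_closed Z" and c: "reduced p c"
  shows "\<exists>e. reduced p e \<and> act [:0, 1:] (comb c Z) = comb e Z"
proof -
  define q where "q z = ([:0, 1:] * c z) div p" for z
  define r where "r z = ([:0, 1:] * c z) mod p" for z
  have p0: "p \<noteq> 0" using degree_p by auto
  have r: "reduced p r"
    unfolding reduced_def r_def
  proof
    fix z
    show "degree (([:0, 1:] * c z) mod p) < degree p"
      using degree_mod_less[OF p0, of "[:0, 1:] * c z"] degree_p by (elim disjE) simp_all
  qed
  have q: "reduced p q"
  proof (unfold reduced_def, rule allI)
    fix z
    show "degree (q z) < degree p"
    proof (cases "q z = 0")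
      case False
      have "degree (c z) < degree p" using c by (auto simp: reduced_def)
      then have 1: "degree ([:0, 1:] * c z) \<le> degree p"
        using degree_mult_le[of "[:0, 1:]" "c z"] by simp
      have "[:0, 1:] * c z = q z * p + r z" by (simp add: q_def r_def)
      moreover have "degree (r z) < degree (q z * p)"
        using False p0 r by (simp add: degree_mult_eq reduced_def trans_less_add2)
      ultimately have "degree ([:0, 1:] * c z) = degree (q z) + degree p"
        using False p0 by (simp add: degree_add_eq_left degree_mult_eq)
      then show ?thesis using 1 degree_p by simp
    qed (use degree_p in auto)
  qed
  obtain e where e: "reduced p e" "act p (comb q Z) = comb e Z"
    using act_p_comb[OF Z q] by blast
  have "[:0, 1:] * c z = p * q z + r z" for z by (simp add: q_def r_def)
  then have "act [:0, 1:] (comb c Z) = act p (comb q Z) + comb r Z"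
    unfolding comb_def scale_sum_right sum.distrib[symmetric]
    by (simp only: scale_left_distrib scale_scale)
  also have "\<dots> = comb (\<lambda>z. e z + r z) Z" by (simp add: e comb_add)
  finally show ?thesis using reduced_add[OF e(1) r] by blast
qed

text \<open>Reduced combinations are closed under constants and under multiplication by t, hence
  under all polynomials by induction on \<open>pCons\<close>.\<close>

lemma span_eq_reduced_combs:
  assumes Z: "finite Z" "p_closed Z"
  shows "span Z = {comb c Z | c. reduced p c}"
proof
  let ?W = "{comb c Z | c. reduced p c}"
  have add: "x + y \<in> ?W" if "x \<in> ?W" "y \<in> ?W" for x y
    using that by (auto simp: comb_add intro: reduced_add)
  have const: "act [:a:] x \<in> ?W" if x: "x \<in> ?W" for a x
  proof -
    obtain c where c: "reduced p c" "x = comb c Z" using x by auto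
    have "act [:a:] x = comb (\<lambda>z. [:a:] * c z) Z"
      unfolding c comb_def scale_sum_right by simp
    moreover have "reduced p (\<lambda>z. [:a:] * c z)"
      using c by (auto simp: reduced_def intro: le_less_trans[OF degree_smult_le])
    ultimately show ?thesis by blast
  qed
  have "0 \<in> ?W" using degree_p by (auto simp: comb_def reduced_def intro!: exI[of _ "\<lambda>_. 0"])
  moreover have "act r x \<in> ?W" if "x \<in> ?W" for r x
  proof (induction r)
    case 0
    then show ?case using \<open>0 \<in> ?W\<close> by simp
  next
    case (pCons a r)
    obtain c where c: "reduced p c" "act r x = comb c Z" using pCons by auto
    have "act [:0, 1:] (act r x) \<in> ?W" using act_shift_comb[OF Z c(1)] unfolding c(2) by auto
    then have "act [:a:] x + act [:0, 1:] (act r x) \<in> ?W" by (rule add[OF const[OF that]])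
    moreover have "pCons a r = [:a:] + [:0, 1:] * r" by simp
    ultimately show ?case by (simp only: scale_left_distrib scale_scale)
  qed
  ultimately have "subspace ?W" using add by (simp add: subspace_def)
  moreover have "Z \<subseteq> ?W"
  proof
    fix w assume "w \<in> Z"
    then have "w = comb (\<lambda>z. if z = w then 1 else 0) Z" using comb_single[OF Z(1)] by simp
    then show "w \<in> ?W" using degree_p by (auto simp: reduced_def)
  qed
  ultimately show "span Z \<subseteq> ?W" by (rule span_minimal[rotated])
  show "?W \<subseteq> span Z" using comb_in_span by auto
qed

lemma reduced_unit:
  assumes "c \<noteq> 0" "degree c < degree p"
  shows "\<exists>e q. e * c = 1 + q * p"
proof -
  have "\<not> p dvd c" using assms dvd_imp_degree_le not_less by blast
  then obtain a b where "a * p + b * c = 1" using irreducible_poly_bezout[OF irr] by blast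
  then have "b * c = 1 + (- a) * p" by (simp add: algebra_simps)
  then show ?thesis by blast
qed

end

text \<open>Heights are capped at \<open>lam\<close>, an ordinal at which the transfinite sequence of images is
  stationary; \<open>osucc lam\<close> plays the role of the height of \<open>0\<close>.\<close>

locale valued_module = torsion_base act p
  for act :: "'a::field poly \<Rightarrow> 'm::ab_group_add \<Rightarrow> 'm" and p :: "'a poly" +
  fixes h :: "'m \<Rightarrow> omega1" and lam :: omega1
  assumes h_zero: "h 0 = osucc lam"
    and h_le: "h x \<le> osucc lam"
    and h_add: "min (h x) (h y) \<le> h (x + y)"
    and h_act: "h x \<le> h (act r x)"
    and h_p: "capped_succ lam (h x) \<le> h (act p x)"
begin

text \<open>The notion of Kaplansky and Mackey: \<open>x\<close> has maximal height in its coset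
  modulo \<open>S\<close>.\<close>

definition proper :: "'m \<Rightarrow> 'm set \<Rightarrow> bool"
  where "proper x S \<longleftrightarrow> (\<forall>s\<in>S. h (x + s) \<le> h x)"

text \<open>A basis as in simply presented modules: \<open>p\<close> maps \<open>Z\<close> to \<open>Z \<union> {0}\<close>, and elements of the span are
  combinations with coefficients of degree below \<open>degree p\<close>. The inequality forces their
  heights to be the minima of the heights of the terms, hence uniqueness of the coefficients
  as soon as the elements of \<open>Z\<close> have height at most \<open>lam\<close>.\<close>

definition t_basis :: "'m set \<Rightarrow> bool"
  where "t_basis Z \<longleftrightarrow> finite Z \<and> p_closed Z \<and>
    (\<forall>c. reduced p c \<longrightarrow> (\<forall>z\<in>Z. c z \<noteq> 0 \<longrightarrow> h (comb c Z) \<le> h z))"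

lemma h_addI: "a \<le> h x \<Longrightarrow> a \<le> h y \<Longrightarrow> a \<le> h (x + y)"
  using h_add[of x y] by (metis min.boundedI order.trans)

lemma h_minus: "h (- x) = h x"
proof (rule antisym)
  show "h x \<le> h (- x)" using h_act[of x "- 1"] by simp
  show "h (- x) \<le> h x" using h_act[of "- x" "- 1"] by simp
qed

lemma h_diffI: "a \<le> h x \<Longrightarrow> a \<le> h y \<Longrightarrow> a \<le> h (x - y)"
  using h_addI[of a x "- y"] by (simp add: h_minus)

lemma h_add_eq: "h x < h y \<Longrightarrow> h (x + y) = h x"
  using h_addI[of "h x" x y] h_diffI[of "h (x + y)" "x + y" y] h_diffI[of "h y" "x + y" y]
  by (metis add_diff_cancel_right' leD le_cases less_imp_le antisym)

lemma h_sumI: "a \<le> osucc lam \<Longrightarrow> (\<And>i. i \<in> I \<Longrightarrow> a \<le> h (f i)) \<Longrightarrow> a \<le> h (sum f I)"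
  by (induction I rule: infinite_finite_induct) (auto simp: h_zero intro: h_addI)

lemma h_pI: "a \<le> h x \<Longrightarrow> capped_succ lam a \<le> h (act p x)"
  using capped_succ_mono h_p order.trans by blast

text \<open>A nonzero reduced \<open>c\<close> has an inverse \<open>e\<close> modulo
  \<open>p\<close>. Applying \<open>e\<close> to \<open>c x + s\<close> gives \<open>x\<close> plus
  an element of \<open>S\<close>, since \<open>p x\<close> is in \<open>S\<close>, and does not
  lower the height. So properness of \<open>x\<close> bounds the height of \<open>c x + s\<close> as
  well.\<close>

lemma proper_min:
  assumes S: "subspace S" "act p x \<in> S" and x: "proper x S"
    and c: "c \<noteq> 0" "degree c < degree p" and s: "s \<in> S"
  shows "h (act c x + s) = min (h x) (h s)"
proof -
  obtain e q where eq: "e * c = 1 + q * p" using reduced_unit[OF c] by blast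
  have "act e (act c x + s) = act (e * c) x + act e s" by (simp add: scale_right_distrib)
  also have "\<dots> = x + (act q (act p x) + act e s)" by (simp add: eq scale_left_distrib add.assoc)
  finally have "h (act e (act c x + s)) \<le> h x"
    using x subspace_add[OF S(1) subspace_scale[OF S] subspace_scale[OF S(1) s]]
    unfolding proper_def by (simp del: scale_scale)
  then have 1: "h (act c x + s) \<le> h x" using h_act order.trans by blast
  have 2: "min (h x) (h s) \<le> h (act c x + s)"
    by (rule h_addI) (auto intro: order.trans[OF min.cobounded1 h_act])
  show ?thesis
  proof (cases "h s < h x")
    case True
    then have "h s < h (act c x)" using h_act less_le_trans by blast
    then have "h (act c x + s) = h s" using h_add_eq[of s "act c x"] by (simp add: add.commute)
    then show ?thesis using True by simp
  next
    case False
    then show ?thesis using 1 2 by (simp add: antisym)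
  qed
qed

lemma span_combE:
  assumes "t_basis Z" "s \<in> span Z"
  obtains c where "reduced p c" "s = comb c Z"
  using assms unfolding t_basis_def by (auto simp: span_eq_reduced_combs)

lemma t_basisD: "t_basis Z \<Longrightarrow> reduced p c \<Longrightarrow> z \<in> Z \<Longrightarrow> c z \<noteq> 0 \<Longrightarrow> h (comb c Z) \<le> h z"
  unfolding t_basis_def by blast

text \<open>The height of a combination is the minimum over the terms with nonzero coefficient.
  Hence only finitely many heights occur in the span.\<close>

lemma span_height:
  assumes Z: "t_basis Z" "s \<in> span Z"
  shows "h s = osucc lam \<or> h s \<in> h ` Z"
proof -
  obtain c where c: "reduced p c" "s = comb c Z" using Z by (rule span_combE)
  define Y where "Y = {z \<in> Z. c z \<noteq> 0}"
  have fin: "finite Y" using Z by (simp add: Y_def t_basis_def)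
  show ?thesis
  proof (cases "Y = {}")
    case True
    then have "s = 0" unfolding c comb_def by (intro sum.neutral) (auto simp: Y_def)
    then show ?thesis by (simp add: h_zero)
  next
    case False
    then have "Min (h ` Y) \<in> h ` Y" using fin by simp
    then obtain y where y: "y \<in> Y" "h y = Min (h ` Y)" by (metis imageE)
    have "h y \<le> h s" unfolding c comb_def
    proof (rule h_sumI)
      show "h y \<le> h (act (c z) z)" if z: "z \<in> Z" for z
      proof (cases "c z = 0")
        case False
        then have "h y \<le> h z" using y fin z by (simp add: Y_def)
        then show ?thesis using h_act order.trans by blast
      qed (simp add: h_zero h_le)
    qed (rule h_le)
    moreover have "h s \<le> h y" using t_basisD[OF Z(1) c(1)] y(1) by (simp add: Y_def c)
    ultimately have "h s = h y" by simp
    moreover have "y \<in> Z" using y(1) by (simp add: Y_def)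
    ultimately show ?thesis by blast
  qed
qed

text \<open>If \<open>z + p s\<close> is higher than \<open>z\<close>, the basis inequality forces
  the coefficient of \<open>z\<close> in it to vanish. So \<open>z\<close> occurs in
  \<open>p s\<close>, and by the formula of \<open>act_p_comb\<close> this comes from some
  \<open>w\<close> over \<open>z\<close> that occurs in \<open>s\<close>.\<close>

lemma predecessor_in_t_basis:
  assumes Z: "t_basis Z" "z \<in> Z" "s \<in> span Z" and gt: "h z < h (z + act p s)"
  shows "\<exists>w\<in>Z. act p w = z \<and> h s \<le> h w"
proof -
  have fin: "finite Z" "p_closed Z" using Z(1) by (auto simp: t_basis_def)
  obtain c where c: "reduced p c" "s = comb c Z" using Z(1,3) by (rule span_combE)
  obtain e where e: "reduced p e" "act p s = comb e Z"
    "\<And>z. e z = (\<Sum>w | w \<in> Z \<and> act p w = z. c w)"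
    using act_p_comb[OF fin c(1)] unfolding c(2) by blast
  define g where "g y = (if y = z then 1 else 0) + e y" for y
  have "reduced p (\<lambda>y. if y = z then 1 else 0)" using degree_p by (simp add: reduced_def)
  then have g: "reduced p g" unfolding g_def using e(1) by (rule reduced_add)
  have "z = comb (\<lambda>y. if y = z then 1 else 0) Z" using comb_single[OF fin(1) Z(2)] by simp
  then have "z + act p s = comb g Z" unfolding e(2) g_def by (metis comb_add)
  then have "\<not> h (comb g Z) \<le> h z" using gt by auto
  then have "g z = 0" using t_basisD[OF Z(1) g Z(2)] by blast
  then have "e z \<noteq> 0" by (auto simp: g_def)
  then have "\<not> (\<forall>w\<in>{w \<in> Z. act p w = z}. c w = 0)"
    unfolding e(3) using sum.neutral[of "{w \<in> Z. act p w = z}" c] by argo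
  then obtain w where "w \<in> Z" "act p w = z" "c w \<noteq> 0" by auto
  then show ?thesis using t_basisD[OF Z(1) c(1), of w] c(2) by blast
qed

text \<open>Each basis element occurring in \<open>p s\<close> is replaced by a predecessor of
  height at least \<open>b\<close>. The result has the same image as \<open>s\<close>, but a height
  that \<open>s\<close> itself may lack.\<close>

lemma lift_in_t_basis:
  assumes Z: "t_basis Z" "s \<in> span Z" and b: "b \<le> osucc lam" "capped_succ lam b \<le> h (act p s)"
    and pred: "\<And>z. z \<in> Z \<Longrightarrow> z \<in> act p ` Z \<Longrightarrow> capped_succ lam b \<le> h z \<Longrightarrow>
      \<exists>w\<in>Z. act p w = z \<and> b \<le> h w"
  shows "\<exists>r\<in>span Z. act p r = act p s \<and> b \<le> h r"
proof -
  have fin: "finite Z" "p_closed Z" using Z(1) by (auto simp: t_basis_def)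
  obtain c where c: "reduced p c" "s = comb c Z" using Z(1,2) by (rule span_combE)
  obtain e where e: "reduced p e" "act p s = comb e Z"
    "\<And>z. e z = (\<Sum>w | w \<in> Z \<and> act p w = z. c w)"
    using act_p_comb[OF fin c(1)] unfolding c(2) by blast
  define Y where "Y = {z \<in> Z. e z \<noteq> 0}"
  have "\<exists>w\<in>Z. act p w = z \<and> b \<le> h w" if z: "z \<in> Y" for z
  proof (rule pred)
    show "z \<in> Z" using z by (simp add: Y_def)
    show "z \<in> act p ` Z"
    proof (rule ccontr)
      assume "z \<notin> act p ` Z"
      then have "e z = 0" unfolding e(3) by (intro sum.neutral) auto
      then show False using z by (simp add: Y_def)
    qed
    show "capped_succ lam b \<le> h z"
      using t_basisD[OF Z(1) e(1), of z] z b(2) unfolding e(2) Y_def by auto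
  qed
  then obtain y where y: "\<And>z. z \<in> Y \<Longrightarrow> y z \<in> Z \<and> act p (y z) = z \<and> b \<le> h (y z)" by metis
  show ?thesis
  proof (intro bexI conjI)
    let ?r = "\<Sum>z\<in>Y. act (e z) (y z)"
    show "?r \<in> span Z" using y by (intro span_sum span_scale span_base) blast
    show "b \<le> h ?r"
      by (intro h_sumI b(1)) (use y h_act order.trans in blast)
    have "act p ?r = (\<Sum>z\<in>Y. act (e z) (act p (y z)))"
      unfolding scale_sum_right by (simp add: mult.commute)
    also have "\<dots> = (\<Sum>z\<in>Y. act (e z) z)" using y by (intro sum.cong refl) simp
    also have "\<dots> = comb e Z" unfolding comb_def Y_def
      by (rule sum.mono_neutral_left) (use fin in auto)
    finally show "act p ?r = act p s" by (simp add: e(2))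
  qed
qed

lemma comb_insert: "finite Z \<Longrightarrow> x \<notin> Z \<Longrightarrow> comb c (insert x Z) = act (c x) x + comb c Z"
  by (simp add: comb_def)

text \<open>\<open>proper_min\<close> makes the height of a combination a minimum again. The formula
  is stated separately because it also shows, in \<open>good_insert\<close>, that heights on two
  sides remain equal.\<close>

lemma t_basis_insert:
  assumes Z: "t_basis Z" and x: "x \<notin> Z" "act p x \<in> insert 0 Z" "proper x (span Z)"
  shows "t_basis (insert x Z)"
    and "reduced p c \<Longrightarrow> h (comb c (insert x Z)) =
      (if c x = 0 then h (comb c Z) else min (h x) (h (comb c Z)))"
proof -
  have fin: "finite Z" "p_closed Z" using Z by (auto simp: t_basis_def)
  have px: "act p x \<in> span Z" using x(2) by (auto intro: span_base span_zero)
  have eq: "h (comb c (insert x Z)) =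
      (if c x = 0 then h (comb c Z) else min (h x) (h (comb c Z)))" if c: "reduced p c" for c
    unfolding comb_insert[OF fin(1) x(1)]
    using proper_min[OF subspace_span px x(3) _ _ comb_in_span, of "c x" c] c by (auto simp: reduced_def)
  then show "reduced p c \<Longrightarrow> h (comb c (insert x Z)) =
      (if c x = 0 then h (comb c Z) else min (h x) (h (comb c Z)))" .
  have "h (comb c (insert x Z)) \<le> h z" if c: "reduced p c" "z \<in> insert x Z" "c z \<noteq> 0" for c z
    using eq[OF c(1)] t_basisD[OF Z c(1), of z] c(2,3) by (auto simp: min.coboundedI2)
  then show "t_basis (insert x Z)" using fin x(2) by (auto simp: t_basis_def p_closed_def)
qed

end

section \<open>Back-and-forth between two modules\<close>

text \<open>These two properties are kept apart because pairs, valued by one component, need not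
  have them: a nonzero pair may have a zero component, and dividing one component by
  \<open>p\<close> says nothing about the other.\<close>

locale height_module = valued_module act p h lam
  for act :: "'a::field poly \<Rightarrow> 'm::ab_group_add \<Rightarrow> 'm" and p h lam +
  assumes h_nonzero: "x \<noteq> 0 \<Longrightarrow> h x \<le> lam"
    and h_div: "b \<le> lam \<Longrightarrow> capped_succ lam b \<le> h z \<Longrightarrow> \<exists>y. act p y = z \<and> b \<le> h y"
begin

lemma h_top: "lam < h x \<longleftrightarrow> x = 0"
  using h_nonzero[of x] by (cases "x = 0") (simp_all add: h_zero less_osucc not_less)

end

definition independent_mod ::
    "('a::field poly \<Rightarrow> 'm::ab_group_add \<Rightarrow> 'm) \<Rightarrow> 'm set \<Rightarrow> nat \<Rightarrow> (nat \<Rightarrow> 'm) \<Rightarrow> bool"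
  where "independent_mod act Q n f \<longleftrightarrow>
    (\<forall>c. (\<Sum>i<n. act [:c i:] (f i)) \<in> Q \<longrightarrow> (\<forall>i<n. c i = 0))"

text \<open>A lower bound for the dimension over the ground field of the image of \<open>A\<close>
  modulo \<open>Q\<close>. Finite bounds suffice because all spaces in question have countable
  dimension.\<close>

definition rank_ge ::
    "('a::field poly \<Rightarrow> 'm::ab_group_add \<Rightarrow> 'm) \<Rightarrow> 'm set \<Rightarrow> 'm set \<Rightarrow> nat \<Rightarrow> bool"
  where "rank_ge act A Q n \<longleftrightarrow> (\<exists>f. (\<forall>i<n. f i \<in> A) \<and> independent_mod act Q n f)"

context valued_module
begin

definition above :: "omega1 \<Rightarrow> 'm set"
  where "above a = {x. a \<le> h x}"

text \<open>Modulo \<open>above (osucc a)\<close> these elements represent the \<open>a\<close>-th Kaplansky invariant when \<open>a < lam\<close>; the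
  case \<open>a = lam\<close>, where only \<open>0\<close> has a greater height, stands for the invariant at infinity.\<close>

definition layer_rep :: "omega1 \<Rightarrow> 'm set"
  where "layer_rep a = {x. a \<le> h x \<and>
    (if a = lam then osucc lam else capped_succ lam (osucc a)) \<le> h (act p x)}"

lemma subspace_above: "a \<le> osucc lam \<Longrightarrow> subspace (above a)"
  by (auto simp: subspace_def above_def h_zero intro: h_addI order.trans[OF _ h_act])

lemma layer_rep_bound: "a \<le> lam \<Longrightarrow> (if a = lam then osucc lam else capped_succ lam (osucc a)) \<le> osucc lam"
  using capped_succ_le[of lam "osucc a"] less_osucc[of lam] by (auto intro: less_imp_le le_less_trans)

lemma subspace_layer_rep:
  assumes a: "a \<le> lam"
  shows "subspace (layer_rep a)"
proof -
  define m where "m = (if a = lam then osucc lam else capped_succ lam (osucc a))"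
  have m: "m \<le> osucc lam" unfolding m_def by (rule layer_rep_bound[OF a])
  have a': "a \<le> osucc lam" using a less_osucc[of lam] by simp
  have rep: "x \<in> layer_rep a \<longleftrightarrow> a \<le> h x \<and> m \<le> h (act p x)" for x by (simp add: layer_rep_def m_def)
  show ?thesis unfolding subspace_def rep
  proof (intro conjI ballI allI)
    fix x y r assume x: "x \<in> layer_rep a"
    have "act p (act r x) = act r (act p x)" by (simp add: mult.commute)
    then show "a \<le> h (act r x)" "m \<le> h (act p (act r x))"
      using x h_act[of x r] h_act[of "act p x" r] unfolding rep by auto
    assume "y \<in> layer_rep a"
    then show "a \<le> h (x + y)" "m \<le> h (act p (x + y))"
      using x unfolding rep by (simp_all add: scale_right_distrib h_addI)
  qed (use a' m in \<open>simp_all add: h_zero\<close>)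
qed

lemma above_subset_layer_rep: "a \<le> lam \<Longrightarrow> above (osucc a) \<subseteq> layer_rep a"
proof
  fix x assume a: "a \<le> lam" and x: "x \<in> above (osucc a)"
  then have "a \<le> h x" using less_osucc[of a] by (auto simp: above_def intro: less_imp_le less_le_trans)
  moreover have "capped_succ lam (osucc a) \<le> h (act p x)" using x h_pI by (simp add: above_def)
  moreover have "osucc lam \<le> h (act p x)" if "a = lam"
    using x that h_act[of x p] by (auto simp: above_def)
  ultimately show "x \<in> layer_rep a" by (simp add: layer_rep_def)
qed

end

text \<open>Then \<open>x - v\<close> is annihilated by \<open>p\<close> and agrees with
  \<open>x\<close> up to greater height. Thus a layer is represented by elements of the
  socle.\<close>

lemma (in height_module) layer_rep_adjust:
  assumes a: "a \<le> lam" and x: "x \<in> layer_rep a"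
  shows "\<exists>v. act p v = act p x \<and> osucc a \<le> h v"
proof (cases "a = lam")
  case True
  then have "act p x = 0" using x h_top by (simp add: layer_rep_def osucc_le_iff)
  then show ?thesis using True by (intro exI[of _ 0]) (simp add: h_zero)
next
  case False
  then have "osucc a \<le> lam" using a by (simp add: osucc_le_iff)
  then show ?thesis using x False by (intro h_div) (simp_all add: layer_rep_def)
qed

context torsion_base
begin

lemma vector_space_const: "vector_space (\<lambda>c. act [:c:])"
proof
  fix a b x y
  show "act [:a:] (x + y) = act [:a:] x + act [:a:] y" by (rule scale_right_distrib)
  show "act [:a + b:] x = act [:a:] x + act [:b:] x"
    using scale_left_distrib[of "[:a:]" "[:b:]"] by simp
  show "act [:a:] (act [:b:] x) = act [:a * b:] x" by (simp add: mult.commute)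
  show "act [:1:] x = x" by (metis one_pCons scale_one)
qed

lemma independent_mod_card:
  assumes fin: "finite T" and f: "\<forall>i<n. f i \<in> Modules.module.span (\<lambda>c. act [:c:]) T"
    and ind: "independent_mod act {0} n f"
  shows "n \<le> card T"
proof -
  interpret F: vector_space "\<lambda>c. act [:c:]" by (rule vector_space_const)
  have inj: "inj_on f {..<n}"
  proof (rule inj_onI, rule ccontr)
    fix i j assume ij: "i \<in> {..<n}" "j \<in> {..<n}" "f i = f j" "i \<noteq> j"
    let ?c = "\<lambda>k. if k = i then 1 else if k = j then - 1 else 0 :: 'a"
    have "(\<Sum>k<n. act [:?c k:] (f k)) = act [:?c i:] (f i) + (\<Sum>k\<in>{..<n} - {i}. act [:?c k:] (f k))"
      by (rule sum.remove) (use ij in auto)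
    also have "(\<Sum>k\<in>{..<n} - {i}. act [:?c k:] (f k)) = act [:?c j:] (f j) + (\<Sum>k\<in>{..<n} - {i} - {j}. act [:?c k:] (f k))"
      by (rule sum.remove) (use ij in auto)
    also have "(\<Sum>k\<in>{..<n} - {i} - {j}. act [:?c k:] (f k)) = 0" by (rule sum.neutral) auto
    finally have "(\<Sum>k<n. act [:?c k:] (f k)) = 0"
      using ij F.scale_minus_left[of 1 "f j"] F.scale_one[of "f j"] by simp
    then have "\<forall>k<n. ?c k = 0"
      using ind unfolding independent_mod_def by (elim allE[of _ ?c]) simp
    then show False using ij(1) by auto
  qed
  have "F.independent (f ` {..<n})"
  proof (rule F.independent_if_scalars_zero)
    fix g x assume g: "(\<Sum>x\<in>f ` {..<n}. act [:g x:] x) = 0" and x: "x \<in> f ` {..<n}"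
    have "(\<Sum>i<n. act [:g (f i):] (f i)) = 0" using g by (simp add: sum.reindex[OF inj])
    then have "\<forall>i<n. g (f i) = 0"
      using ind unfolding independent_mod_def by (auto dest: spec[of _ "\<lambda>i. g (f i)"])
    then show "g x = 0" using x by auto
  qed simp
  then have "card (f ` {..<n}) \<le> card T"
    using F.independent_span_bound[OF fin] f by blast
  then show "n \<le> card T" by (simp add: card_image[OF inj])
qed

lemma act_in_const_span:
  assumes c: "degree c < degree p" and T: "\<And>i. i < degree p \<Longrightarrow> act (monom 1 i) z \<in> T"
  shows "act c z \<in> Modules.module.span (\<lambda>c. act [:c:]) T"
proof -
  interpret F: vector_space "\<lambda>c. act [:c:]" by (rule vector_space_const)
  have "c = (\<Sum>i\<le>degree c. monom (coeff c i) i)" by (rule poly_as_sum_of_monoms[symmetric])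
  also have "\<dots> = (\<Sum>i\<le>degree c. [:coeff c i:] * monom 1 i)" by (simp add: smult_monom)
  finally have "act c z = act (\<Sum>i\<le>degree c. [:coeff c i:] * monom 1 i) z" by (rule arg_cong)
  also have "\<dots> = (\<Sum>i\<le>degree c. act [:coeff c i:] (act (monom 1 i) z))"
    by (simp only: scale_sum_left scale_scale)
  also have "\<dots> \<in> F.span T" using c by (intro F.span_sum F.span_scale F.span_base T) simp
  finally show ?thesis .
qed

text \<open>The elements \<open>t^i z\<close> with \<open>i < degree p\<close> and \<open>z\<close>
  in \<open>Z\<close> span the submodule over the ground field, and they are finitely many.\<close>

lemma independent_mod_bound:
  assumes Z: "finite Z" "p_closed Z"
  shows "\<exists>m. \<forall>n f. (\<forall>i<n. f i \<in> span Z) \<longrightarrow> independent_mod act {0} n f \<longrightarrow> n \<le> m"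
proof -
  interpret F: vector_space "\<lambda>c. act [:c:]" by (rule vector_space_const)
  define T where "T = (\<lambda>(i, z). act (monom 1 i) z) ` ({..<degree p} \<times> Z)"
  have fin: "finite T" using Z(1) by (simp add: T_def)
  have sp: "span Z \<subseteq> F.span T"
  proof
    fix s assume "s \<in> span Z"
    then obtain c where c: "reduced p c" "s = comb c Z" using span_eq_reduced_combs[OF Z] by auto
    have "act (c z) z \<in> F.span T" if z: "z \<in> Z" for z
    proof (rule act_in_const_span)
      show "degree (c z) < degree p" using c(1) by (simp add: reduced_def)
      fix i assume "i < degree p"
      then have "(i, z) \<in> {..<degree p} \<times> Z" using z by simp
      then show "act (monom 1 i) z \<in> T" unfolding T_def by (rule rev_image_eqI) simp
    qed
    then show "s \<in> F.span T" unfolding c comb_def by (intro F.span_sum)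
  qed
  show ?thesis
  proof (intro exI[of _ "card T"] allI impI)
    fix n f assume f: "\<forall>i<n. f i \<in> span Z" and ind: "independent_mod act {0} n f"
    have "\<forall>i<n. f i \<in> F.span T" using f sp by blast
    then show "n \<le> card T" using independent_mod_card[OF fin _ ind] by blast
  qed
qed

end

definition pair_act :: "('r \<Rightarrow> 'm \<Rightarrow> 'm) \<Rightarrow> ('r \<Rightarrow> 'n \<Rightarrow> 'n) \<Rightarrow> 'r \<Rightarrow> 'm \<times> 'n \<Rightarrow> 'm \<times> 'n"
  where "pair_act act1 act2 r z = (act1 r (fst z), act2 r (snd z))"

lemma fst_pair_act [simp]: "fst (pair_act act1 act2 r z) = act1 r (fst z)"
  and snd_pair_act [simp]: "snd (pair_act act1 act2 r z) = act2 r (snd z)"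
  by (simp_all add: pair_act_def)

locale height_pair = V: height_module act1 p h1 lam + W: height_module act2 p h2 lam
  for act1 :: "'a::field poly \<Rightarrow> 'm::ab_group_add \<Rightarrow> 'm"
    and act2 :: "'a::field poly \<Rightarrow> 'n::ab_group_add \<Rightarrow> 'n"
    and p h1 h2 lam +
  assumes rank_eq: "a \<le> lam \<Longrightarrow> rank_ge act1 (V.layer_rep a) (V.above (osucc a)) n \<longleftrightarrow>
      rank_ge act2 (W.layer_rep a) (W.above (osucc a)) n"
begin

text \<open>One module of pairs carries two height functions, one for each component. A partial
  isomorphism is then just a submodule of pairs, and the results on bases apply to it on both
  sides.\<close>

sublocale L: valued_module "pair_act act1 act2" p "\<lambda>z. h1 (fst z)" lam
proof
  fix x y r r'
  show "pair_act act1 act2 r (x + y) = pair_act act1 act2 r x + pair_act act1 act2 r y"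
    by (simp add: prod_eq_iff V.scale_right_distrib W.scale_right_distrib)
  show "pair_act act1 act2 (r + r') x = pair_act act1 act2 r x + pair_act act1 act2 r' x"
    by (simp add: prod_eq_iff V.scale_left_distrib W.scale_left_distrib)
  show "pair_act act1 act2 r (pair_act act1 act2 r' x) = pair_act act1 act2 (r * r') x"
    by (simp add: prod_eq_iff)
  show "pair_act act1 act2 1 x = x" by (simp add: prod_eq_iff)
qed (use V.irr V.h_zero V.h_le V.h_add V.h_act V.h_p in simp_all)

sublocale R: valued_module "pair_act act1 act2" p "\<lambda>z. h2 (snd z)" lam
  by unfold_locales (use W.h_zero W.h_le W.h_add W.h_act W.h_p in simp_all)

text \<open>The span of a good set is the graph of a height-preserving isomorphism between finitely
  generated submodules: as 0 is the only element of height above \<open>lam\<close>, equal heights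
  let zero correspond to zero only. Nonzero first components keep the heights of \<open>Z\<close> at
  most \<open>lam\<close>, which the uniqueness of coefficients requires.\<close>

definition good :: "('m \<times> 'n) set \<Rightarrow> bool"
  where "good Z \<longleftrightarrow> L.t_basis Z \<and> R.t_basis Z \<and> (\<forall>w\<in>L.span Z. h1 (fst w) = h2 (snd w)) \<and>
    (\<forall>z\<in>Z. fst z \<noteq> 0) \<and> (\<forall>z\<in>Z. \<exists>k. pair_act act1 act2 (p ^ k) z = 0)"

lemma good_empty: "good {}"
  by (simp add: good_def L.t_basis_def R.t_basis_def L.p_closed_def V.h_zero W.h_zero)

lemma good_finite: "good Z \<Longrightarrow> finite Z" "good Z \<Longrightarrow> L.p_closed Z"
  by (auto simp: good_def L.t_basis_def)

lemma good_height: "good Z \<Longrightarrow> w \<in> L.span Z \<Longrightarrow> h1 (fst w) = h2 (snd w)"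
  by (auto simp: good_def)

lemma good_insert:
  assumes Z: "good Z" and z: "pair_act act1 act2 p z \<in> insert 0 Z" "h1 (fst z) = h2 (snd z)" "fst z \<noteq> 0"
    and proper: "L.proper z (L.span Z)" "R.proper z (L.span Z)"
  shows "good (insert z Z)"
proof -
  \<comment> \<open>Otherwise 0 would lie in the coset of \<open>z\<close> modulo the span, and its
    height exceeds that of \<open>z\<close>.\<close>
  have zZ: "z \<notin> Z"
  proof
    assume "z \<in> Z"
    then have "- z \<in> L.span Z" by (intro L.span_neg L.span_base)
    then have "h1 (fst (z + - z)) \<le> h1 (fst z)" using proper(1) unfolding L.proper_def by blast
    then show False using V.h_nonzero[OF z(3)] less_osucc[of lam] by (simp add: V.h_zero)
  qed
  have tL: "L.t_basis Z" and tR: "R.t_basis Z" using Z by (auto simp: good_def)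
  have L: "L.t_basis (insert z Z)" by (rule L.t_basis_insert(1)[OF tL zZ z(1) proper(1)])
  have R: "R.t_basis (insert z Z)" by (rule R.t_basis_insert(1)[OF tR zZ z(1) proper(2)])
  have "h1 (fst w) = h2 (snd w)" if w: "w \<in> L.span (insert z Z)" for w
  proof -
    obtain c where c: "reduced p c" "w = L.comb c (insert z Z)" using L w by (rule L.span_combE)
    show ?thesis
      using L.t_basis_insert(2)[OF tL zZ z(1) proper(1) c(1)] R.t_basis_insert(2)[OF tR zZ z(1) proper(2) c(1)]
        good_height[OF Z L.comb_in_span[of c Z]] z(2) unfolding c(2) by simp
  qed
  moreover have "\<exists>k. pair_act act1 act2 (p ^ k) z = 0"
  proof (cases "pair_act act1 act2 p z = 0")
    case True
    then show ?thesis by (intro exI[of _ 1]) simp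
  next
    case False
    then have "pair_act act1 act2 p z \<in> Z" using z(1) by blast
    then obtain k where "pair_act act1 act2 (p ^ k) (pair_act act1 act2 p z) = 0"
      using Z unfolding good_def by blast
    then have "pair_act act1 act2 (p ^ Suc k) z = 0" by (simp add: mult.commute)
    then show ?thesis by blast
  qed
  ultimately show ?thesis using L R Z z(3) by (auto simp: good_def)
qed

text \<open>Independence modulo \<open>above (osucc b)\<close> implies independence modulo 0, so
  \<open>independent_mod_bound\<close> limits the length of such families and a longest one
  exists.\<close>

lemma span_rank_bound:
  assumes "good Z" "b \<le> lam"
  shows "\<exists>n f. (\<forall>i<n. f i \<in> L.span Z \<and> P (f i)) \<and> independent_mod (pair_act act1 act2) (L.above (osucc b)) n f
    \<and> \<not> (\<exists>f. (\<forall>i<Suc n. f i \<in> L.span Z \<and> P (f i)) \<and> independent_mod (pair_act act1 act2) (L.above (osucc b)) (Suc n) f)"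
proof (rule ccontr)
  define N where "N n \<longleftrightarrow> (\<exists>f. (\<forall>i<n. f i \<in> L.span Z \<and> P (f i)) \<and>
    independent_mod (pair_act act1 act2) (L.above (osucc b)) n f)" for n
  assume "\<not> ?thesis"
  then have step: "N n \<Longrightarrow> N (Suc n)" for n unfolding N_def by blast
  have "N 0" by (simp add: N_def independent_mod_def)
  then have all: "N n" for n by (induction n) (use step in auto)
  obtain m where m: "\<And>n f. \<forall>i<n. f i \<in> L.span Z \<Longrightarrow> independent_mod (pair_act act1 act2) {0} n f \<Longrightarrow> n \<le> m"
    using L.independent_mod_bound[OF good_finite[OF assms(1)]] by blast
  obtain f where f: "\<forall>i<Suc m. f i \<in> L.span Z \<and> P (f i)"
    "independent_mod (pair_act act1 act2) (L.above (osucc b)) (Suc m) f"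
    using all[of "Suc m"] unfolding N_def by blast
  have "0 \<in> L.above (osucc b)"
    using assms(2) less_osucc[of lam] by (simp add: L.above_def V.h_zero osucc_le_iff le_less_trans)
  then have "independent_mod (pair_act act1 act2) {0} (Suc m) f"
    using f(2) unfolding independent_mod_def by auto
  then have "Suc m \<le> m" using f(1) by (intro m) auto
  then show False by simp
qed

text \<open>A counting argument: were every socle element of height \<open>b\<close> on the right improvable by
  \<open>span Z\<close>, a maximal independent family in \<open>span Z\<close> would have the rank of the right layer,
  while on the left the proper element \<open>x\<close> makes it longer.\<close>

lemma socle_transfer:
  assumes Z: "good Z" and b: "b \<le> lam" and x: "act1 p x = 0" "h1 x = b"
    and proper: "\<And>w. w \<in> L.span Z \<Longrightarrow> h1 (x + fst w) \<le> b"
  shows "\<exists>y. act2 p y = 0 \<and> h2 y = b \<and> (\<forall>w\<in>L.span Z. h2 (y + snd w) \<le> b)"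
proof (rule ccontr)
  assume neg: "\<not> ?thesis"
  have sb: "osucc b \<le> osucc lam" using b less_osucc[of lam] by (simp add: osucc_le_iff le_less_trans)
  let ?A = "pair_act act1 act2"
  \<comment> \<open>By equality of heights for \<open>w\<close> and for \<open>p w\<close>, this
    condition on the first component is equivalent to the one on the second.\<close>
  define P where "P w \<longleftrightarrow> fst w \<in> V.layer_rep b" for w :: "'m \<times> 'n"
  have P2: "snd w \<in> W.layer_rep b \<longleftrightarrow> P w" if w: "w \<in> L.span Z" for w
    using good_height[OF Z w] good_height[OF Z L.span_scale[OF w, of p]]
    by (simp add: P_def V.layer_rep_def W.layer_rep_def)
  obtain n f where f: "\<forall>i<n. f i \<in> L.span Z \<and> P (f i)" "independent_mod ?A (L.above (osucc b)) n f"
    and max: "\<not> (\<exists>f. (\<forall>i<Suc n. f i \<in> L.span Z \<and> P (f i)) \<and> independent_mod ?A (L.above (osucc b)) (Suc n) f)"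
    using span_rank_bound[OF Z b, of P] by blast
  \<comment> \<open>Up to greater height \<open>y\<close> equals the socle element
    \<open>y - v\<close>; by the negated claim, some element of the span raises the height of the
    latter above \<open>b\<close>.\<close>
  have dec: "\<exists>w. w \<in> L.span Z \<and> P w \<and> osucc b \<le> h2 (y - snd w)" if y: "y \<in> W.layer_rep b" for y
  proof -
    obtain v where v: "act2 p v = act2 p y" "osucc b \<le> h2 v" using W.layer_rep_adjust[OF b y] by blast
    have hy: "b \<le> h2 y" using y by (simp add: W.layer_rep_def)
    have hv: "b \<le> h2 v" using v(2) less_osucc[of b] by (meson less_imp_le less_le_trans)
    have "\<exists>w\<in>L.span Z. osucc b \<le> h2 ((y - v) + snd w)"
    proof (cases "osucc b \<le> h2 (y - v)")
      case True
      then show ?thesis by (intro bexI[of _ 0] L.span_zero) simp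
    next
      case False
      then have "h2 (y - v) = b" using W.h_diffI[OF hy hv] by (simp add: osucc_le_iff)
      moreover have "act2 p (y - v) = 0" by (simp add: W.scale_right_diff_distrib v(1))
      ultimately obtain w where "w \<in> L.span Z" "\<not> h2 ((y - v) + snd w) \<le> b" using neg by blast
      then show ?thesis by (intro bexI[of _ w]) (simp_all add: osucc_le_iff not_le)
    qed
    then obtain w where w: "w \<in> L.span Z" "osucc b \<le> h2 ((y - v) + snd w)" by blast
    have q: "osucc b \<le> h2 (y - snd (- w))"
      using W.h_addI[OF w(2) v(2)] by (simp add: algebra_simps)
    then have "y - snd (- w) \<in> W.layer_rep b" using W.above_subset_layer_rep[OF b] by (auto simp: W.above_def)
    then have "y - (y - snd (- w)) \<in> W.layer_rep b"
      by (rule W.subspace_diff[OF W.subspace_layer_rep[OF b] y])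
    then have "P (- w)" using P2[OF L.span_neg[OF w(1)]] by simp
    then show ?thesis using q L.span_neg[OF w(1)] by blast
  qed
  define g where "g i = (if i < n then fst (f i) else x)" for i
  have "rank_ge act1 (V.layer_rep b) (V.above (osucc b)) (Suc n)" unfolding rank_ge_def
  proof (intro exI[of _ g] conjI allI impI)
    fix i assume "i < Suc n"
    have "x \<in> V.layer_rep b" using x V.layer_rep_bound[OF b] by (simp add: V.layer_rep_def V.h_zero)
    then show "g i \<in> V.layer_rep b" using f(1) by (simp add: g_def P_def)
  next
    show "independent_mod act1 (V.above (osucc b)) (Suc n) g" unfolding independent_mod_def
    proof (rule allI, rule impI)
      fix c assume "(\<Sum>i<Suc n. act1 [:c i:] (g i)) \<in> V.above (osucc b)"
      moreover define s where "s = (\<Sum>i<n. ?A [:c i:] (f i))"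
      have s: "s \<in> L.span Z" unfolding s_def using f(1) by (intro L.span_sum L.span_scale) auto
      have "(\<Sum>i<n. act1 [:c i:] (g i)) = fst s" unfolding s_def fst_sum by (intro sum.cong refl) (simp add: g_def)
      ultimately have hs: "osucc b \<le> h1 (act1 [:c n:] x + fst s)" by (simp add: V.above_def g_def add.commute)
      \<comment> \<open>Otherwise division by \<open>c n\<close> would yield an element of the coset
        of \<open>x\<close> of height above \<open>b\<close>, contrary to its properness.\<close>
      have cn: "c n = 0"
      proof (rule ccontr)
        assume "c n \<noteq> 0"
        then have "act1 [:inverse (c n):] (act1 [:c n:] x + fst s) = x + fst (?A [:inverse (c n):] s)"
          by (simp add: V.scale_right_distrib one_pCons[symmetric])
        moreover have "osucc b \<le> h1 (act1 [:inverse (c n):] (act1 [:c n:] x + fst s))"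
          using hs V.h_act order.trans by blast
        ultimately show False using proper[OF L.span_scale[OF s, of "[:inverse (c n):]"]]
          by (simp add: osucc_le_iff)
      qed
      then have "s \<in> L.above (osucc b)" using hs by (simp add: L.above_def)
      then have "\<forall>i<n. c i = 0" using f(2) unfolding independent_mod_def s_def by blast
      then show "\<forall>i<Suc n. c i = 0" using cn by (simp add: less_Suc_eq)
    qed
  qed
  then obtain g' where g': "\<forall>i<Suc n. g' i \<in> W.layer_rep b"
    "independent_mod act2 (W.above (osucc b)) (Suc n) g'"
    using rank_eq[OF b] unfolding rank_ge_def by blast
  \<comment> \<open>Replacing each \<open>g' i\<close> by an element of the span changes it by
    greater height only, so independence survives and contradicts the maximality of
    \<open>n\<close>.\<close>
  have "\<forall>i. \<exists>w. i < Suc n \<longrightarrow> w \<in> L.span Z \<and> P w \<and> osucc b \<le> h2 (g' i - snd w)"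
    using dec g'(1) by blast
  then obtain w where w: "\<And>i. i < Suc n \<Longrightarrow> w i \<in> L.span Z \<and> P (w i) \<and> osucc b \<le> h2 (g' i - snd (w i))"
    by metis
  have "independent_mod ?A (L.above (osucc b)) (Suc n) w" unfolding independent_mod_def
  proof (rule allI, rule impI)
    fix c assume "(\<Sum>i<Suc n. ?A [:c i:] (w i)) \<in> L.above (osucc b)"
    moreover have "(\<Sum>i<Suc n. ?A [:c i:] (w i)) \<in> L.span Z" using w by (intro L.span_sum L.span_scale) auto
    ultimately have 1: "osucc b \<le> h2 (snd (\<Sum>i<Suc n. ?A [:c i:] (w i)))"
      using good_height[OF Z, of "\<Sum>i<Suc n. ?A [:c i:] (w i)"] by (simp add: L.above_def)
    have 2: "osucc b \<le> h2 (\<Sum>i<Suc n. act2 [:c i:] (g' i - snd (w i)))"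
      by (rule W.h_sumI[OF sb], rule order.trans[OF _ W.h_act]) (use w in auto)
    have "snd (\<Sum>i<Suc n. ?A [:c i:] (w i)) + (\<Sum>i<Suc n. act2 [:c i:] (g' i - snd (w i)))
        = (\<Sum>i<Suc n. act2 [:c i:] (g' i))"
      unfolding snd_sum sum.distrib[symmetric] snd_pair_act V.scale_right_distrib[symmetric]
      by (intro sum.cong refl) (simp add: W.scale_right_distrib[symmetric])
    then have "(\<Sum>i<Suc n. act2 [:c i:] (g' i)) \<in> W.above (osucc b)"
      using W.h_addI[OF 1 2] by (simp add: W.above_def)
    then show "\<forall>i<Suc n. c i = 0" using g'(2) unfolding independent_mod_def by blast
  qed
  then show False using max w by blast
qed

end

section \<open>Criteria for properness, and maximal heights in cosets\<close>

context valued_module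
begin

text \<open>A height can rise from \<open>y\<close> to \<open>y + s\<close> only by cancellation
  between elements of equal height, and \<open>s\<close> has the height of a basis element or is of
  top height.\<close>

lemma proper_if_height_avoids:
  assumes Z: "t_basis Z" and y: "h y \<notin> h ` Z" "h y \<le> lam"
  shows "proper y (span Z)"
  unfolding proper_def
proof (rule ballI, rule ccontr)
  fix s assume s: "s \<in> span Z" and n: "\<not> h (y + s) \<le> h y"
  then have "h (- y + (y + s)) = h (- y)" by (intro h_add_eq) (simp add: h_minus)
  then have "h s = h y" by (simp add: h_minus)
  then show False using span_height[OF Z s] y less_osucc[of lam] by auto
qed

text \<open>If \<open>y + s\<close> were higher than \<open>c\<close>, its image
  \<open>z + p s\<close> would be higher than \<open>z\<close>, and
  \<open>predecessor_in_t_basis\<close> would give a forbidden predecessor. The case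
  \<open>osucc c = lam\<close> is excluded because there the cap hides the rise in height:
  \<open>z\<close> already has height \<open>lam\<close>, whose best predecessors have height
  \<open>lam\<close>.\<close>

lemma proper_predecessor:
  assumes Z: "t_basis Z" "z \<in> Z" and y: "act p y = z" "c \<le> h y"
    and c: "h z = capped_succ lam c" "c = lam \<or> osucc c < lam"
    and none: "\<And>w. w \<in> Z \<Longrightarrow> act p w = z \<Longrightarrow> \<not> c \<le> h w"
    and s: "s \<in> span Z"
  shows "h (y + s) \<le> c"
proof (rule ccontr)
  assume n: "\<not> h (y + s) \<le> c"
  have "h z < h (act p (y + s))"
  proof (cases "c = lam")
    case True
    then have "osucc lam \<le> h (act p (y + s))"
      using n h_act[of "y + s" p] by (simp add: osucc_le_iff not_le less_le_trans)
    then show ?thesis using c(1) capped_succ_le[of lam c] by (simp add: osucc_le_iff le_less_trans)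
  next
    case False
    then have o: "osucc c < lam" "c < lam" using c(2) less_osucc[of c] by auto
    have "capped_succ lam (osucc c) \<le> h (act p (y + s))"
      by (rule h_pI) (use n in \<open>simp add: osucc_le_iff not_le\<close>)
    then show ?thesis using o c(1) less_osucc[of "osucc c"] by (simp add: capped_succ_def less_le_trans)
  qed
  then have "h z < h (z + act p s)" by (simp add: scale_right_distrib y(1))
  then obtain w where w: "w \<in> Z" "act p w = z" "h s \<le> h w"
    using predecessor_in_t_basis[OF Z s] by blast
  have "c \<le> h ((y + s) - y)" using n y(2) by (intro h_diffI) auto
  then show False using none[OF w(1,2)] w(3) by simp
qed

text \<open>A non-maximal height in the coset is the height of a difference of two of its elements,
  hence of an element of the span. By \<open>span_height\<close> there are finitely many.\<close>

lemma coset_height_max: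
  assumes Z: "t_basis Z"
  shows "\<exists>s\<in>span Z. \<forall>t\<in>span Z. h (x + t) \<le> h (x + s)"
proof (rule ccontr)
  assume n: "\<not> ?thesis"
  define H where "H = (\<lambda>s. h (x + s)) ` span Z"
  have up: "\<exists>b\<in>H. a < b" if a: "a \<in> H" for a
    using a n unfolding H_def by (auto simp: not_le)
  have "H \<subseteq> insert (osucc lam) (h ` Z)"
  proof
    fix a assume "a \<in> H"
    then obtain s t where st: "s \<in> span Z" "t \<in> span Z" "a = h (x + s)" "h (x + s) < h (x + t)"
      using up[of a] unfolding H_def by auto
    have "h ((x + s) + - (x + t)) = h (x + s)" by (rule h_add_eq) (simp only: h_minus st(4))
    then have "a = h (s - t)" using st(3) by simp
    then show "a \<in> insert (osucc lam) (h ` Z)" using span_height[OF Z span_diff[OF st(1,2)]] by auto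
  qed
  then have fin: "finite H" by (rule finite_subset) (use Z in \<open>simp add: t_basis_def\<close>)
  have "h (x + 0) \<in> H" unfolding H_def by (intro imageI span_zero)
  then have "Max H \<in> H" using fin by (intro Max_in) auto
  then obtain b where "b \<in> H" "Max H < b" using up by blast
  then show False using Max_ge[OF fin] by (auto simp: not_le[symmetric])
qed

end

section \<open>Enlarging finite partial isomorphisms\<close>

context height_pair
begin

abbreviation pair_mult where "pair_mult \<equiv> pair_act act1 act2 p"

lemma good_height_le: "good Z \<Longrightarrow> z \<in> Z \<Longrightarrow> h1 (fst z) \<le> lam"
  unfolding good_def using V.h_nonzero by blast

lemma good_height_base: "good Z \<Longrightarrow> z \<in> Z \<Longrightarrow> h1 (fst z) = h2 (snd z)"
  using good_height L.span_base by blast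

lemma goodD: "good Z \<Longrightarrow> L.t_basis Z" "good Z \<Longrightarrow> R.t_basis Z" "good Z \<Longrightarrow> z \<in> Z \<Longrightarrow> fst z \<noteq> 0"
  by (auto simp: good_def)

text \<open>If no basis element serves, \<open>z\<close> is divided by \<open>p\<close> on both
  sides. The absence of predecessors of height \<open>c\<close> holds on both sides because heights
  agree, so \<open>proper_predecessor\<close> applies twice; with \<open>s = 0\<close> it also pins
  both heights to \<open>c\<close>.\<close>

lemma add_predecessor_successor:
  assumes Z: "good Z" "z \<in> Z" and c: "c \<le> lam" "h1 (fst z) = capped_succ lam c" "c = lam \<or> osucc c < lam"
  shows "\<exists>w. good (insert w Z) \<and> pair_mult w = z \<and> c \<le> h1 (fst w)"
proof (cases "\<exists>w\<in>Z. pair_mult w = z \<and> c \<le> h1 (fst w)")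
  case True
  then show ?thesis using Z(1) by (metis insert_absorb)
next
  case False
  then have noL: "\<And>w. w \<in> Z \<Longrightarrow> pair_mult w = z \<Longrightarrow> \<not> c \<le> h1 (fst w)" by blast
  then have noR: "\<And>w. w \<in> Z \<Longrightarrow> pair_mult w = z \<Longrightarrow> \<not> c \<le> h2 (snd w)"
    using good_height_base[OF Z(1)] by simp
  have hz: "h2 (snd z) = capped_succ lam c" using c(2) good_height_base[OF Z] by simp
  obtain y1 y2 where y: "act1 p y1 = fst z" "c \<le> h1 y1" "act2 p y2 = snd z" "c \<le> h2 y2"
    using V.h_div[of c "fst z"] W.h_div[of c "snd z"] c hz by auto
  define y where "y = (y1, y2)"
  have yz: "pair_mult y = z" by (simp add: y_def prod_eq_iff y)
  have L: "h1 (fst (y + s)) \<le> c" if "s \<in> L.span Z" for s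
    by (rule L.proper_predecessor[OF goodD(1)[OF Z(1)] Z(2) yz _ c(2,3) noL that]) (simp_all add: y_def y)
  have R: "h2 (snd (y + s)) \<le> c" if "s \<in> L.span Z" for s
    by (rule R.proper_predecessor[OF goodD(2)[OF Z(1)] Z(2) yz _ hz c(3) noR that]) (simp_all add: y_def y)
  have eq: "h1 (fst y) = c" "h2 (snd y) = c"
    using L[OF L.span_zero] R[OF L.span_zero] y(2,4) by (simp_all add: y_def)
  have "good (insert y Z)"
  proof (rule good_insert[OF Z(1)])
    show "pair_mult y \<in> insert 0 Z" using yz Z(2) by simp
    show "fst y \<noteq> 0" using y(1) goodD(3)[OF Z] by (auto simp: y_def)
    show "L.proper y (L.span Z)" "R.proper y (L.span Z)"
      using L R eq by (simp_all add: L.proper_def R.proper_def)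
  qed (simp add: eq)
  then show ?thesis using yz eq by (intro exI[of _ y]) simp
qed

lemma socle_height_transfer:
  assumes "act1 p x = 0" "h1 x \<le> lam"
  shows "\<exists>y. act2 p y = 0 \<and> h2 y = h1 x"
  using socle_transfer[OF good_empty assms(2) assms(1) refl] by auto

text \<open>Below a limit there is room to choose a predecessor whose height differs from all
  heights in \<open>Z\<close>; it is then proper for free by \<open>proper_if_height_avoids\<close>.
  The remaining task is to realise exactly the same height on the right.\<close>

lemma add_predecessor_limit:
  assumes Z: "good Z" "z \<in> Z" and b: "b < h1 (fst z)"
    and lim: "h1 (fst z) < lam" "\<And>a. a < h1 (fst z) \<Longrightarrow> osucc a < h1 (fst z)"
  shows "\<exists>w. good (insert w Z) \<and> pair_mult w = z \<and> b \<le> h1 (fst w)"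
proof -
  define g where "g = h1 (fst z)"
  have g: "g \<le> lam" using good_height_le[OF Z] by (simp add: g_def)
  \<comment> \<open>A predecessor higher than \<open>Max H\<close>, and necessarily lower than
    \<open>g\<close>, avoids all heights of \<open>Z\<close>.\<close>
  define H where "H = insert b {a \<in> (\<lambda>w. h1 (fst w)) ` Z. a < g}"
  have fin: "finite H" using good_finite(1)[OF Z(1)] by (simp add: H_def)
  have "Max H \<in> H" using fin by (intro Max_in) (auto simp: H_def)
  then have m: "Max H < g" using b by (auto simp: H_def g_def)
  have div: "\<exists>y1 y2. act1 p y1 = fst z \<and> osucc a \<le> h1 y1 \<and> act2 p y2 = snd z \<and> osucc a \<le> h2 y2" if a: "a < g" for a
  proof -
    have o: "osucc a < g" "osucc (osucc a) < g" using lim(2) a by (auto simp: g_def)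
    then have "osucc a \<le> lam" "capped_succ lam (osucc a) \<le> h1 (fst z)"
      using g lim(1) by (auto simp: capped_succ_def g_def[symmetric])
    then show ?thesis using V.h_div[of "osucc a" "fst z"] W.h_div[of "osucc a" "snd z"] good_height_base[OF Z] by auto
  qed
  obtain y1 where y1: "act1 p y1 = fst z" "osucc (Max H) \<le> h1 y1" using div[OF m] by blast
  define e where "e = h1 y1"
  have eg: "e < g"
  proof (rule ccontr)
    assume "\<not> e < g"
    then have ge: "g \<le> e" by simp
    have "capped_succ lam e \<le> g" using V.h_p[of y1] y1(1) by (simp add: e_def g_def)
    then show False using ge less_osucc[of e] lim(1) by (auto simp: capped_succ_def g_def split: if_splits)
  qed
  \<comment> \<open>Predecessors higher than \<open>e\<close> on both sides. The difference
    \<open>y1 - y1'\<close> is annihilated by \<open>p\<close> and has height \<open>e\<close>; its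
    counterpart \<open>n\<close> on the right, added to the higher \<open>y2'\<close>, yields height
    exactly \<open>e\<close>.\<close>
  obtain y1' y2' where y1': "act1 p y1' = fst z" "osucc e \<le> h1 y1'"
    and y2': "act2 p y2' = snd z" "osucc e \<le> h2 y2'" using div[OF eg] by blast
  have "h1 (y1 + - y1') = h1 y1"
    by (rule V.h_add_eq) (use y1' in \<open>simp add: V.h_minus e_def[symmetric] osucc_le_iff\<close>)
  moreover have "act1 p (y1 + - y1') = 0" by (simp add: V.scale_right_diff_distrib y1 y1')
  moreover have "e \<le> lam" using eg g by simp
  ultimately obtain n where n: "act2 p n = 0" "h2 n = e"
    using socle_height_transfer[of "y1 + - y1'"] by (auto simp: e_def)
  have hy2: "h2 (n + y2') = e"
    using W.h_add_eq[of n y2'] n(2) y2'(2) by (simp add: osucc_le_iff)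
  define y where "y = (y1, n + y2')"
  have yz: "pair_mult y = z" by (simp add: y_def prod_eq_iff y1 y2' n W.scale_right_distrib)
  have e_avoid: "e \<notin> (\<lambda>w. h1 (fst w)) ` Z"
  proof
    assume "e \<in> (\<lambda>w. h1 (fst w)) ` Z"
    then have "e \<le> Max H" using eg fin by (intro Max_ge) (auto simp: H_def)
    then show False using y1(2) by (simp add: e_def[symmetric] osucc_le_iff)
  qed
  then have e_avoid': "e \<notin> (\<lambda>w. h2 (snd w)) ` Z"
    using good_height_base[OF Z(1)] by (auto simp: image_iff)
  have "good (insert y Z)"
  proof (rule good_insert[OF Z(1)])
    show "pair_mult y \<in> insert 0 Z" using yz Z(2) by simp
    show "fst y \<noteq> 0" using y1(1) goodD(3)[OF Z] by (auto simp: y_def)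
    show "L.proper y (L.span Z)"
      by (rule L.proper_if_height_avoids[OF goodD(1)[OF Z(1)]])
        (use e_avoid \<open>e \<le> lam\<close> in \<open>simp_all add: y_def e_def\<close>)
    show "R.proper y (L.span Z)"
      by (rule R.proper_if_height_avoids[OF goodD(2)[OF Z(1)]])
        (use e_avoid' \<open>e \<le> lam\<close> in \<open>simp_all add: y_def hy2\<close>)
  qed (simp add: y_def hy2 e_def)
  moreover have "b \<le> Max H" by (rule Max_ge[OF fin]) (simp add: H_def)
  then have "b \<le> e" using y1(2) by (simp add: e_def osucc_le_iff)
  ultimately show ?thesis using yz by (intro exI[of _ y]) (simp add: y_def e_def)
qed

end

context height_pair
begin

text \<open>The \<open>c\<close> of the first case is the best height of a predecessor; at limits there is no best one.\<close>

lemma height_cases: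
  assumes "g \<le> lam"
  obtains c where "c \<le> lam" "g = capped_succ lam c" "c = lam \<or> osucc c < lam"
    "\<And>b. b \<le> lam \<Longrightarrow> capped_succ lam b \<le> g \<Longrightarrow> b \<le> c"
  | "g < lam" "\<And>a. a < g \<Longrightarrow> osucc a < g"
proof (cases "g = lam")
  case True
  then show ?thesis using that(1)[of lam] by simp
next
  case False
  then have g: "g < lam" using assms by simp
  show ?thesis
  proof (cases "\<exists>c. g = osucc c")
    case True
    then obtain c where c: "g = osucc c" by blast
    then have "c < lam" using g less_osucc[of c] by simp
    moreover have "b \<le> c" if "b \<le> lam" "capped_succ lam b \<le> g" for b
      using that g c by (auto simp: capped_succ_def osucc_le_iff less_osucc_iff split: if_splits)
    ultimately show ?thesis using that(1)[of c] c g by (simp add: capped_succ_def)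
  next
    case False
    then have "osucc a < g" if "a < g" for a using that by (metis osucc_le_iff le_less)
    then show ?thesis using that(2) g by blast
  qed
qed

lemma add_predecessor:
  assumes Z: "good Z" "z \<in> Z" and b: "b \<le> lam" "capped_succ lam b \<le> h1 (fst z)"
  shows "\<exists>w. good (insert w Z) \<and> pair_mult w = z \<and> b \<le> h1 (fst w)"
  using good_height_le[OF Z]
proof (cases rule: height_cases)
  case (1 c)
  obtain w where "good (insert w Z)" "pair_mult w = z" "c \<le> h1 (fst w)"
    using add_predecessor_successor[OF Z 1(1-3)] by blast
  then show ?thesis using order.trans[OF 1(4)[OF b]] by blast
next
  case 2
  then have "b < h1 (fst z)" using b less_osucc[of b] by (auto simp: capped_succ_def osucc_le_iff split: if_splits)
  then show ?thesis using add_predecessor_limit[OF Z _ 2] by blast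
qed

text \<open>The clause on \<open>Z' - Z\<close> records that every new element lies directly over
  \<open>T\<close>, at a controlled height. The completeness arguments below need it to know that no
  new demands for predecessors arise.\<close>

lemma add_predecessors:
  assumes Z: "good Z" and T: "finite T" "T \<subseteq> Z"
    and \<beta>: "\<And>z. z \<in> T \<Longrightarrow> \<beta> z \<le> lam \<and> capped_succ lam (\<beta> z) \<le> h1 (fst z)"
  shows "\<exists>Z'. good Z' \<and> Z \<subseteq> Z' \<and> (\<forall>w\<in>Z' - Z. \<exists>z\<in>T. pair_mult w = z \<and> \<beta> z \<le> h1 (fst w)) \<and>
    (\<forall>z\<in>T. \<exists>w\<in>Z'. pair_mult w = z \<and> \<beta> z \<le> h1 (fst w))"
  using T \<beta>
proof (induction T rule: finite_induct)
  case empty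
  then show ?case using Z by blast
next
  case (insert z T)
  then obtain Y where Y: "good Y" "Z \<subseteq> Y" "\<forall>w\<in>Y - Z. \<exists>z\<in>T. pair_mult w = z \<and> \<beta> z \<le> h1 (fst w)"
    "\<forall>z\<in>T. \<exists>w\<in>Y. pair_mult w = z \<and> \<beta> z \<le> h1 (fst w)" by auto
  have "z \<in> Y" using insert.prems(1) Y(2) by auto
  then obtain w where "good (insert w Y)" "pair_mult w = z" "\<beta> z \<le> h1 (fst w)"
    using add_predecessor[OF Y(1)] insert.prems(2) by blast
  then show ?case using Y(2-4) by (intro exI[of _ "insert w Y"]) auto
qed

text \<open>This is the hypothesis \<open>pred\<close> of \<open>L.lift_in_t_basis\<close>.\<close>

definition complete_at :: "omega1 \<Rightarrow> ('m \<times> 'n) set \<Rightarrow> bool"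
  where "complete_at b Z \<longleftrightarrow> (\<forall>z\<in>Z. z \<in> pair_mult ` Z \<longrightarrow> capped_succ lam b \<le> h1 (fst z) \<longrightarrow>
    (\<exists>w\<in>Z. pair_mult w = z \<and> b \<le> h1 (fst w)))"

text \<open>Where a best height for predecessors exists, one predecessor of that height settles all
  bounds \<open>b\<close> at once. The first alternative covers the heights, zero or a limit below
  \<open>lam\<close>, for which \<open>height_cases\<close> provides no such best height.\<close>

lemma complete_successors:
  assumes Z: "good Z"
  shows "\<exists>Z'. good Z' \<and> Z \<subseteq> Z' \<and> (\<forall>z\<in>Z'. z \<in> pair_mult ` Z' \<longrightarrow>
    (h1 (fst z) < lam \<and> (\<forall>a<h1 (fst z). osucc a < h1 (fst z))) \<or>
    (\<exists>w\<in>Z'. pair_mult w = z \<and> (\<forall>b\<le>lam. capped_succ lam b \<le> h1 (fst z) \<longrightarrow> b \<le> h1 (fst w))))"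
proof -
  define succ_best where "succ_best g c \<longleftrightarrow> c \<le> lam \<and> g = capped_succ lam c \<and> (c = lam \<or> osucc c < lam) \<and>
    (\<forall>b\<le>lam. capped_succ lam b \<le> g \<longrightarrow> b \<le> c)" for g c
  define T where "T = {z \<in> Z. z \<in> pair_mult ` Z \<and> (\<exists>c. succ_best (h1 (fst z)) c)}"
  define \<beta> where "\<beta> z = (SOME c. succ_best (h1 (fst z)) c)" for z :: "'m \<times> 'n"
  have \<beta>: "succ_best (h1 (fst z)) (\<beta> z)" if "z \<in> T" for z
    using that unfolding \<beta>_def T_def by (auto intro: someI)
  have "finite T" using good_finite(1)[OF Z] by (simp add: T_def)
  moreover have "T \<subseteq> Z" by (auto simp: T_def)
  moreover have "\<beta> z \<le> lam \<and> capped_succ lam (\<beta> z) \<le> h1 (fst z)" if "z \<in> T" for z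
    using \<beta>[OF that] by (auto simp: succ_best_def)
  ultimately obtain Z' where Z': "good Z'" "Z \<subseteq> Z'"
    "\<forall>w\<in>Z' - Z. \<exists>z\<in>T. pair_mult w = z \<and> \<beta> z \<le> h1 (fst w)"
    "\<forall>z\<in>T. \<exists>w\<in>Z'. pair_mult w = z \<and> \<beta> z \<le> h1 (fst w)"
    using add_predecessors[OF Z] by metis
  show ?thesis
  proof (intro exI[of _ Z'] conjI Z' ballI impI)
    fix z assume z: "z \<in> Z'" "z \<in> pair_mult ` Z'"
    show "(h1 (fst z) < lam \<and> (\<forall>a<h1 (fst z). osucc a < h1 (fst z))) \<or>
      (\<exists>w\<in>Z'. pair_mult w = z \<and> (\<forall>b\<le>lam. capped_succ lam b \<le> h1 (fst z) \<longrightarrow> b \<le> h1 (fst w)))"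
      using good_height_le[OF Z'(1) z(1)]
    proof (cases rule: height_cases)
      case (1 c)
      obtain w where w: "w \<in> Z'" "z = pair_mult w" using z(2) by blast
      \<comment> \<open>No second round is required: an image of an old element is old by closure,
        and an image of a new element lies in \<open>T\<close> by construction. New elements have no
        predecessors.\<close>
      have "z \<in> T"
      proof (cases "w \<in> Z")
        case True
        have "z \<noteq> 0" using goodD(3)[OF Z'(1) z(1)] by auto
        then have "z \<in> Z" using True w good_finite(2)[OF Z] by (auto simp: L.p_closed_def)
        moreover have "succ_best (h1 (fst z)) c" using 1 by (simp add: succ_best_def)
        ultimately show ?thesis using True w(2) by (auto simp: T_def)
      next
        case False
        then show ?thesis using Z'(3) w by blast
      qed
      then obtain v where v: "v \<in> Z'" "pair_mult v = z" "\<beta> z \<le> h1 (fst v)" using Z'(4) by blast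
      have "b \<le> h1 (fst v)" if "b \<le> lam" "capped_succ lam b \<le> h1 (fst z)" for b
        using \<beta>[OF \<open>z \<in> T\<close>] that v(3) unfolding succ_best_def by (meson order.trans)
      then show ?thesis using v(1,2) by blast
    next
      case 2
      then show ?thesis by blast
    qed
  qed
qed

text \<open>Predecessors below limit heights are added only once the maximal height \<open>b\<close> in the coset of
  \<open>x\<close> is known: as the new elements have height above \<open>b\<close>, the maximum over the larger span
  cannot exceed \<open>osucc b\<close>, so that no iteration is needed.\<close>

lemma complete_extension:
  assumes Z: "good Z"
  shows "\<exists>Z'. good Z' \<and> Z \<subseteq> Z' \<and> (x \<in> fst ` L.span Z' \<or> (\<exists>b\<le>lam. complete_at b Z' \<and>
    (\<exists>s\<in>L.span Z'. h1 (x + fst s) = b) \<and> (\<forall>s\<in>L.span Z'. h1 (x + fst s) \<le> b)))"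
proof -
  have sub: "x \<in> fst ` L.span Y" if s: "s \<in> L.span Y" "lam < h1 (x + fst s)" for Y s
  proof -
    have "x = fst (- s)" using s(2) V.h_top by (simp add: add_eq_0_iff2)
    then show ?thesis using L.span_neg[OF s(1)] by blast
  qed
  have mx: "\<exists>s\<in>L.span Y. \<forall>t\<in>L.span Y. h1 (x + fst t) \<le> h1 (x + fst s)" if "good Y" for Y
    using L.coset_height_max[OF goodD(1)[OF that], of "(x, 0)"] by simp
  obtain Y where Y: "good Y" "Z \<subseteq> Y" and Yc: "\<And>z. z \<in> Y \<Longrightarrow> z \<in> pair_mult ` Y \<Longrightarrow>
    (h1 (fst z) < lam \<and> (\<forall>a<h1 (fst z). osucc a < h1 (fst z))) \<or>
    (\<exists>w\<in>Y. pair_mult w = z \<and> (\<forall>b\<le>lam. capped_succ lam b \<le> h1 (fst z) \<longrightarrow> b \<le> h1 (fst w)))"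
    using complete_successors[OF Z] by blast
  obtain s where s: "s \<in> L.span Y" "\<And>t. t \<in> L.span Y \<Longrightarrow> h1 (x + fst t) \<le> h1 (x + fst s)"
    using mx[OF Y(1)] by blast
  define b where "b = h1 (x + fst s)"
  show ?thesis
  proof (cases "lam < b")
    case True
    then show ?thesis using sub[OF s(1)] Y unfolding b_def by blast
  next
    case False
    then have b: "b \<le> lam" by simp
    \<comment> \<open>Predecessors of height \<open>osucc b\<close> are supplied, not merely
      \<open>b\<close>, because the maximum over the larger span may have moved up to
      \<open>osucc b\<close>.\<close>
    define T where "T = {z \<in> Y. z \<in> pair_mult ` Y \<and> osucc b < h1 (fst z) \<and> h1 (fst z) < lam}"
    have "finite T" using good_finite(1)[OF Y(1)] by (simp add: T_def)
    moreover have "T \<subseteq> Y" by (auto simp: T_def)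
    moreover have "osucc b \<le> lam \<and> capped_succ lam (osucc b) \<le> h1 (fst z)" if "z \<in> T" for z
    proof -
      have z: "osucc b < h1 (fst z)" "h1 (fst z) < lam" using that by (simp_all add: T_def)
      then have "osucc b < lam" by simp
      then show ?thesis using z(1) less_osucc[of b] by (simp add: capped_succ_def osucc_le_iff)
    qed
    ultimately obtain Z' where Z': "good Z'" "Y \<subseteq> Z'"
      "\<forall>w\<in>Z' - Y. \<exists>z\<in>T. pair_mult w = z \<and> osucc b \<le> h1 (fst w)"
      "\<forall>z\<in>T. \<exists>w\<in>Z'. pair_mult w = z \<and> osucc b \<le> h1 (fst w)"
      using add_predecessors[OF Y(1), of T "\<lambda>_. osucc b"] by metis
    obtain s' where s': "s' \<in> L.span Z'" "\<And>t. t \<in> L.span Z' \<Longrightarrow> h1 (x + fst t) \<le> h1 (x + fst s')"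
      using mx[OF Z'(1)] by blast
    define b' where "b' = h1 (x + fst s')"
    have bb: "b \<le> b'" using s'(2)[of s] s(1) L.span_mono[OF Z'(2)] unfolding b_def b'_def by blast
    show ?thesis
    proof (cases "lam < b'")
      case True
      then show ?thesis using sub[OF s'(1)] Y Z' unfolding b'_def by blast
    next
      case False
      then have b': "b' \<le> lam" by simp
      have "b' \<le> osucc b"
      proof (rule ccontr)
        assume gt: "\<not> b' \<le> osucc b"
        have "L.span Z' = L.span (Y \<union> (Z' - Y))" using Z'(2) by (simp add: Un_absorb1)
        then obtain s1 r where sr: "s' = s1 + r" "s1 \<in> L.span Y" "r \<in> L.span (Z' - Y)"
          using s'(1) unfolding \<open>L.span Z' = L.span (Y \<union> (Z' - Y))\<close> L.span_Un by blast
        have "osucc b \<le> osucc lam" using b less_osucc[of lam] by (simp add: osucc_le_iff le_less_trans)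
        then have "L.span (Z' - Y) \<subseteq> L.above (osucc b)"
          using Z'(3) by (intro L.span_minimal L.subspace_above) (auto simp: L.above_def)
        then have "osucc b \<le> h1 (fst r)" using sr(3) by (auto simp: L.above_def)
        moreover have "osucc b \<le> h1 (x + fst s')" using gt by (simp add: b'_def)
        ultimately have "osucc b \<le> h1 (x + fst s' - fst r)" by (rule V.h_diffI[rotated])
        then have "osucc b \<le> h1 (x + fst s1)" using sr(1) by (simp add: add.assoc[symmetric])
        then show False using s(2)[OF sr(2)] by (simp add: osucc_le_iff b_def[symmetric])
      qed
      moreover have "complete_at b' Z'" unfolding complete_at_def
      proof (intro ballI impI)
        fix z assume z: "z \<in> Z'" "z \<in> pair_mult ` Z'" "capped_succ lam b' \<le> h1 (fst z)"
        then obtain w where w: "w \<in> Z'" "z = pair_mult w" by blast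
        have "z \<noteq> 0" using goodD(3)[OF Z'(1) z(1)] by auto
        have zY: "z \<in> Y \<and> z \<in> pair_mult ` Y"
        proof (cases "w \<in> Y")
          case True
          then show ?thesis using w(2) \<open>z \<noteq> 0\<close> good_finite(2)[OF Y(1)] by (auto simp: L.p_closed_def)
        next
          case False
          then have "z \<in> T" using Z'(3) w by blast
          then show ?thesis by (simp add: T_def)
        qed
        show "\<exists>w\<in>Z'. pair_mult w = z \<and> b' \<le> h1 (fst w)"
        proof (cases "\<exists>w\<in>Y. pair_mult w = z \<and> (\<forall>b\<le>lam. capped_succ lam b \<le> h1 (fst z) \<longrightarrow> b \<le> h1 (fst w))")
          case True
          then show ?thesis using Z'(2) z(3) b' by blast
        next
          case False
          then have lim: "h1 (fst z) < lam" "\<And>a. a < h1 (fst z) \<Longrightarrow> osucc a < h1 (fst z)"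
            using Yc[of z] zY by blast+
          have "capped_succ lam b \<le> h1 (fst z)" using z(3) bb capped_succ_mono order.trans by blast
          then have "b < h1 (fst z)" using lim(1) by (auto simp: capped_succ_def osucc_le_iff split: if_splits)
          then have "z \<in> T" using lim zY by (simp add: T_def)
          then show ?thesis using Z'(4) \<open>b' \<le> osucc b\<close> order.trans by blast
        qed
      qed
      ultimately show ?thesis
        using Z'(1,2) Y(2) b' s' unfolding b'_def by blast
    qed
  qed
qed

text \<open>An element \<open>x + s\<close> of maximal height in the coset need not be annihilated
  by \<open>p\<close>. Completeness provides \<open>r\<close> in the span with
  \<open>p r = p s\<close> and height at least \<open>b\<close>; then \<open>x + s - r\<close> lies
  in the socle, has the same maximal height, and can be matched by
  \<open>socle_transfer\<close>.\<close>

lemma add_socle_element: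
  assumes Z: "good Z" and x: "act1 p x = 0"
  shows "\<exists>Z'. good Z' \<and> Z \<subseteq> Z' \<and> x \<in> fst ` L.span Z'"
proof -
  obtain Y where Y: "good Y" "Z \<subseteq> Y" "x \<in> fst ` L.span Y \<or> (\<exists>b\<le>lam. complete_at b Y \<and>
    (\<exists>s\<in>L.span Y. h1 (x + fst s) = b) \<and> (\<forall>s\<in>L.span Y. h1 (x + fst s) \<le> b))"
    using complete_extension[OF Z, of x] by blast
  show ?thesis
  proof (cases "x \<in> fst ` L.span Y")
    case True
    then show ?thesis using Y by blast
  next
    case False
    then obtain b s where b: "b \<le> lam" "complete_at b Y" and s: "s \<in> L.span Y" "h1 (x + fst s) = b"
      and mx: "\<And>t. t \<in> L.span Y \<Longrightarrow> h1 (x + fst t) \<le> b" using Y(3) by blast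
    have "\<exists>r\<in>L.span Y. pair_mult r = pair_mult s \<and> b \<le> h1 (fst r)"
    proof (rule L.lift_in_t_basis[OF goodD(1)[OF Y(1)] s(1)])
      show "b \<le> osucc lam" using b(1) less_osucc[of lam] by simp
      have "act1 p (x + fst s) = fst (pair_mult s)" by (simp add: V.scale_right_distrib x)
      then show "capped_succ lam b \<le> h1 (fst (pair_mult s))" using V.h_p[of "x + fst s"] s(2) by simp
    qed (use b(2) in \<open>auto simp: complete_at_def\<close>)
    then obtain r where r: "r \<in> L.span Y" "pair_mult r = pair_mult s" "b \<le> h1 (fst r)" by blast
    define x1 where "x1 = x + fst (s - r)"
    have sr: "s - r \<in> L.span Y" using s(1) r(1) by (rule L.span_diff)
    have px1: "act1 p x1 = 0"
      using arg_cong[OF r(2), of fst] by (simp add: x1_def V.scale_right_distrib V.scale_right_diff_distrib x)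
    have "b \<le> h1 ((x + fst s) - fst r)" using s(2) r(3) by (intro V.h_diffI) auto
    then have hx1: "h1 x1 = b" using mx[OF sr] by (simp add: x1_def add_diff_eq antisym)
    have prop1: "h1 (x1 + fst w) \<le> b" if "w \<in> L.span Y" for w
      using mx[OF L.span_add[OF sr that]] by (simp add: x1_def add.assoc)
    obtain y where y: "act2 p y = 0" "h2 y = b" "\<And>w. w \<in> L.span Y \<Longrightarrow> h2 (y + snd w) \<le> b"
      using socle_transfer[OF Y(1) b(1) px1 hx1 prop1] by blast
    have "good (insert (x1, y) Y)"
    proof (rule good_insert[OF Y(1)])
      show "pair_mult (x1, y) \<in> insert 0 Y" using px1 y(1) by (simp add: prod_eq_iff)
      show "fst (x1, y) \<noteq> 0" using hx1 b(1) V.h_top[of x1] by auto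
    qed (use hx1 y(2,3) prop1 in \<open>auto simp: L.proper_def R.proper_def\<close>)
    moreover have "(x1, y) - (s - r) \<in> L.span (insert (x1, y) Y)"
    proof (rule L.span_diff)
      show "s - r \<in> L.span (insert (x1, y) Y)" using sr L.span_mono[of Y "insert (x1, y) Y"] by blast
    qed (rule L.span_base, simp)
    then have "x \<in> fst ` L.span (insert (x1, y) Y)" by (rule rev_image_eqI) (simp add: x1_def)
    ultimately show ?thesis using Y(2) by blast
  qed
qed

text \<open>Write \<open>p x\<close> in the basis and divide it there by adding predecessors of the
  basis elements involved. The quotient differs from \<open>x\<close> by a socle element.\<close>

lemma add_element_above:
  assumes Z: "good Z" and x: "act1 p x \<in> fst ` L.span Z"
  shows "\<exists>Z'. good Z' \<and> Z \<subseteq> Z' \<and> x \<in> fst ` L.span Z'"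
proof -
  obtain s where s: "s \<in> L.span Z" "act1 p x = fst s" using x by auto
  obtain c where c: "reduced p c" "s = L.comb c Z" using goodD(1)[OF Z] s(1) by (rule L.span_combE)
  define T where "T = {z \<in> Z. c z \<noteq> 0}"
  have T: "finite T" "T \<subseteq> Z" using good_finite(1)[OF Z] by (auto simp: T_def)
  \<comment> \<open>Any predecessor will do, so the bound is \<open>ozero\<close>. It is admissible
    because each term is at least as high as the whole sum, which is \<open>p x\<close>.\<close>
  have "ozero \<le> lam \<and> capped_succ lam ozero \<le> h1 (fst z)" if "z \<in> T" for z
  proof
    have "capped_succ lam ozero \<le> capped_succ lam (h1 x)" by (intro capped_succ_mono ozero_le)
    also have "\<dots> \<le> h1 (fst s)" using V.h_p[of x] s(2) by simp
    also have "\<dots> \<le> h1 (fst z)" using L.t_basisD[OF goodD(1)[OF Z] c(1), of z] that c(2) by (simp add: T_def)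
    finally show "capped_succ lam ozero \<le> h1 (fst z)" .
  qed (rule ozero_le)
  then obtain Y where Y: "good Y" "Z \<subseteq> Y" "\<forall>z\<in>T. \<exists>w\<in>Y. pair_mult w = z"
    using add_predecessors[OF Z T, of "\<lambda>_. ozero"] by metis
  then obtain y where y: "\<And>z. z \<in> T \<Longrightarrow> y z \<in> Y \<and> pair_mult (y z) = z" by metis
  define r where "r = (\<Sum>z\<in>T. pair_act act1 act2 (c z) (y z))"
  have r: "r \<in> L.span Y" unfolding r_def using y by (intro L.span_sum L.span_scale L.span_base) blast
  have "pair_mult r = (\<Sum>z\<in>T. pair_act act1 act2 (c z) (pair_mult (y z)))"
    unfolding r_def L.scale_sum_right by (simp add: mult.commute)
  also have "\<dots> = (\<Sum>z\<in>T. pair_act act1 act2 (c z) z)" using y by (intro sum.cong refl) simp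
  also have "\<dots> = s" unfolding c(2) L.comb_def T_def
    by (rule sum.mono_neutral_left) (use good_finite(1)[OF Z] in auto)
  finally have "act1 p (x - fst r) = 0"
    using s(2) by (simp add: V.scale_right_diff_distrib flip: fst_pair_act[of act1 act2])
  then obtain Z' where Z': "good Z'" "Y \<subseteq> Z'" "x - fst r \<in> fst ` L.span Z'"
    using add_socle_element[OF Y(1)] by blast
  then obtain t where "t \<in> L.span Z'" "x - fst r = fst t" by auto
  then have "x = fst (t + r)" by (simp add: diff_eq_eq)
  moreover have "r \<in> L.span Z'" using r L.span_mono[OF Z'(2)] by blast
  then have "t + r \<in> L.span Z'" using \<open>t \<in> L.span Z'\<close> L.span_add by blast
  ultimately have "x \<in> fst ` L.span Z'" by (rule image_eqI)
  then show ?thesis using Z'(1,2) Y(2) by (intro exI[of _ Z']) auto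
qed

lemma add_torsion_element:
  "good Z \<Longrightarrow> act1 (p ^ k) x = 0 \<Longrightarrow> \<exists>Z'. good Z' \<and> Z \<subseteq> Z' \<and> x \<in> fst ` L.span Z'"
proof (induction k arbitrary: x Z)
  case 0
  then show ?case by (intro exI[of _ Z]) (auto intro: rev_image_eqI[OF L.span_zero])
next
  case (Suc k)
  have "act1 (p ^ k) (act1 p x) = 0" using Suc.prems(2) by (simp add: mult.commute)
  from Suc.IH[OF Suc.prems(1) this] obtain Y where
    Y: "good Y" "Z \<subseteq> Y" "act1 p x \<in> fst ` L.span Y" by blast
  obtain Z' where "good Z'" "Y \<subseteq> Z'" "x \<in> fst ` L.span Z'"
    using add_element_above[OF Y(1,3)] by blast
  then show ?case using Y(2) by (intro exI[of _ Z']) auto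
qed

end

section \<open>Torsion submodules, the symmetric extension step, and exhaustion\<close>

definition torsion :: "('a::field poly \<Rightarrow> 'm::ab_group_add \<Rightarrow> 'm) \<Rightarrow> 'a poly \<Rightarrow> 'm set"
  where "torsion act p = {x. \<exists>k. act (p ^ k) x = 0}"

lemma (in poly_module) subspace_torsion: "subspace (torsion act p)"
  unfolding subspace_def
proof (intro conjI ballI allI)
  show "0 \<in> torsion act p" by (simp add: torsion_def)
next
  fix x y assume "x \<in> torsion act p" "y \<in> torsion act p"
  then obtain k l where k: "act (p ^ k) x = 0" "act (p ^ l) y = 0" by (auto simp: torsion_def)
  have "act (p ^ l) (act (p ^ k) x) + act (p ^ k) (act (p ^ l) y) = 0" by (simp add: k del: scale_scale)
  then have "act (p ^ (k + l)) (x + y) = 0"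
    by (simp add: scale_right_distrib power_add mult.commute)
  then show "x + y \<in> torsion act p" unfolding torsion_def by blast
next
  fix r x assume "x \<in> torsion act p"
  then obtain k where k: "act (p ^ k) x = 0" by (auto simp: torsion_def)
  have "act (p ^ k) (act r x) = act r (act (p ^ k) x)" by (simp add: mult.commute)
  then show "act r x \<in> torsion act p" using k unfolding torsion_def by (auto simp del: scale_scale)
qed

context height_pair
begin

lemma swapped: "height_pair act2 act1 p h2 h1 lam"
  by unfold_locales (simp add: rank_eq)

text \<open>Turns the extension on the left into the one on the right: combinations of swapped pairs
  are swapped combinations, and equal heights make second components nonzero too.\<close>

lemma good_swap:
  assumes Z: "good Z"
  shows "height_pair.good act2 act1 p h2 h1 (prod.swap ` Z)"
    and "Modules.module.span (pair_act act2 act1) (prod.swap ` Z) = prod.swap ` L.span Z"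
proof -
  interpret S: height_pair act2 act1 p h2 h1 lam by (rule swapped)
  have inj: "inj_on prod.swap Z" by (rule inj_onI) (simp add: prod_eq_iff)
  have comb: "S.L.comb c (prod.swap ` Z) = prod.swap (L.comb (c \<circ> prod.swap) Z)" for c
    unfolding S.L.comb_def L.comb_def sum.reindex[OF inj]
    by (simp add: prod_eq_iff fst_sum snd_sum)
  have red: "reduced p (c \<circ> prod.swap)" if "reduced p c" for c :: "'n \<times> 'm \<Rightarrow> 'a poly"
    using that by (simp add: reduced_def)
  have red': "reduced p (c \<circ> prod.swap)" if "reduced p c" for c :: "'m \<times> 'n \<Rightarrow> 'a poly"
    using that by (simp add: reduced_def)
  have mult: "pair_act act2 act1 r (prod.swap z) = prod.swap (pair_act act1 act2 r z)" for r z
    by (simp add: prod_eq_iff)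
  have fin: "finite (prod.swap ` Z)" using good_finite[OF Z] by simp
  have cl: "S.L.p_closed (prod.swap ` Z)" unfolding S.L.p_closed_def
  proof (rule ballI)
    fix z assume "z \<in> prod.swap ` Z"
    then obtain w where w: "w \<in> Z" "z = prod.swap w" by auto
    then have "pair_mult w = 0 \<or> pair_mult w \<in> Z" using good_finite(2)[OF Z] by (auto simp: L.p_closed_def)
    then show "pair_act act2 act1 p z \<in> insert 0 (prod.swap ` Z)"
      unfolding w(2) mult by (elim disjE) (simp_all add: zero_prod_def)
  qed
  have L: "S.L.t_basis (prod.swap ` Z)" unfolding S.L.t_basis_def
  proof (intro conjI allI impI ballI fin cl)
    fix c z assume c: "reduced p c" "z \<in> prod.swap ` Z" "c z \<noteq> 0"
    then obtain w where w: "w \<in> Z" "z = prod.swap w" by auto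
    show "h2 (fst (S.L.comb c (prod.swap ` Z))) \<le> h2 (fst z)"
      using R.t_basisD[OF goodD(2)[OF Z] red[OF c(1)] w(1)] c(3) by (simp add: comb w)
  qed
  have R: "S.R.t_basis (prod.swap ` Z)" unfolding S.R.t_basis_def
  proof (intro conjI allI impI ballI fin cl)
    fix c z assume c: "reduced p c" "z \<in> prod.swap ` Z" "c z \<noteq> 0"
    then obtain w where w: "w \<in> Z" "z = prod.swap w" by auto
    show "h1 (snd (S.L.comb c (prod.swap ` Z))) \<le> h1 (snd z)"
      using L.t_basisD[OF goodD(1)[OF Z] red[OF c(1)] w(1)] c(3) by (simp add: comb w)
  qed
  show span: "S.L.span (prod.swap ` Z) = prod.swap ` L.span Z"
  proof
    show "S.L.span (prod.swap ` Z) \<subseteq> prod.swap ` L.span Z"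
    proof
      fix w assume "w \<in> S.L.span (prod.swap ` Z)"
      then obtain c where "w = S.L.comb c (prod.swap ` Z)" by (rule S.L.span_combE[OF L])
      then show "w \<in> prod.swap ` L.span Z" unfolding comb using L.comb_in_span by blast
    qed
    show "prod.swap ` L.span Z \<subseteq> S.L.span (prod.swap ` Z)"
    proof (rule image_subsetI)
      fix w assume "w \<in> L.span Z"
      then obtain c where "w = L.comb c Z" by (rule L.span_combE[OF goodD(1)[OF Z]])
      then have "prod.swap w = S.L.comb (c \<circ> prod.swap) (prod.swap ` Z)"
        unfolding comb by (simp add: comp_assoc)
      then show "prod.swap w \<in> S.L.span (prod.swap ` Z)" using S.L.comb_in_span by simp
    qed
  qed
  have "h2 (fst w) = h1 (snd w)" if "w \<in> S.L.span (prod.swap ` Z)" for w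
    using that good_height[OF Z] unfolding span by auto
  moreover have "fst z \<noteq> 0" if "z \<in> prod.swap ` Z" for z
  proof
    obtain w where w: "w \<in> Z" "z = prod.swap w" using \<open>z \<in> prod.swap ` Z\<close> by auto
    assume "fst z = 0"
    then have "h1 (fst w) = osucc lam" using good_height_base[OF Z w(1)] w(2) by (simp add: W.h_zero)
    then show False using good_height_le[OF Z w(1)] less_osucc[of lam] by simp
  qed
  moreover have "\<exists>k. pair_act act2 act1 (p ^ k) z = 0" if z: "z \<in> prod.swap ` Z" for z
  proof -
    obtain w where w: "w \<in> Z" "z = prod.swap w" using z by auto
    then obtain k where "pair_act act1 act2 (p ^ k) w = 0" using Z unfolding good_def by blast
    then show ?thesis unfolding w(2) mult by (intro exI[of _ k]) (simp add: zero_prod_def)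
  qed
  ultimately show "S.good (prod.swap ` Z)" unfolding S.good_def using L R by blast
qed

lemma add_torsion_element_right:
  assumes Z: "good Z" and y: "act2 (p ^ k) y = 0"
  shows "\<exists>Z'. good Z' \<and> Z \<subseteq> Z' \<and> y \<in> snd ` L.span Z'"
proof -
  interpret S: height_pair act2 act1 p h2 h1 lam by (rule swapped)
  obtain Y where Y: "S.good Y" "prod.swap ` Z \<subseteq> Y" "y \<in> fst ` S.L.span Y"
    using S.add_torsion_element[OF good_swap(1)[OF Z] y] by blast
  have "prod.swap ` prod.swap ` Z \<subseteq> prod.swap ` Y" using Y(2) by (rule image_mono)
  then have "Z \<subseteq> prod.swap ` Y" by (simp add: image_image)
  moreover have "y \<in> snd ` L.span (prod.swap ` Y)"
    unfolding S.good_swap(2)[OF Y(1)] using Y(3) by (auto simp: image_image)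
  ultimately show ?thesis using S.good_swap(1)[OF Y(1)] by blast
qed

text \<open>Stage \<open>n\<close> takes in the \<open>n\<close>-th generator on each side. The
  torsion clause of \<open>good\<close> keeps the spans inside the two torsion submodules.\<close>

lemma exhausting_sequence:
  assumes C1: "countable C1" "torsion act1 p \<subseteq> V.span C1" "C1 \<subseteq> torsion act1 p"
    and C2: "countable C2" "torsion act2 p \<subseteq> W.span C2" "C2 \<subseteq> torsion act2 p"
  obtains Z where "\<And>n::nat. good (Z n)" "incseq Z"
    "torsion act1 p = fst ` (\<Union>n. L.span (Z n))" "torsion act2 p = snd ` (\<Union>n. L.span (Z n))"
proof -
  have z: "0 \<in> torsion act1 p" "0 \<in> torsion act2 p" by (simp_all add: torsion_def)
  \<comment> \<open>Zero is added so that the enumeration also makes sense for an empty set of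
    generators.\<close>
  define xs where "xs = from_nat_into (insert 0 C1)"
  define ys where "ys = from_nat_into (insert 0 C2)"
  have xs: "range xs = insert 0 C1" and ys: "range ys = insert 0 C2"
    unfolding xs_def ys_def using C1(1) C2(1) by (auto intro!: range_from_nat_into)
  have "xs n \<in> insert 0 C1" "ys n \<in> insert 0 C2" for n
    using xs ys by (metis rangeI)+
  then have xt: "xs n \<in> torsion act1 p" and yt: "ys n \<in> torsion act2 p" for n
    using C1(3) C2(3) z by (metis insertE subsetD)+
  have step: "\<exists>Z'. good Z' \<and> Z \<subseteq> Z' \<and> x \<in> fst ` L.span Z' \<and> y \<in> snd ` L.span Z'"
    if Z: "good Z" and x: "x \<in> torsion act1 p" and y: "y \<in> torsion act2 p" for Z x y
  proof -
    obtain k l where kl: "act1 (p ^ k) x = 0" "act2 (p ^ l) y = 0" using x y by (auto simp: torsion_def)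
    obtain Y where Y: "good Y" "Z \<subseteq> Y" "x \<in> fst ` L.span Y" using add_torsion_element[OF Z kl(1)] by blast
    obtain Z' where Z': "good Z'" "Y \<subseteq> Z'" "y \<in> snd ` L.span Z'"
      using add_torsion_element_right[OF Y(1) kl(2)] by blast
    have "x \<in> fst ` L.span Z'" using Y(3) L.span_mono[OF Z'(2)] by blast
    then show ?thesis using Z' Y(2) by blast
  qed
  have "\<exists>Z. \<forall>n. good (Z n) \<and> (Z n \<subseteq> Z (Suc n) \<and> xs n \<in> fst ` L.span (Z (Suc n)) \<and> ys n \<in> snd ` L.span (Z (Suc n)))"
  proof (rule dependent_nat_choice)
    show "\<exists>Z. good Z" using good_empty by blast
    show "\<exists>Z'. good Z' \<and> Z \<subseteq> Z' \<and> xs n \<in> fst ` L.span Z' \<and> ys n \<in> snd ` L.span Z'" if "good Z" for Z n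
      using step[OF that xt yt] by blast
  qed
  then obtain Z where Z: "\<And>n. good (Z n)" "\<And>n. Z n \<subseteq> Z (Suc n)"
    "\<And>n. xs n \<in> fst ` L.span (Z (Suc n))" "\<And>n. ys n \<in> snd ` L.span (Z (Suc n))" by blast
  have inc: "incseq Z" using Z(2) by (rule incseq_SucI)
  let ?G = "\<Union>n. L.span (Z n)"
  have tors: "pair_act act1 act2 (p ^ k) w = 0 \<Longrightarrow> fst w \<in> torsion act1 p \<and> snd w \<in> torsion act2 p" for k w
    by (auto simp: torsion_def prod_eq_iff)
  have "Z n \<subseteq> torsion (pair_act act1 act2) p" for n
    using Z(1)[of n] by (auto simp: good_def torsion_def)
  then have "L.span (Z n) \<subseteq> torsion (pair_act act1 act2) p" for n
    using L.span_minimal[OF _ L.subspace_torsion] by blast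
  then have G: "?G \<subseteq> torsion (pair_act act1 act2) p" by blast
  have sub: "L.subspace ?G" unfolding L.span_UN_incseq[OF inc] by (rule L.subspace_span)
  have hom1: "Modules.module_hom (pair_act act1 act2) act1 fst" by unfold_locales simp_all
  have hom2: "Modules.module_hom (pair_act act1 act2) act2 snd" by unfold_locales simp_all
  have "V.subspace (fst ` ?G)" by (rule module_hom.subspace_image[OF hom1 sub])
  moreover have "xs n \<in> fst ` ?G" for n using Z(3)[of n] by blast
  then have "insert 0 C1 \<subseteq> fst ` ?G" using xs by (metis image_subset_iff)
  ultimately have "V.span C1 \<subseteq> fst ` ?G" by (intro V.span_minimal) auto
  then have 1: "torsion act1 p = fst ` ?G" using C1(2) G tors by (auto simp: torsion_def)
  have "W.subspace (snd ` ?G)" by (rule module_hom.subspace_image[OF hom2 sub])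
  moreover have "ys n \<in> snd ` ?G" for n using Z(4)[of n] by blast
  then have "insert 0 C2 \<subseteq> snd ` ?G" using ys by (metis image_subset_iff)
  ultimately have "W.span C2 \<subseteq> snd ` ?G" by (intro W.span_minimal) auto
  then have 2: "torsion act2 p = snd ` ?G" using C2(2) G tors by (auto simp: torsion_def)
  show ?thesis using that[OF Z(1) inc 1 2] .
qed

lemma fst_zero_iff_snd_zero:
  assumes "good Z" "w \<in> L.span Z"
  shows "fst w = 0 \<longleftrightarrow> snd w = 0"
  using good_height[OF assms] V.h_top[of "fst w"] W.h_top[of "snd w"] by simp

text \<open>Ulm's theorem for countably generated modules.\<close>

lemma isomorphism_graph:
  assumes C1: "countable C1" "torsion act1 p \<subseteq> V.span C1" "C1 \<subseteq> torsion act1 p"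
    and C2: "countable C2" "torsion act2 p \<subseteq> W.span C2" "C2 \<subseteq> torsion act2 p"
  shows "\<exists>G. L.subspace G \<and> fst ` G = torsion act1 p \<and> snd ` G = torsion act2 p \<and>
    (\<forall>w\<in>G. fst w = 0 \<longleftrightarrow> snd w = 0)"
proof -
  obtain Z where Z: "\<And>n::nat. good (Z n)" "incseq Z"
    "torsion act1 p = fst ` (\<Union>n. L.span (Z n))" "torsion act2 p = snd ` (\<Union>n. L.span (Z n))"
    using exhausting_sequence[OF assms] by blast
  show ?thesis
  proof (intro exI[of _ "\<Union>n. L.span (Z n)"] conjI ballI)
    show "L.subspace (\<Union>n. L.span (Z n))" unfolding L.span_UN_incseq[OF Z(2)] by (rule L.subspace_span)
    show "fst w = 0 \<longleftrightarrow> snd w = 0" if "w \<in> (\<Union>n. L.span (Z n))" for w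
      using that fst_zero_iff_snd_zero[OF Z(1)] by blast
  qed (use Z in auto)
qed

text \<open>The first components of the bases form the presentation. If a reduced combination
  vanishes, it has height above \<open>lam\<close>, so by the basis inequality no basis element can
  occur in it.\<close>

lemma simply_presented:
  assumes C1: "countable C1" "torsion act1 p \<subseteq> V.span C1" "C1 \<subseteq> torsion act1 p"
    and C2: "countable C2" "torsion act2 p \<subseteq> W.span C2" "C2 \<subseteq> torsion act2 p"
  shows "\<exists>X. incseq X \<and> (\<forall>n::nat. finite (X n) \<and> V.p_closed (X n) \<and>
      (\<forall>c. reduced p c \<longrightarrow> V.comb c (X n) = 0 \<longrightarrow> (\<forall>x\<in>X n. c x = 0))) \<and>
    torsion act1 p = (\<Union>n. V.span (X n))"
proof -
  obtain Z where Z: "\<And>n::nat. good (Z n)" "incseq Z"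
    "torsion act1 p = fst ` (\<Union>n. L.span (Z n))" "torsion act2 p = snd ` (\<Union>n. L.span (Z n))"
    using exhausting_sequence[OF assms] by blast
  have inj: "inj_on fst (Z n)" for n
  proof (rule inj_onI)
    fix z w assume zw: "z \<in> Z n" "w \<in> Z n" "fst z = fst w"
    then have "z - w \<in> L.span (Z n)" by (intro L.span_diff L.span_base)
    then have "snd (z - w) = 0" using fst_zero_iff_snd_zero[OF Z(1)] zw(3) by (metis fst_diff right_minus_eq)
    then show "z = w" using zw(3) by (simp add: prod_eq_iff)
  qed
  have comb: "V.comb c (fst ` Z n) = fst (L.comb (c \<circ> fst) (Z n))" for c n
    unfolding V.comb_def L.comb_def sum.reindex[OF inj] by (simp add: fst_sum)
  show ?thesis
  proof (intro exI[of _ "\<lambda>n. fst ` Z n"] conjI allI)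
    show "incseq (\<lambda>n. fst ` Z n)" using Z(2) by (auto simp: incseq_def)
    fix n
    show fin: "finite (fst ` Z n)" using good_finite(1)[OF Z(1)] by simp
    show "V.p_closed (fst ` Z n)" unfolding V.p_closed_def
    proof (rule ballI)
      fix x assume "x \<in> fst ` Z n"
      then obtain z where z: "z \<in> Z n" "x = fst z" by blast
      then have "pair_mult z = 0 \<or> pair_mult z \<in> Z n" using good_finite(2)[OF Z(1)] by (auto simp: L.p_closed_def)
      then show "act1 p x \<in> insert 0 (fst ` Z n)"
        unfolding z(2) fst_pair_act[of act1 act2, symmetric] by (elim disjE) (simp_all del: fst_pair_act)
    qed
    show "reduced p c \<longrightarrow> V.comb c (fst ` Z n) = 0 \<longrightarrow> (\<forall>x\<in>fst ` Z n. c x = 0)" for c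
    proof (intro impI ballI, rule ccontr)
      fix x assume c: "reduced p c" "V.comb c (fst ` Z n) = 0" and x: "x \<in> fst ` Z n" "c x \<noteq> 0"
      then obtain z where z: "z \<in> Z n" "x = fst z" by blast
      have "reduced p (c \<circ> fst)" using c(1) by (simp add: reduced_def)
      then have "h1 (fst (L.comb (c \<circ> fst) (Z n))) \<le> h1 (fst z)"
        using L.t_basisD[OF goodD(1)[OF Z(1)], of "c \<circ> fst" z n] x z by simp
      then show False using c(2) good_height_le[OF Z(1) z(1)] less_osucc[of lam]
        by (simp add: comb V.h_zero)
    qed
  next
    have hom: "Modules.module_hom (pair_act act1 act2) act1 fst" by unfold_locales simp_all
    have "fst ` L.span (Z n) = V.span (fst ` Z n)" for n using module_hom.span_image[OF hom] by simp
    then show "torsion act1 p = (\<Union>n. V.span (fst ` Z n))" unfolding Z(3) image_UN by simp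
  qed
qed

end

section \<open>Kaplansky invariants and ranks\<close>

definition residue_class :: "'a::field poly \<Rightarrow> 'a poly \<Rightarrow> 'a poly set"
  where "residue_class q r = PIdl\<^bsub>polynomial_ring\<^esub> q +>\<^bsub>polynomial_ring\<^esub> r"

lemma cring_polynomial_ring: "cring (polynomial_ring :: 'a::field poly ring)"
proof (rule cringI)
  show "abelian_group (polynomial_ring :: 'a poly ring)"
    by (rule abelian_groupI) (auto simp: polynomial_ring_def algebra_simps intro: exI[of _ "- x" for x] left_minus)
  show "Group.comm_monoid (polynomial_ring :: 'a poly ring)"
    by (rule comm_monoidI) (auto simp: polynomial_ring_def algebra_simps)
qed (simp add: polynomial_ring_def algebra_simps)

lemma ideal_polynomial_ring: "ideal (PIdl\<^bsub>polynomial_ring\<^esub> q) (polynomial_ring :: 'a::field poly ring)"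
  by (rule cring.cgenideal_ideal[OF cring_polynomial_ring]) (simp add: polynomial_ring_def)

lemma PIdl_polynomial_ring: "PIdl\<^bsub>polynomial_ring\<^esub> q = {s. q dvd s}"
  by (auto simp: cgenideal_def polynomial_ring_def dvd_def mult.commute)

lemma residue_class_eq: "residue_class q r = {s. q dvd s - r}"
proof -
  have "residue_class q r = (\<lambda>k. k + r) ` {s. q dvd s}"
    unfolding residue_class_def PIdl_polynomial_ring a_r_coset_def r_coset_def
    by (auto simp: polynomial_ring_def)
  also have "\<dots> = {s. q dvd s - r}" by (force intro: rev_image_eqI)
  finally show ?thesis .
qed

lemma carrier_residue_field: "carrier (residue_field q) = range (residue_class q)"
  by (auto simp: residue_field_def FactRing_def A_RCOSETS_def RCOSETS_def residue_class_def
      a_r_coset_def polynomial_ring_def)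

lemma residue_class_hom: "residue_class q \<in> ring_hom polynomial_ring (residue_field q)"
  using ideal.rcos_ring_hom[OF ideal_polynomial_ring[of q]]
  by (simp add: residue_class_def[abs_def] residue_field_def)

lemma residue_class_simps:
  "residue_class q r \<otimes>\<^bsub>residue_field q\<^esub> residue_class q s = residue_class q (r * s)"
  "residue_class q r \<oplus>\<^bsub>residue_field q\<^esub> residue_class q s = residue_class q (r + s)"
  "\<one>\<^bsub>residue_field q\<^esub> = residue_class q 1"
  "\<zero>\<^bsub>residue_field q\<^esub> = residue_class q 0"
proof -
  have c: "r \<in> carrier polynomial_ring" for r :: "'a poly" by (simp add: polynomial_ring_def)
  show "residue_class q r \<otimes>\<^bsub>residue_field q\<^esub> residue_class q s = residue_class q (r * s)"
    using ring_hom_mult[OF residue_class_hom c c] by (simp add: polynomial_ring_def)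
  show "residue_class q r \<oplus>\<^bsub>residue_field q\<^esub> residue_class q s = residue_class q (r + s)"
    using ring_hom_add[OF residue_class_hom c c] by (simp add: polynomial_ring_def)
  show "\<one>\<^bsub>residue_field q\<^esub> = residue_class q 1"
    using ring_hom_one[OF residue_class_hom, of q] by (simp add: polynomial_ring_def)
  show "\<zero>\<^bsub>residue_field q\<^esub> = residue_class q 0"
    by (simp add: residue_field_def FactRing_def PIdl_polynomial_ring residue_class_eq)
qed

lemma residue_class_eq_iff: "residue_class q r = residue_class q s \<longleftrightarrow> q dvd r - s"
proof
  assume "residue_class q r = residue_class q s"
  moreover have "r \<in> residue_class q r" by (simp add: residue_class_eq)
  ultimately have "r \<in> residue_class q s" by simp
  then show "q dvd r - s" by (simp add: residue_class_eq)
next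
  assume d: "q dvd r - s"
  have "q dvd x - r \<longleftrightarrow> q dvd x - s" for x
    using dvd_add_left_iff[OF d, of "x - r"] by simp
  then show "residue_class q r = residue_class q s" by (simp add: residue_class_eq)
qed

lemma field_residue_field:
  fixes q :: "'a::field poly"
  assumes q: "irreducible q"
  shows "Ring.field (residue_field q)"
  unfolding residue_field_def
proof (rule maximalideal.quotient_is_field[OF _ cring_polynomial_ring], rule maximalidealI)
  let ?I = "PIdl\<^bsub>polynomial_ring\<^esub> q"
  show "ideal ?I polynomial_ring" by (rule ideal_polynomial_ring)
  have "\<not> q dvd 1" using q by (simp add: irreducible_def)
  then have "1 \<notin> ?I" by (simp add: PIdl_polynomial_ring)
  then show "carrier polynomial_ring \<noteq> ?I" by (auto simp: polynomial_ring_def)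
  fix J assume J: "ideal J polynomial_ring" "?I \<subseteq> J" "J \<subseteq> carrier polynomial_ring"
  show "J = ?I \<or> J = carrier polynomial_ring"
  proof (rule disjCI)
    assume "J \<noteq> carrier polynomial_ring"
    have "J \<subseteq> ?I"
    proof (rule ccontr)
      assume "\<not> J \<subseteq> ?I"
      then obtain f where f: "f \<in> J" "\<not> q dvd f" by (auto simp: PIdl_polynomial_ring)
      from irreducible_poly_bezout[OF q f(2)] obtain a b where ab: "a * q + b * f = 1" by blast
      have c: "r \<in> carrier polynomial_ring" for r :: "'a poly" by (simp add: polynomial_ring_def)
      have "q \<in> ?I" by (simp add: PIdl_polynomial_ring)
      then have "q \<in> J" by (rule subsetD[OF J(2)])
      then have "a * q \<in> J" "b * f \<in> J"
        using ideal.I_l_closed[OF J(1) _ c, of q a] ideal.I_l_closed[OF J(1) f(1) c, of b]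
        by (simp_all add: polynomial_ring_def)
      then have "a * q + b * f \<in> J"
        using additive_subgroup.a_closed[OF ideal.axioms(1)[OF J(1)], of "a * q" "b * f"]
        by (simp add: polynomial_ring_def)
      then have "\<one>\<^bsub>polynomial_ring\<^esub> \<in> J" using ab by (simp add: polynomial_ring_def)
      then show False using ideal.one_imp_carrier[OF J(1)] \<open>J \<noteq> carrier polynomial_ring\<close> by blast
    qed
    then show "J = ?I" using J(2) by blast
  qed
qed

text \<open>Frees rank estimates from the index set of numbers below \<open>n\<close>.\<close>

lemma rank_geI:
  assumes act0: "\<And>x. act 0 x = 0" and I: "finite I" "n \<le> card I" "\<And>i. i \<in> I \<Longrightarrow> f i \<in> A"
    and ind: "\<And>c. (\<Sum>i\<in>I. act [:c i:] (f i)) \<in> Q \<Longrightarrow> \<forall>i\<in>I. c i = 0"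
  shows "rank_ge act A Q n"
proof -
  obtain J where J: "J \<subseteq> I" "card J = n" "finite J"
    using obtain_subset_with_card_n[OF I(2)] I(1) by (metis finite_subset)
  then obtain e where e: "bij_betw e {..<n} J" using ex_bij_betw_nat_finite[of J] by (auto simp: lessThan_atLeast0)
  show ?thesis unfolding rank_ge_def independent_mod_def
  proof (intro exI[of _ "f \<circ> e"] conjI allI impI)
    fix i assume "i < n"
    then have "e i \<in> J" using e by (auto simp: bij_betw_def)
    then show "(f \<circ> e) i \<in> A" using J(1) I(3) by auto
  next
    fix c i assume s: "(\<Sum>i<n. act [:c i:] ((f \<circ> e) i)) \<in> Q" and i: "i < n"
    \<comment> \<open>Scalars are carried over along the enumeration \<open>e\<close> and are zero
      off \<open>J\<close>, as only \<open>n\<close> indices are used.\<close>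
    define c' where "c' j = (if j \<in> J then c (inv_into {..<n} e j) else 0)" for j
    have "(\<Sum>i<n. act [:c i:] ((f \<circ> e) i)) = (\<Sum>i<n. act [:c' (e i):] (f (e i)))"
    proof (intro sum.cong refl)
      fix k assume k: "k \<in> {..<n}"
      then have "e k \<in> J" "inv_into {..<n} e (e k) = k"
        using e by (auto simp: bij_betw_def inv_into_f_f)
      then show "act [:c k:] ((f \<circ> e) k) = act [:c' (e k):] (f (e k))" by (simp add: c'_def)
    qed
    also have "\<dots> = (\<Sum>j\<in>J. act [:c' j:] (f j))" by (rule sum.reindex_bij_betw[OF e])
    also have "\<dots> = (\<Sum>j\<in>I. act [:c' j:] (f j))"
      by (rule sum.mono_neutral_left) (use I(1) J(1) act0 in \<open>auto simp: c'_def\<close>)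
    finally have "\<forall>j\<in>I. c' j = 0" using ind s by metis
    moreover have "e i \<in> J" "inv_into {..<n} e (e i) = i"
      using e i by (auto simp: bij_betw_def inv_into_f_f)
    ultimately show "c i = 0" using J(1) unfolding c'_def by force
  qed
qed

lemma countable_if_finite_fibres:
  assumes "\<And>i::nat. finite {c \<in> C. f c i}" "\<And>c. c \<in> C \<Longrightarrow> \<exists>i. f c i"
  shows "countable C"
proof -
  have "C = (\<Union>i. {c \<in> C. f c i})" using assms(2) by blast
  moreover have "countable (\<Union>i. {c \<in> C. f c i})" using assms(1) by (intro countable_UN) (auto intro: countable_finite)
  ultimately show ?thesis by simp
qed

text \<open>An independent set meets the span of finitely many generators in a finite set, and
  countably many such spans cover the space.\<close>

lemma (in vector_space) countable_independent:
  assumes B: "countable B" "span B = UNIV" and C: "independent C"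
  shows "countable C"
proof -
  define e where "e = from_nat_into (insert 0 B)"
  have e: "range e = insert 0 B" unfolding e_def using B(1) by (intro range_from_nat_into) auto
  show ?thesis
  proof (rule countable_if_finite_fibres[where f = "\<lambda>c i. c \<in> span (e ` {..<i})"])
    fix i :: nat
    have "independent {c \<in> C. c \<in> span (e ` {..<i})}" by (rule independent_mono[OF C]) auto
    then show "finite {c \<in> C. c \<in> span (e ` {..<i})}"
      using independent_span_bound[of "e ` {..<i}"] by blast
  next
    fix c
    have "c \<in> span B" using B(2) by simp
    then have "\<exists>t r. finite t \<and> t \<subseteq> B \<and> c = (\<Sum>a\<in>t. scale (r a) a)"
      unfolding span_explicit by auto
    then obtain t r where t: "finite t" "t \<subseteq> B" "c = (\<Sum>a\<in>t. scale (r a) a)" by blast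
    have "t \<subseteq> e ` UNIV" using t(2) e by auto
    then obtain I where I: "finite I" "t = e ` I" using finite_subset_image[OF t(1)] by metis
    then obtain m where "\<And>i. i \<in> I \<Longrightarrow> i < m" unfolding finite_nat_set_iff_bounded by auto
    then have "t \<subseteq> e ` {..<m}" using I(2) by auto
    then have "c \<in> span (e ` {..<m})" unfolding t(3)
      by (intro span_sum span_scale span_base) auto
    then show "\<exists>i. c \<in> span (e ` {..<i})" by blast
  qed
qed

text \<open>A vector space \<open>W\<close> over the residue field of \<open>p\<close>, presented as the quotient \<open>A / Q\<close> by means of
  the projection \<open>\<rho>\<close>.\<close>

locale residue_quotient = torsion_base act p
  for act :: "'a::field poly \<Rightarrow> 'm::ab_group_add \<Rightarrow> 'm" and p +
  fixes A Q :: "'m set" and W :: "('a poly set, 'w) module" and \<rho> :: "'m \<Rightarrow> 'w"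
  assumes A: "subspace A" and Q: "subspace Q" and carrier_W: "carrier W = \<rho> ` A"
    and W_add: "x \<in> A \<Longrightarrow> y \<in> A \<Longrightarrow> \<rho> x \<oplus>\<^bsub>W\<^esub> \<rho> y = \<rho> (x + y)"
    and W_zero: "\<zero>\<^bsub>W\<^esub> = \<rho> 0"
    and W_smult: "x \<in> A \<Longrightarrow> residue_class p r \<odot>\<^bsub>W\<^esub> \<rho> x = \<rho> (act r x)"
    and ker: "x \<in> A \<Longrightarrow> y \<in> A \<Longrightarrow> \<rho> x = \<rho> y \<longleftrightarrow> x - y \<in> Q"
begin

lemma vectorspace_W: "vectorspace (residue_field p) W"
proof -
  have F: "Ring.field (residue_field p)" by (rule field_residue_field[OF irr])
  then have cr: "cring (residue_field p)" by (intro domain.axioms(1) field.axioms(1))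
  have ab: "abelian_group W"
  proof (rule abelian_groupI)
    show "\<zero>\<^bsub>W\<^esub> \<in> carrier W" using subspace_0[OF A] by (simp add: carrier_W W_zero)
  next
    fix x y assume "x \<in> carrier W" "y \<in> carrier W"
    then show "x \<oplus>\<^bsub>W\<^esub> y \<in> carrier W" "x \<oplus>\<^bsub>W\<^esub> y = y \<oplus>\<^bsub>W\<^esub> x"
      using subspace_add[OF A] by (auto simp: carrier_W W_add add.commute)
  next
    fix x y z assume "x \<in> carrier W" "y \<in> carrier W" "z \<in> carrier W"
    then show "x \<oplus>\<^bsub>W\<^esub> y \<oplus>\<^bsub>W\<^esub> z = x \<oplus>\<^bsub>W\<^esub> (y \<oplus>\<^bsub>W\<^esub> z)"
      using subspace_add[OF A] by (auto simp: carrier_W W_add add.assoc)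
  next
    fix x assume "x \<in> carrier W"
    then obtain y where y: "y \<in> A" "x = \<rho> y" by (auto simp: carrier_W)
    show "\<zero>\<^bsub>W\<^esub> \<oplus>\<^bsub>W\<^esub> x = x" using subspace_0[OF A] y by (simp add: W_zero W_add)
    show "\<exists>y\<in>carrier W. y \<oplus>\<^bsub>W\<^esub> x = \<zero>\<^bsub>W\<^esub>"
      using subspace_neg[OF A y(1)] y by (intro bexI[of _ "\<rho> (- y)"]) (simp_all add: carrier_W W_add W_zero)
  qed
  have "Module.module (residue_field p) W"
  proof (rule moduleI[OF cr ab])
    fix a x assume "a \<in> carrier (residue_field p)" "x \<in> carrier W"
    then show "a \<odot>\<^bsub>W\<^esub> x \<in> carrier W"
      using subspace_scale[OF A] by (auto simp: carrier_residue_field carrier_W W_smult)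
  next
    fix a b x assume "a \<in> carrier (residue_field p)" "b \<in> carrier (residue_field p)" "x \<in> carrier W"
    then obtain r s y where rs: "a = residue_class p r" "b = residue_class p s" "y \<in> A" "x = \<rho> y"
      by (auto simp: carrier_residue_field carrier_W)
    show "(a \<oplus>\<^bsub>residue_field p\<^esub> b) \<odot>\<^bsub>W\<^esub> x = a \<odot>\<^bsub>W\<^esub> x \<oplus>\<^bsub>W\<^esub> b \<odot>\<^bsub>W\<^esub> x"
      using rs(3) subspace_scale[OF A rs(3)]
      by (simp add: rs residue_class_simps W_smult W_add scale_left_distrib)
    show "(a \<otimes>\<^bsub>residue_field p\<^esub> b) \<odot>\<^bsub>W\<^esub> x = a \<odot>\<^bsub>W\<^esub> (b \<odot>\<^bsub>W\<^esub> x)"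
      using rs(3) subspace_scale[OF A rs(3)] by (simp add: rs residue_class_simps W_smult)
  next
    fix a x y assume "a \<in> carrier (residue_field p)" "x \<in> carrier W" "y \<in> carrier W"
    then show "a \<odot>\<^bsub>W\<^esub> (x \<oplus>\<^bsub>W\<^esub> y) = a \<odot>\<^bsub>W\<^esub> x \<oplus>\<^bsub>W\<^esub> a \<odot>\<^bsub>W\<^esub> y"
      using subspace_scale[OF A] subspace_add[OF A]
      by (auto simp: carrier_residue_field carrier_W W_smult W_add scale_right_distrib)
  next
    fix x assume "x \<in> carrier W"
    then show "\<one>\<^bsub>residue_field p\<^esub> \<odot>\<^bsub>W\<^esub> x = x" by (auto simp: residue_class_simps carrier_W W_smult)
  qed
  then show ?thesis using F by (simp add: vectorspace_def)
qed

sublocale KW: vectorspace "residue_field p" W by (rule vectorspace_W)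

text \<open>Without it the choice in \<open>dimension\<close> would be void. Zorn's lemma applies
  because a linear dependence involves finitely many vectors only.\<close>

lemma ex_basis: "\<exists>B. KW.basis B"
proof -
  let ?P = "\<lambda>S. S \<subseteq> carrier W \<and> \<not> KW.lin_dep S"
  have "\<exists>M\<in>{S. ?P S}. \<forall>X\<in>{S. ?P S}. M \<subseteq> X \<longrightarrow> X = M"
  proof (rule subset_Zorn_nonempty)
    have "\<not> KW.lin_dep {}" unfolding KW.lin_dep_def by auto
    then show "{S. ?P S} \<noteq> {}" by blast
    fix \<C> assume C: "\<C> \<noteq> {}" "subset.chain {S. ?P S} \<C>"
    have "\<not> KW.lin_dep (\<Union>\<C>)"
    proof
      assume "KW.lin_dep (\<Union>\<C>)"
      then obtain F a v where F: "finite F" "F \<subseteq> \<Union>\<C>" "a \<in> F \<rightarrow> carrier (residue_field p)"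
        "KW.lincomb a F = \<zero>\<^bsub>W\<^esub>" "v \<in> F" "a v \<noteq> \<zero>\<^bsub>residue_field p\<^esub>"
        unfolding KW.lin_dep_def by blast
      then obtain S where S: "S \<in> \<C>" "F \<subseteq> S"
        using finite_subset_Union_chain[OF F(1,2) C(1)] C(2) by (metis subset_chain_def)
      then have "KW.lin_dep S" unfolding KW.lin_dep_def using F by blast
      then show False using S(1) C(2) by (auto simp: subset_chain_def)
    qed
    then show "\<Union>\<C> \<in> {S. ?P S}" using C(2) by (auto simp: subset_chain_def)
  qed
  then obtain M where M: "M \<in> {S. ?P S}" "\<forall>X\<in>{S. ?P S}. M \<subseteq> X \<longrightarrow> X = M" ..
  then have "maximal M ?P" unfolding maximal_def by simp
  then show ?thesis using KW.max_li_is_basis by blast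
qed

lemma lincomb_residue_class:
  assumes "finite F" "\<And>b. b \<in> F \<Longrightarrow> x b \<in> A \<and> \<rho> (x b) = b"
  shows "KW.lincomb (\<lambda>b. residue_class p (c b)) F = \<rho> (\<Sum>b\<in>F. act (c b) (x b)) \<and>
    (\<Sum>b\<in>F. act (c b) (x b)) \<in> A"
  using assms
proof (induction F rule: finite_induct)
  case empty
  then show ?case using subspace_0[OF A] by (simp add: KW.lincomb_def W_zero)
next
  case (insert b F)
  have F: "F \<subseteq> carrier W" "b \<in> carrier W" using insert.prems unfolding carrier_W by (metis image_eqI insertCI subsetI)+
  have "KW.lincomb (\<lambda>b. residue_class p (c b)) (F \<union> {b}) =
      residue_class p (c b) \<odot>\<^bsub>W\<^esub> b \<oplus>\<^bsub>W\<^esub> KW.lincomb (\<lambda>b. residue_class p (c b)) F"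
    by (rule KW.lincomb_insert) (use insert F in \<open>auto simp: carrier_residue_field\<close>)
  moreover have b: "x b \<in> A" "\<rho> (x b) = b" using insert.prems by auto
  have "residue_class p (c b) \<odot>\<^bsub>W\<^esub> b = \<rho> (act (c b) (x b))" using W_smult[OF b(1), of "c b"] b(2) by simp
  moreover have s: "act (c b) (x b) \<in> A" by (rule subspace_scale[OF A b(1)])
  moreover have IH: "KW.lincomb (\<lambda>b. residue_class p (c b)) F = \<rho> (\<Sum>b\<in>F. act (c b) (x b))"
    "(\<Sum>b\<in>F. act (c b) (x b)) \<in> A" using insert by auto
  ultimately show ?case using insert.hyps W_add[OF s IH(2)] subspace_add[OF A s IH(2)] by simp
qed

context
  fixes B x assumes B: "KW.basis B" and x: "\<And>b. b \<in> B \<Longrightarrow> x b \<in> A \<and> \<rho> (x b) = b"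
begin

lemma basis_independent:
  assumes F: "finite F" "F \<subseteq> B" and c: "reduced p c" "(\<Sum>b\<in>F. act (c b) (x b)) \<in> Q" and b: "b \<in> F"
  shows "c b = 0"
proof (rule ccontr)
  assume n: "c b \<noteq> 0"
  have *: "KW.lincomb (\<lambda>b. residue_class p (c b)) F = \<rho> (\<Sum>b\<in>F. act (c b) (x b))"
    "(\<Sum>b\<in>F. act (c b) (x b)) \<in> A" using lincomb_residue_class[of F x c] F x by auto
  then have "KW.lincomb (\<lambda>b. residue_class p (c b)) F = \<zero>\<^bsub>W\<^esub>"
    using ker[OF *(2) subspace_0[OF A]] c(2) by (simp add: W_zero)
  moreover have "residue_class p (c b) \<noteq> \<zero>\<^bsub>residue_field p\<^esub>"
    using n c(1) dvd_imp_degree_le[of p "c b"] by (auto simp: residue_class_simps residue_class_eq_iff reduced_def not_less[symmetric])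
  ultimately have "KW.lin_dep B" unfolding KW.lin_dep_def using F b
    by (intro exI[of _ F] exI[of _ "\<lambda>b. residue_class p (c b)"] exI[of _ b]) (auto simp: carrier_residue_field)
  then show False using B by (simp add: KW.basis_def)
qed

lemma basis_spanning:
  assumes y: "y \<in> A"
  shows "\<exists>F c. finite F \<and> F \<subseteq> B \<and> reduced p c \<and> y - (\<Sum>b\<in>F. act (c b) (x b)) \<in> Q"
proof -
  have "\<rho> y \<in> KW.span B" using B y by (auto simp: KW.basis_def carrier_W)
  then obtain a F where F: "finite F" "F \<subseteq> B" "a \<in> F \<rightarrow> carrier (residue_field p)" "\<rho> y = KW.lincomb a F"
    unfolding KW.span_def by blast
  have "\<exists>r. a b = residue_class p r" if b: "b \<in> F" for b
  proof -
    have "a b \<in> range (residue_class p)" using F(3) b unfolding carrier_residue_field by (rule funcset_mem)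
    then show ?thesis by blast
  qed
  then obtain r where r: "\<And>b. b \<in> F \<Longrightarrow> a b = residue_class p (r b)" by metis
  define c where "c b = r b mod p" for b
  have p0: "p \<noteq> 0" using degree_p by auto
  have c: "reduced p c" unfolding reduced_def c_def
  proof
    fix b show "degree (r b mod p) < degree p"
      using degree_mod_less[OF p0, of "r b"] degree_p by (elim disjE) simp_all
  qed
  have "a b = residue_class p (c b)" if "b \<in> F" for b
    using r[OF that] by (simp add: c_def residue_class_eq_iff minus_mod_eq_mult_div)
  moreover have "F \<subseteq> carrier W" using F(2) B by (auto simp: KW.basis_def)
  ultimately have "KW.lincomb a F = KW.lincomb (\<lambda>b. residue_class p (c b)) F"
    by (intro KW.lincomb_cong) (auto simp: carrier_residue_field)
  moreover have "KW.lincomb (\<lambda>b. residue_class p (c b)) F = \<rho> (\<Sum>b\<in>F. act (c b) (x b)) \<and>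
    (\<Sum>b\<in>F. act (c b) (x b)) \<in> A" using lincomb_residue_class[of F x c] F x by auto
  ultimately have "y - (\<Sum>b\<in>F. act (c b) (x b)) \<in> Q" using F(4) ker[OF y] by simp
  then show ?thesis using F c by blast
qed

text \<open>The residue field has the powers of t below \<open>degree p\<close> as a basis over the
  ground field, whence the factor \<open>degree p\<close>.\<close>

lemma rank_basis:
  "rank_ge act A Q n \<longleftrightarrow> infinite B \<or> n \<le> card B * degree p"
proof
  assume r: "infinite B \<or> n \<le> card B * degree p"
  have "\<exists>F. finite F \<and> F \<subseteq> B \<and> n \<le> card F * degree p"
  proof (cases "finite B")
    case True
    then show ?thesis using r by blast
  next
    case False
    then obtain F where "F \<subseteq> B" "card F = n" "finite F" using infinite_arbitrarily_large by blast
    then show ?thesis using degree_p by (intro exI[of _ F]) auto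
  qed
  then obtain F where F: "finite F" "F \<subseteq> B" "n \<le> card F * degree p" by blast
  show "rank_ge act A Q n"
  proof (rule rank_geI[where I = "F \<times> {..<degree p}" and f = "\<lambda>(b, i). act (monom 1 i) (x b)"])
    show "n \<le> card (F \<times> {..<degree p})" using F by simp
    show "(case j of (b, i) \<Rightarrow> act (monom 1 i) (x b)) \<in> A" if "j \<in> F \<times> {..<degree p}" for j
      using that x F(2) by (auto intro!: subspace_scale[OF A])
  next
    fix c :: "'w \<times> nat \<Rightarrow> 'a"
    assume s: "(\<Sum>j\<in>F \<times> {..<degree p}. act [:c j:] (case j of (b, i) \<Rightarrow> act (monom 1 i) (x b))) \<in> Q"
    \<comment> \<open>The scalars belonging to one basis vector are gathered into one reduced
      polynomial.\<close>
    define e where "e b = (\<Sum>i<degree p. monom (c (b, i)) i)" for b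
    have e: "reduced p e" unfolding reduced_def e_def
    proof
      fix b
      have "degree (\<Sum>i<degree p. monom (c (b, i)) i) \<le> degree p - 1"
        by (rule degree_sum_le) (auto intro: order.trans[OF degree_monom_le])
      then show "degree (\<Sum>i<degree p. monom (c (b, i)) i) < degree p" using degree_p by linarith
    qed
    have "(\<Sum>j\<in>F \<times> {..<degree p}. act [:c j:] (case j of (b, i) \<Rightarrow> act (monom 1 i) (x b)))
        = (\<Sum>b\<in>F. \<Sum>i<degree p. act [:c (b, i):] (act (monom 1 i) (x b)))"
      by (simp add: sum.cartesian_product split_def)
    also have "\<dots> = (\<Sum>b\<in>F. act (e b) (x b))"
      unfolding e_def scale_sum_left by (simp add: smult_monom)
    finally have "e b = 0" if "b \<in> F" for b
      using basis_independent[OF F(1,2) e _ that] s by simp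
    moreover have "coeff (e b) i = c (b, i)" if "i < degree p" for b i
      using that by (simp add: e_def coeff_sum)
    ultimately have "c (b, i) = 0" if "b \<in> F" "i < degree p" for b i
      using that by (metis coeff_0)
    then show "\<forall>j\<in>F \<times> {..<degree p}. c j = 0" by auto
  qed (use F in auto)
next
  assume r: "rank_ge act A Q n"
  show "infinite B \<or> n \<le> card B * degree p"
  proof (rule disjCI)
    assume "\<not> n \<le> card B * degree p"
    interpret F: vector_space "\<lambda>c. act [:c:]" by (rule vector_space_const)
    show "infinite B"
    proof
      assume fin: "finite B"
      define T where "T = (\<lambda>(b, i). act (monom 1 i) (x b)) ` (B \<times> {..<degree p})"
      have T: "finite T" "card T \<le> card B * degree p"
        unfolding T_def using fin card_image_le[of "B \<times> {..<degree p}"] by (auto simp: card_cartesian_product)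
      obtain f where f: "\<forall>i<n. f i \<in> A" "independent_mod act Q n f" using r unfolding rank_ge_def by blast
      \<comment> \<open>Modulo \<open>Q\<close> every element of \<open>A\<close> comes from the
        finite set \<open>T\<close>, so an independent family modulo \<open>Q\<close> lifts to one
        in the span of \<open>T\<close>.\<close>
      have "\<exists>g. g \<in> F.span T \<and> y - g \<in> Q" if y: "y \<in> A" for y
      proof -
        obtain F c where Fc: "finite F" "F \<subseteq> B" "reduced p c" "y - (\<Sum>b\<in>F. act (c b) (x b)) \<in> Q"
          using basis_spanning[OF y] by blast
        have "act (c b) (x b) \<in> F.span T" if b: "b \<in> F" for b
        proof (rule act_in_const_span)
          fix i assume "i < degree p"
          then have "(b, i) \<in> B \<times> {..<degree p}" using b Fc(2) by auto
          then show "act (monom 1 i) (x b) \<in> T" unfolding T_def by (rule rev_image_eqI) simp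
        qed (use Fc(3) in \<open>simp add: reduced_def\<close>)
        then have "(\<Sum>b\<in>F. act (c b) (x b)) \<in> F.span T" by (rule F.span_sum)
        then show ?thesis using Fc(4) by blast
      qed
      then have "\<forall>i. \<exists>g. i < n \<longrightarrow> g \<in> F.span T \<and> f i - g \<in> Q" using f(1) by blast
      then obtain g where g: "\<And>i. i < n \<Longrightarrow> g i \<in> F.span T \<and> f i - g i \<in> Q" by metis
      have "independent_mod act {0} n g" unfolding independent_mod_def
      proof (rule allI, rule impI)
        fix c assume s: "(\<Sum>i<n. act [:c i:] (g i)) \<in> {0}"
        have "(\<Sum>i<n. act [:c i:] (f i - g i)) \<in> Q"
          using g by (intro subspace_sum[OF Q] subspace_scale[OF Q]) auto
        then have "(\<Sum>i<n. act [:c i:] (f i)) \<in> Q"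
          using s by (simp add: scale_right_diff_distrib sum_subtractf)
        then show "\<forall>i<n. c i = 0" using f(2) unfolding independent_mod_def by blast
      qed
      then have "n \<le> card T" using independent_mod_card[OF T(1)] g by blast
      then show False using T(2) \<open>\<not> n \<le> card B * degree p\<close> by simp
    qed
  qed
qed

lemma countable_basis:
  assumes C: "countable C" "Modules.module.span (\<lambda>c. act [:c:]) C = UNIV"
  shows "countable B"
proof -
  interpret F: vector_space "\<lambda>c. act [:c:]" by (rule vector_space_const)
  have inj: "inj_on x B" by (rule inj_onI) (metis x)
  have "F.independent (x ` B)" unfolding F.independent_explicit_module
  proof (intro allI impI)
    fix t u v assume t: "finite t" "t \<subseteq> x ` B" "(\<Sum>v\<in>t. act [:u v:] v) = 0" "v \<in> t"
    obtain F where F: "F \<subseteq> B" "t = x ` F" using t(2) by (metis subset_imageE)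
    have injF: "inj_on x F" using inj F(1) by (rule inj_on_subset)
    have "(\<Sum>b\<in>F. act [:u (x b):] (x b)) = 0" using t(3) unfolding F(2) sum.reindex[OF injF] by simp
    then have "(\<Sum>b\<in>F. act [:u (x b):] (x b)) \<in> Q" using subspace_0[OF Q] by simp
    moreover obtain b where b: "b \<in> F" "v = x b" using t(4) F(2) by blast
    ultimately have "[:u (x b):] = 0"
      using t(1) F injF degree_p
      by (intro basis_independent[of F "\<lambda>b. [:u (x b):]" b]) (auto simp: reduced_def finite_image_iff)
    then show "u v = 0" using b by simp
  qed
  then have "countable (x ` B)" by (rule F.countable_independent[OF C])
  then show ?thesis using inj by (simp add: countable_image_inj_eq)
qed

end

end

section \<open>Heights from the transfinite sequence of images\<close>

lemma omega1_cases:
  obtains "a = ozero" | b where "a = osucc b" | "is_limit a"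
  by (auto simp: is_limit_def is_successor_def)

lemma omega1_induct [case_names zero succ limit]:
  assumes "P ozero" "\<And>a. P a \<Longrightarrow> P (osucc a)" "\<And>a. is_limit a \<Longrightarrow> (\<And>b. b < a \<Longrightarrow> P b) \<Longrightarrow> P a"
  shows "P a"
proof (induction a rule: less_induct)
  case (less a)
  show ?case
    by (cases a rule: omega1_cases) (use assms less less_osucc in auto)
qed

lemma uncountable_omega1: "\<not> countable (UNIV :: omega1 set)"
proof
  assume "countable (UNIV :: omega1 set)"
  then obtain f :: "omega1 \<Rightarrow> nat" where "inj f" by (rule countableE)
  then have "|UNIV :: omega1 set| \<le>o |UNIV :: nat set|"
    using card_of_ordLeq[of UNIV UNIV] by auto
  moreover have "|UNIV :: nat set| <o |UNIV :: omega1 set|"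
  proof -
    have C: "Card_order (card_suc |UNIV :: nat set| )" by (rule Card_order_card_suc) (rule card_of_card_order_on)
    have "|UNIV :: nat set| <o card_suc |UNIV :: nat set|" by (rule card_suc_greater) (rule card_of_card_order_on)
    moreover have "card_suc |UNIV :: nat set| =o |UNIV :: omega1 set|"
      using card_of_Field_ordIso[OF C] by (simp add: Field_card_suc ordIso_symmetric)
    ultimately show ?thesis by (rule ordLess_ordIso_trans)
  qed
  ultimately show False using not_ordLess_ordLeq by blast
qed

context torsion_base
begin

definition img :: "omega1 \<Rightarrow> 'm set"
  where "img a = iterated_image (act p) a"

lemma img_simps: "img ozero = UNIV" "img (osucc a) = act p ` img a"
  "is_limit a \<Longrightarrow> img a = (\<Inter>b\<in>{..<a}. img b)"
  by (simp_all add: img_def iterated_image_ozero iterated_image_osucc iterated_image_limit)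

lemma subspace_img: "subspace (img a)"
proof (induction a rule: omega1_induct)
  case zero
  show ?case by (simp add: img_simps subspace_UNIV)
next
  case (succ a)
  show ?case unfolding img_simps subspace_def
  proof (intro conjI ballI allI)
    show "0 \<in> act p ` img a" using subspace_0[OF succ] by (rule rev_image_eqI) simp
    fix x y assume "x \<in> act p ` img a" "y \<in> act p ` img a"
    then obtain v w where v: "v \<in> img a" "w \<in> img a" "x = act p v" "y = act p w" by blast
    show "x + y \<in> act p ` img a"
      using subspace_add[OF succ v(1,2)] by (rule rev_image_eqI) (simp add: v scale_right_distrib)
  next
    fix r x assume "x \<in> act p ` img a"
    then obtain v where v: "v \<in> img a" "x = act p v" by blast
    show "act r x \<in> act p ` img a"
      using subspace_scale[OF succ v(1), of r] by (rule rev_image_eqI) (simp add: v mult.commute)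
  qed
next
  case (limit a)
  then show ?case by (auto simp: img_simps intro: subspace_Int)
qed

lemma img_osucc_subset: "img (osucc a) \<subseteq> img a"
proof (induction a rule: omega1_induct)
  case (limit a)
  have "act p x \<in> img b" if x: "x \<in> img a" and b: "b < a" for x b
  proof -
    have "x \<in> img b" using x b by (simp add: img_simps(3)[OF limit(1)])
    then show ?thesis using limit(2)[OF b] by (auto simp: img_simps(2))
  qed
  then show ?case unfolding img_simps(2) by (auto simp: img_simps(3)[OF limit(1)])
qed (auto simp: img_simps)

lemma img_antimono: "a \<le> b \<Longrightarrow> img b \<subseteq> img a"
proof (induction b rule: omega1_induct)
  case zero
  then show ?case using ozero_le[of a] by (metis antisym order_refl)
next
  case (succ b)
  then show ?case using img_osucc_subset[of b] by (auto simp: le_osucc_cases)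
next
  case (limit b)
  then show ?case by (cases "a = b") (auto simp: img_simps(3)[OF limit(1)])
qed

definition stable :: "omega1 \<Rightarrow> bool"
  where "stable a \<longleftrightarrow> img (osucc a) = img a"

lemma stableD: "stable a \<Longrightarrow> a \<le> b \<Longrightarrow> img b = img a"
proof (induction b rule: omega1_induct)
  case zero
  then show ?case using ozero_le[of a] by (metis antisym)
next
  case (succ b)
  then show ?case by (auto simp: le_osucc_cases img_simps(2) stable_def)
next
  case (limit b)
  show ?case
  proof (cases "a = b")
    case False
    then have ab: "a < b" using limit.prems(2) by simp
    have "img a \<subseteq> img c" if "c < b" for c
      using limit.IH[OF that limit.prems(1)] img_antimono[of c a] by (cases "a \<le> c") auto
    then show ?thesis using ab by (auto simp: img_simps(3)[OF limit.hyps])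
  qed simp
qed

lemma stable_mono: "stable a \<Longrightarrow> a \<le> b \<Longrightarrow> stable b"
  using stableD[of a b] stableD[of a "osucc b"] less_osucc[of b] by (simp add: stable_def)

text \<open>A drop at every countable ordinal would give an uncountable independent family.\<close>

lemma ex_stable:
  assumes C: "countable C" "Modules.module.span (\<lambda>c. act [:c:]) C = UNIV"
  shows "\<exists>a. stable a"
proof (rule ccontr)
  interpret F: vector_space "\<lambda>c. act [:c:]" by (rule vector_space_const)
  assume "\<not> ?thesis"
  then have "\<forall>a. \<exists>x. x \<in> img a \<and> x \<notin> img (osucc a)" using img_osucc_subset unfolding stable_def by blast
  then obtain x where x: "\<And>a. x a \<in> img a" "\<And>a. x a \<notin> img (osucc a)" by metis
  have up: "x b \<in> img (osucc a)" if "a < b" for a b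
    using x(1)[of b] img_antimono[of "osucc a" b] that by (auto simp: osucc_le_iff)
  have inj: "inj x"
  proof (rule injI)
    fix a b assume "x a = x b"
    then show "a = b" using up x(2) by (metis linorder_neqE)
  qed
  have "F.independent (range x)" unfolding F.independent_explicit_module
  proof (intro allI impI, rule ccontr)
    fix t r v assume t: "finite t" "t \<subseteq> range x" "(\<Sum>v\<in>t. act [:r v:] v) = 0" "v \<in> t" "r v \<noteq> 0"
    obtain I where I: "t = x ` I" using t(2) by (metis subset_imageE)
    have injI: "inj_on x I" using inj by (rule inj_on_subset) simp
    have finI: "finite I" using t(1) I injI by (simp add: finite_image_iff)
    define J where "J = {a \<in> I. r (x a) \<noteq> 0}"
    \<comment> \<open>In a relation, all terms beyond the least ordinal lie in the image after it,
      so the term at \<open>a\<close> would too, contrary to the choice of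
      \<open>x a\<close>.\<close>
    define a where "a = Min J"
    have J: "finite J" "J \<noteq> {}" using finI t(4,5) I by (auto simp: J_def)
    then have a: "a \<in> J" "\<And>b. b \<in> J \<Longrightarrow> a \<le> b" unfolding a_def by auto
    have "0 = (\<Sum>b\<in>I. act [:r (x b):] (x b))" using t(3) unfolding I sum.reindex[OF injI] by simp
    also have "\<dots> = (\<Sum>b\<in>J. act [:r (x b):] (x b))"
      by (rule sum.mono_neutral_right) (use finI in \<open>auto simp: J_def\<close>)
    also have "\<dots> = act [:r (x a):] (x a) + (\<Sum>b\<in>J - {a}. act [:r (x b):] (x b))"
      by (rule sum.remove[OF J(1) a(1)])
    finally have "act [:r (x a):] (x a) = - (\<Sum>b\<in>J - {a}. act [:r (x b):] (x b))"
      by (simp add: eq_neg_iff_add_eq_0)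
    moreover have "a < b" if "b \<in> J - {a}" for b using a(2)[of b] that by auto
    then have "(\<Sum>b\<in>J - {a}. act [:r (x b):] (x b)) \<in> img (osucc a)"
      by (intro subspace_sum[OF subspace_img] subspace_scale[OF subspace_img] up)
    ultimately have "act [:r (x a):] (x a) \<in> img (osucc a)" using subspace_neg[OF subspace_img] by simp
    then have "act [:inverse (r (x a)):] (act [:r (x a):] (x a)) \<in> img (osucc a)"
      by (rule subspace_scale[OF subspace_img])
    then show False using x(2)[of a] a(1) by (simp add: J_def one_pCons[symmetric])
  qed
  then have "countable (range x)" by (rule F.countable_independent[OF C])
  then have "countable (UNIV :: omega1 set)" using inj by (simp add: countable_image_inj_eq)
  then show False using uncountable_omega1 by blast
qed

lemma iterated_image_final_eq:
  assumes "stable a"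
  shows "iterated_image_final (act p) = img a"
  unfolding iterated_image_final_def
proof (rule the_equality)
  show "\<exists>c. \<forall>b\<ge>c. iterated_image (act p) b = img a"
    using stableD[OF assms] unfolding img_def by blast
  fix W assume "\<exists>c. \<forall>b\<ge>c. iterated_image (act p) b = W"
  then obtain c where "\<And>b. c \<le> b \<Longrightarrow> img b = W" unfolding img_def by blast
  then have "img (max a c) = W" by simp
  then show "W = img a" using stableD[OF assms, of "max a c"] by simp
qed

definition height :: "omega1 \<Rightarrow> 'm \<Rightarrow> omega1"
  where "height lam x = (if x = 0 then osucc lam else if x \<in> img lam then lam
    else (THE a. x \<in> img a \<and> x \<notin> img (osucc a)))"

lemma height_iff:
  assumes a: "a \<le> lam"
  shows "a \<le> height lam x \<longleftrightarrow> x \<in> img a"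
proof -
  consider "x = 0" | "x \<noteq> 0" "x \<in> img lam" | "x \<noteq> 0" "x \<notin> img lam" by blast
  then show ?thesis
  proof cases
    case 1
    then show ?thesis using a less_osucc[of lam] subspace_0[OF subspace_img] by (simp add: height_def less_imp_le le_less_trans)
  next
    case 2
    then show ?thesis using a img_antimono[OF a] by (auto simp: height_def)
  next
    case 3
    define b where "b = (LEAST b. x \<notin> img b)"
    have b: "x \<notin> img b" unfolding b_def using 3 by (intro LeastI)
    have min: "x \<in> img c" if "c < b" for c using that not_less_Least unfolding b_def by blast
    \<comment> \<open>The first image that misses \<open>x\<close> cannot be at zero, where it is
      everything, nor at a limit, where it is the intersection of earlier ones.\<close>
    have "\<exists>c. b = osucc c"
      by (cases b rule: omega1_cases) (use b min in \<open>auto simp: img_simps\<close>)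
    then obtain c where c: "b = osucc c" by blast
    have cx: "x \<in> img c" "x \<notin> img (osucc c)" using min b less_osucc[of c] by (auto simp: c)
    have iff: "x \<in> img d \<longleftrightarrow> d \<le> c" for d
      using img_antimono[of d c] img_antimono[of "osucc c" d] cx by (auto simp: osucc_le_iff not_le[symmetric])
    have "(THE a. x \<in> img a \<and> x \<notin> img (osucc a)) = c"
      by (rule the_equality) (auto simp: cx iff osucc_le_iff less_osucc_iff not_less intro: antisym)
    then show ?thesis using 3 by (simp add: height_def iff)
  qed
qed

lemma height_top: "lam < height lam x \<longleftrightarrow> x = 0"
proof (cases "x = 0")
  case False
  have "height lam x \<le> lam"
  proof (cases "x \<in> img lam")
    case False
    then show ?thesis using height_iff[of lam lam x] by auto
  qed (use \<open>x \<noteq> 0\<close> in \<open>simp add: height_def\<close>)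
  then show ?thesis using False by simp
qed (simp add: height_def less_osucc)

lemma height_le: "height lam x \<le> osucc lam"
  using height_top[of lam x] less_osucc[of lam] by (cases "x = 0") (auto simp: height_def[of _ 0])

lemma height_module_height:
  assumes st: "stable lam"
  shows "height_module act p (height lam) lam"
proof
  fix x y :: 'm and r :: "'a poly"
  show zero: "height lam 0 = osucc lam" by (simp add: height_def)
  show "height lam x \<le> osucc lam" by (rule height_le)
  show "min (height lam x) (height lam y) \<le> height lam (x + y)"
  proof (cases "x = 0 \<or> y = 0")
    case False
    define m where "m = min (height lam x) (height lam y)"
    have m: "m \<le> lam" "m \<le> height lam x" "m \<le> height lam y"
      using False height_top[of lam x] unfolding m_def by (auto simp: min.coboundedI1 not_less)
    then show ?thesis unfolding m_def[symmetric]
      using subspace_add[OF subspace_img] by (simp add: height_iff)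
  qed auto
  show "height lam x \<le> height lam (act r x)"
  proof (cases "x = 0")
    case False
    then have m: "height lam x \<le> lam" using height_top[of lam x] by (simp add: not_less)
    then show ?thesis using subspace_scale[OF subspace_img] height_iff[OF m] by blast
  qed simp
  show "capped_succ lam (height lam x) \<le> height lam (act p x)"
  proof (cases "height lam x < lam")
    case True
    then have "act p x \<in> img (osucc (height lam x))"
      using height_iff[of "height lam x" lam x] by (simp add: img_simps(2))
    then show ?thesis using True height_iff[of "osucc (height lam x)" lam] by (simp add: capped_succ_def osucc_le_iff)
  next
    case False
    then have "x \<in> img lam" using height_iff[of lam lam x] by (simp add: not_less)
    then have "act p x \<in> img lam" by (rule subspace_scale[OF subspace_img])
    then show ?thesis using False height_iff[of lam lam] by (simp add: capped_succ_def)
  qed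
next
  fix x :: 'm assume "x \<noteq> 0"
  then show "height lam x \<le> lam" using height_top[of lam x] by (simp add: not_less)
next
  fix b z assume b: "b \<le> lam" "capped_succ lam b \<le> height lam z"
  then have "z \<in> img (capped_succ lam b)" using height_iff[OF capped_succ_le] by blast
  \<comment> \<open>For \<open>b = lam\<close> this is stationarity: the image at \<open>lam\<close>
    is divisible by \<open>p\<close>.\<close>
  also have "img (capped_succ lam b) \<subseteq> img (osucc b)"
    using b(1) st by (cases "b < lam") (auto simp: capped_succ_def stable_def)
  finally obtain y where "y \<in> img b" "z = act p y" by (auto simp: img_simps(2))
  then show "\<exists>y. act p y = z \<and> b \<le> height lam y" using height_iff[OF b(1)] by blast
qed

text \<open>Representatives in the \<open>a\<close>-th image of the kernel of the map induced by
  \<open>p\<close> on layers.\<close>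

definition layer_set :: "omega1 \<Rightarrow> 'm set"
  where "layer_set a = {x \<in> img a. act p x \<in> img (osucc (osucc a))}"

definition final_socle :: "omega1 \<Rightarrow> 'm set"
  where "final_socle lam = {x. act p x = 0} \<inter> img lam"

text \<open>Links the height-theoretic layers of the back-and-forth argument with the Kaplansky
  invariants.\<close>

lemma layer_rep_height:
  assumes st: "stable lam" and a: "a \<le> lam"
  shows "valued_module.layer_rep act p (height lam) lam a = (if a = lam then final_socle lam else layer_set a)"
    and "valued_module.above (height lam) (osucc a) = (if a = lam then {0} else img (osucc a))"
proof -
  interpret H: height_module act p "height lam" lam by (rule height_module_height[OF st])
  have top: "osucc lam \<le> height lam x \<longleftrightarrow> x = 0" for x by (simp add: osucc_le_iff height_top)
  show "H.above (osucc a) = (if a = lam then {0} else img (osucc a))"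
    using a height_iff[of "osucc a" lam] by (auto simp: H.above_def osucc_le_iff height_top)
  show "H.layer_rep a = (if a = lam then final_socle lam else layer_set a)"
  proof (cases "a = lam")
    case True
    then show ?thesis using height_iff[of lam lam]
      by (auto simp: H.layer_rep_def final_socle_def top)
  next
    case False
    then have o: "osucc a \<le> lam" using a by (simp add: osucc_le_iff)
    \<comment> \<open>If \<open>osucc a = lam\<close>, the cap stops one step early, which is
      harmless as the images are stationary from \<open>lam\<close> on.\<close>
    have "img (capped_succ lam (osucc a)) = img (osucc (osucc a))"
      using o st by (auto simp: capped_succ_def stable_def)
    then show ?thesis using False height_iff[OF a] height_iff[OF capped_succ_le, of lam "osucc a"]
      by (auto simp: H.layer_rep_def layer_set_def)
  qed
qed

end

section \<open>Cosets, and polynomials evaluated at an endomorphism\<close>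

lemma mem_coset_iff: "x \<in> (\<lambda>n. n + y) ` N \<longleftrightarrow> x - y \<in> N" for x :: "'v::ab_group_add"
  unfolding image_iff by (auto intro: bexI[of _ "x - y"])

lemma (in Modules.module) coset_eq_iff:
  assumes N: "subspace N"
  shows "(\<lambda>n. n + x) ` N = (\<lambda>n. n + y) ` N \<longleftrightarrow> x - y \<in> N"
proof
  assume "(\<lambda>n. n + x) ` N = (\<lambda>n. n + y) ` N"
  moreover have "x \<in> (\<lambda>n. n + x) ` N" using subspace_0[OF N] by (simp add: mem_coset_iff)
  ultimately show "x - y \<in> N" by (simp add: mem_coset_iff)
next
  assume d: "x - y \<in> N"
  have *: "z - x \<in> N \<longleftrightarrow> z - y \<in> N" for z
    using subspace_add[OF N _ d, of "z - x"] subspace_diff[OF N _ d, of "z - y"] by auto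
  show "(\<lambda>n. n + x) ` N = (\<lambda>n. n + y) ` N" by (rule Set.set_eqI) (simp only: mem_coset_iff *)
qed

lemma a_rcosets_eq: "a_rcosets\<^bsub>G\<^esub> N = (\<Union>a\<in>carrier G. {N +>\<^bsub>G\<^esub> a})"
  by (simp add: A_RCOSETS_def RCOSETS_def a_r_coset_def)

lemma poly_apply_pCons:
  assumes "vector_space scale" and u: "Vector_Spaces.linear scale scale u"
  shows "poly_apply scale (pCons a r) u x = scale a x + u (poly_apply scale r u x)"
proof -
  interpret vector_space scale by fact
  interpret U: Vector_Spaces.linear scale scale u by fact
  have *: "poly_apply scale r u x = (\<Sum>k\<le>n. scale (coeff r k) ((u ^^ k) x))" if "degree r \<le> n" for r n
    unfolding poly_apply_def by (rule sum.mono_neutral_left) (use that in \<open>auto simp: coeff_eq_0\<close>)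
  have "degree (pCons a r) \<le> Suc (degree r)" by (rule degree_pCons_le)
  then have "poly_apply scale (pCons a r) u x = (\<Sum>k\<le>Suc (degree r). scale (coeff (pCons a r) k) ((u ^^ k) x))"
    by (rule *)
  also have "\<dots> = scale a x + (\<Sum>k\<le>degree r. scale (coeff r k) (u ((u ^^ k) x)))"
    by (subst sum.atMost_Suc_shift) simp
  also have "(\<Sum>k\<le>degree r. scale (coeff r k) (u ((u ^^ k) x))) = u (poly_apply scale r u x)"
    unfolding poly_apply_def by (simp add: U.sum U.scale)
  finally show ?thesis .
qed

lemma poly_apply_module:
  assumes vs: "vector_space scale" and u: "Vector_Spaces.linear scale scale u"
  shows "Modules.module (\<lambda>r. poly_apply scale r u)"
proof -
  interpret vector_space scale by fact
  interpret U: Vector_Spaces.linear scale scale u by fact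
  note pc = poly_apply_pCons[OF vs u]
  have zero: "poly_apply scale 0 u x = 0" for x by (simp add: poly_apply_def)
  have add: "poly_apply scale r u (x + y) = poly_apply scale r u x + poly_apply scale r u y" for r x y
    by (induction r) (simp_all add: zero pc scale_right_distrib U.add algebra_simps)
  have sc: "poly_apply scale r u (scale a x) = scale a (poly_apply scale r u x)" for r a x
    by (induction r) (simp_all add: zero pc scale_right_distrib U.scale mult.commute)
  have uu: "poly_apply scale r u (u x) = u (poly_apply scale r u x)" for r x
    by (induction r) (simp_all add: zero pc U.add U.scale)
  have add': "poly_apply scale (r + s) u x = poly_apply scale r u x + poly_apply scale s u x" for r s x
    by (induction r s rule: poly_induct2) (simp_all add: zero pc scale_left_distrib U.add algebra_simps)
  have smult: "poly_apply scale (Polynomial.smult a r) u x = scale a (poly_apply scale r u x)" for a r x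
    by (induction r) (simp_all add: zero pc scale_right_distrib U.scale)
  show ?thesis
  proof
    show "poly_apply scale r u (poly_apply scale s u x) = poly_apply scale (r * s) u x" for r s x
      by (induction r) (simp_all add: zero pc add' smult)
    show "poly_apply scale 1 u x = x" for x by (simp add: one_pCons pc zero)
  qed (simp_all add: add add')
qed

lemma poly_apply_const:
  assumes "vector_space scale" "Vector_Spaces.linear scale scale u"
  shows "poly_apply scale [:c:] u x = scale c x"
  by (simp add: poly_apply_def)

lemma poly_apply_X:
  assumes "vector_space scale" "Vector_Spaces.linear scale scale u"
  shows "poly_apply scale [:0, 1:] u x = u x"
proof -
  interpret vector_space scale by fact
  show ?thesis by (simp add: poly_apply_def)
qed

locale endomorphism = vector_space scale + U: Vector_Spaces.linear scale scale u
  for scale :: "'a::field \<Rightarrow> 'v::ab_group_add \<Rightarrow> 'v" and u :: "'v \<Rightarrow> 'v"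
begin

abbreviation "act \<equiv> \<lambda>r. poly_apply scale r u"

lemma torsion_base_poly_apply: "irreducible p \<Longrightarrow> torsion_base act p"
  by (intro torsion_base.intro poly_module.intro torsion_base_axioms.intro poly_apply_module vector_space_axioms U.linear_axioms)

text \<open>Replaces the record constructions behind \<open>kappa\<close> by a projection from
  \<open>layer_set\<close>, so that the rank formula of \<open>residue_quotient\<close> becomes
  available.\<close>

lemma kappa_quotient:
  assumes p: "irreducible p"
  shows "residue_quotient act p
    (torsion_base.layer_set act p \<alpha>)
    (torsion_base.img act p (osucc \<alpha>))
    (over_residue_field (layer scale p u \<alpha>\<lparr>carrier := layer_kernel scale p u \<alpha>\<rparr>))
    (\<lambda>x. (\<lambda>y. y + x) ` torsion_base.img act p (osucc \<alpha>))"
proof -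
  interpret T: torsion_base act p by (rule torsion_base_poly_apply[OF p])
  let ?N = "T.img (osucc \<alpha>)" and ?N' = "T.img (osucc (osucc \<alpha>))"
  define \<rho> where "\<rho> x = (\<lambda>y. y + x) ` ?N" for x
  define \<rho>' where "\<rho>' x = (\<lambda>y. y + x) ` ?N'" for x
  have pow: "power_submodule scale p u \<beta> = T.img \<beta>" for \<beta>
    by (simp add: power_submodule_def T.img_def)
  have ml: "x \<in> \<rho> y \<longleftrightarrow> x - y \<in> ?N" for x y unfolding \<rho>_def by (rule mem_coset_iff)
  note sN = T.subspace_img[of "osucc \<alpha>"] and sN' = T.subspace_img[of "osucc (osucc \<alpha>)"]
  have eq: "\<rho> x = \<rho> y \<longleftrightarrow> x - y \<in> ?N" for x y unfolding \<rho>_def by (rule T.coset_eq_iff[OF sN])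
  have eq': "\<rho>' x = \<rho>' y \<longleftrightarrow> x - y \<in> ?N'" for x y unfolding \<rho>'_def by (rule T.coset_eq_iff[OF sN'])
  have UN: "(\<Union>y\<in>\<rho> x. \<rho> (act r y)) = \<rho> (act r x)" for r x
  proof -
    have "\<rho> (act r y) = \<rho> (act r x)" if "y \<in> \<rho> x" for y
      using T.subspace_scale[OF sN, of "y - x" r] that by (simp add: eq ml T.scale_right_diff_distrib)
    moreover have "x \<in> \<rho> x" using T.subspace_0[OF sN] by (simp add: ml)
    ultimately show ?thesis by blast
  qed
  have UN': "(\<Union>y\<in>\<rho> x. \<rho>' (act p y)) = \<rho>' (act p x)" for x
  proof -
    have "\<rho>' (act p y) = \<rho>' (act p x)" if "y \<in> \<rho> x" for y
    proof -
      have "act p (y - x) \<in> ?N'" using that by (auto simp: ml T.img_simps(2))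
      then show ?thesis by (simp add: eq' T.scale_right_diff_distrib)
    qed
    moreover have "x \<in> \<rho> x" using T.subspace_0[OF sN] by (simp add: ml)
    ultimately show ?thesis by blast
  qed
  have coset: "?N +>\<^bsub>endo_module scale u\<lparr>carrier := X\<rparr>\<^esub> x = \<rho> x" for X x
    by (auto simp: a_r_coset_def r_coset_def endo_module_def \<rho>_def)
  have coset': "?N' +>\<^bsub>endo_module scale u\<lparr>carrier := X\<rparr>\<^esub> x = \<rho>' x" for X x
    by (auto simp: a_r_coset_def r_coset_def endo_module_def \<rho>'_def)
  have sm: "r \<odot>\<^bsub>endo_module scale u\<^esub> y = act r y" for r y
    by (simp add: endo_module_def)
  have cl: "carrier (layer scale p u \<alpha>) = \<rho> ` T.img \<alpha>"
    by (auto simp: layer_def quotient_module_def pow a_rcosets_eq coset)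
  have lm: "layer_map scale p u \<alpha> (\<rho> x) = \<rho>' (act p x)" for x
    by (simp add: layer_map_def induced_map_def pow coset' UN')
  have z': "\<zero>\<^bsub>layer scale p u (osucc \<alpha>)\<^esub> = \<rho>' 0"
    by (simp add: layer_def quotient_module_def pow \<rho>'_def)
  have lk: "layer_kernel scale p u \<alpha> = \<rho> ` T.layer_set \<alpha>"
  proof -
    have "layer_map scale p u \<alpha> (\<rho> x) = \<zero>\<^bsub>layer scale p u (osucc \<alpha>)\<^esub> \<longleftrightarrow> act p x \<in> ?N'" for x
      by (simp add: lm z' eq')
    moreover have "{X \<in> \<rho> ` T.img \<alpha>. P X} = \<rho> ` {x \<in> T.img \<alpha>. P (\<rho> x)}" for P by blast
    ultimately show ?thesis unfolding layer_kernel_def cl T.layer_set_def by simp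
  qed
  let ?W = "over_residue_field (layer scale p u \<alpha>\<lparr>carrier := layer_kernel scale p u \<alpha>\<rparr>)"
  have "residue_quotient act p (T.layer_set \<alpha>) ?N ?W \<rho>"
  proof (intro residue_quotient.intro residue_quotient_axioms.intro T.torsion_base_axioms)
    show "T.subspace (T.layer_set \<alpha>)" unfolding T.subspace_def
    proof (intro conjI ballI allI)
      show "0 \<in> T.layer_set \<alpha>" using T.subspace_0[OF T.subspace_img] by (simp add: T.layer_set_def)
      fix x y assume "x \<in> T.layer_set \<alpha>" "y \<in> T.layer_set \<alpha>"
      then show "x + y \<in> T.layer_set \<alpha>"
        by (auto simp: T.layer_set_def T.scale_right_distrib intro: T.subspace_add[OF T.subspace_img])
    next
      fix r x assume x: "x \<in> T.layer_set \<alpha>"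
      then have "act r (act p x) \<in> ?N'"
        unfolding T.layer_set_def by (intro T.subspace_scale[OF T.subspace_img, where c = r]) blast
      moreover have "act r x \<in> T.img \<alpha>"
        using x unfolding T.layer_set_def by (intro T.subspace_scale[OF T.subspace_img]) blast
      ultimately show "act r x \<in> T.layer_set \<alpha>"
        by (simp add: T.layer_set_def mult.commute)
    qed
    show "T.subspace ?N" by (rule sN)
    show "carrier ?W = \<rho> ` T.layer_set \<alpha>" by (simp add: over_residue_field_def lk)
    show "\<zero>\<^bsub>?W\<^esub> = \<rho> 0"
      by (simp add: over_residue_field_def layer_def quotient_module_def pow \<rho>_def)
  next
    fix x y assume "x \<in> T.layer_set \<alpha>" "y \<in> T.layer_set \<alpha>"
    have "set_add (endo_module scale u\<lparr>carrier := T.img \<alpha>\<rparr>) (\<rho> x) (\<rho> y) = \<rho> (x + y)"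
    proof -
      have "set_add (endo_module scale u\<lparr>carrier := T.img \<alpha>\<rparr>) (\<rho> x) (\<rho> y) = {a + b | a b. a \<in> \<rho> x \<and> b \<in> \<rho> y}"
        by (auto simp: set_add_def set_mult_def endo_module_def)
      also have "\<dots> = \<rho> (x + y)"
      proof (intro equalityI subsetI)
        fix c assume "c \<in> {a + b | a b. a \<in> \<rho> x \<and> b \<in> \<rho> y}"
        then obtain a b where ab: "c = a + b" "a - x \<in> ?N" "b - y \<in> ?N" by (auto simp: ml)
        show "c \<in> \<rho> (x + y)" using T.subspace_add[OF sN ab(2,3)] by (simp add: ml ab(1) algebra_simps)
      next
        fix c assume c: "c \<in> \<rho> (x + y)"
        have "c - y \<in> \<rho> x" "y \<in> \<rho> y" using c T.subspace_0[OF sN] by (simp_all add: ml algebra_simps)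
        then show "c \<in> {a + b | a b. a \<in> \<rho> x \<and> b \<in> \<rho> y}"
          by (metis (mono_tags, lifting) diff_add_cancel mem_Collect_eq)
      qed
      finally show ?thesis .
    qed
    then show "\<rho> x \<oplus>\<^bsub>?W\<^esub> \<rho> y = \<rho> (x + y)"
      by (simp add: over_residue_field_def layer_def quotient_module_def pow)
  next
    fix x r assume x: "x \<in> T.layer_set \<alpha>"
    \<comment> \<open>The representative chosen by the scalar multiplication. It differs from
      \<open>r\<close> by a multiple of \<open>p\<close>, which sends \<open>x\<close> into the next
      image, so the coset is unaffected.\<close>
    define r' where "r' = (SOME r'. r' \<in> residue_class p r)"
    have "r \<in> residue_class p r" by (simp add: residue_class_eq)
    then have "r' \<in> residue_class p r" unfolding r'_def by (rule someI)
    then obtain k where k: "r' - r = p * k" by (auto simp: residue_class_eq dvd_def)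
    have "x \<in> T.img \<alpha>" using x by (simp add: T.layer_set_def)
    then have "act p (act k x) \<in> ?N"
      unfolding T.img_simps(2) by (intro imageI T.subspace_scale[OF T.subspace_img])
    then have "act r' x - act r x \<in> ?N"
      by (simp add: T.scale_left_diff_distrib[symmetric] k)
    then have "\<rho> (act r' x) = \<rho> (act r x)" by (simp add: eq)
    then show "residue_class p r \<odot>\<^bsub>?W\<^esub> \<rho> x = \<rho> (act r x)"
      using UN[where x = x and r = r']
      by (simp add: over_residue_field_def layer_def quotient_module_def pow r'_def[symmetric] coset sm)
  next
    fix x y show "\<rho> x = \<rho> y \<longleftrightarrow> x - y \<in> ?N" by (rule eq)
  qed
  then show ?thesis unfolding \<rho>_def .
qed

lemma kappa_infinity_quotient:
  assumes p: "irreducible p" and st: "torsion_base.stable act p lam"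
  shows "residue_quotient act p
    (torsion_base.final_socle act p lam) {0}
    (over_residue_field (endo_module scale u
        \<lparr>carrier := {x. act p x = 0} \<inter> power_submodule_infinity scale p u\<rparr>)) (\<lambda>x. x)"
proof -
  interpret T: torsion_base act p by (rule torsion_base_poly_apply[OF p])
  have pow: "power_submodule_infinity scale p u = T.img lam"
    unfolding power_submodule_infinity_def using T.iterated_image_final_eq[OF st] by simp
  show ?thesis
  proof (intro residue_quotient.intro residue_quotient_axioms.intro T.torsion_base_axioms)
    show "T.subspace (T.final_socle lam)" unfolding T.subspace_def
    proof (intro conjI ballI allI)
      show "0 \<in> T.final_socle lam" using T.subspace_0[OF T.subspace_img] by (simp add: T.final_socle_def)
      fix x y assume "x \<in> T.final_socle lam" "y \<in> T.final_socle lam"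
      then show "x + y \<in> T.final_socle lam"
        using T.subspace_add[OF T.subspace_img] by (simp add: T.final_socle_def T.scale_right_distrib)
    next
      fix r x assume x: "x \<in> T.final_socle lam"
      then have "act r (act p x) = 0" by (simp add: T.final_socle_def del: T.scale_scale)
      then show "act r x \<in> T.final_socle lam"
        using x T.subspace_scale[OF T.subspace_img] by (simp add: T.final_socle_def mult.commute)
    qed
  next
    fix x r assume x: "x \<in> T.final_socle lam"
    define r' where "r' = (SOME r'. r' \<in> residue_class p r)"
    have "r \<in> residue_class p r" by (simp add: residue_class_eq)
    then have "r' \<in> residue_class p r" unfolding r'_def by (rule someI)
    then obtain k where k: "r' - r = p * k" by (auto simp: residue_class_eq dvd_def)
    have "act k (act p x) = 0" using x by (simp add: T.final_socle_def del: T.scale_scale)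
    then have "act (r' - r) x = 0" by (simp add: k mult.commute)
    then have "act r' x = act r x" by (simp add: T.scale_left_diff_distrib)
    then show "residue_class p r \<odot>\<^bsub>over_residue_field (endo_module scale u
        \<lparr>carrier := {x. act p x = 0} \<inter> power_submodule_infinity scale p u\<rparr>)\<^esub> x = act r x"
      by (simp add: over_residue_field_def endo_module_def r'_def[symmetric])
  qed (simp_all add: over_residue_field_def endo_module_def pow T.final_socle_def)
qed

end

section \<open>Reciprocal polynomials and inverse endomorphisms\<close>

text \<open>The bound just above the larger rank tells finite from infinite, the exact values give
  the finite cardinals, and infinite countable sets are equipotent.\<close>

lemma card_eq_if_countable:
  assumes "countable B1" "countable B2" and d: "d > 0"
  shows "|B1| =o |B2| \<longleftrightarrow>
    (\<forall>n. (infinite B1 \<or> n \<le> card B1 * d) = (infinite B2 \<or> n \<le> card B2 * d))"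
proof
  assume eq: "|B1| =o |B2|"
  then have "finite B1 \<longleftrightarrow> finite B2" by (rule card_of_ordIso_finite)
  moreover have "card B1 = card B2"
    using eq unfolding card_of_ordIso[symmetric] by (auto simp: bij_betw_same_card)
  ultimately show "\<forall>n. (infinite B1 \<or> n \<le> card B1 * d) = (infinite B2 \<or> n \<le> card B2 * d)" by simp
next
  assume *: "\<forall>n. (infinite B1 \<or> n \<le> card B1 * d) = (infinite B2 \<or> n \<le> card B2 * d)"
  have fin: "finite B1 \<longleftrightarrow> finite B2"
    using *[rule_format, of "Suc (card B1 * d)"] *[rule_format, of "Suc (card B2 * d)"] by auto
  show "|B1| =o |B2|"
  proof (cases "finite B1")
    case True
    then have "card B1 * d = card B2 * d"
      using *[rule_format, of "card B1 * d"] *[rule_format, of "card B2 * d"] fin by auto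
    then have "card B1 = card B2" using d by simp
    then obtain f where "bij_betw f B1 B2" using True fin finite_same_card_bij by blast
    then show ?thesis using card_of_ordIso by blast
  next
    case False
    then have "\<exists>f. bij_betw f B1 (UNIV :: nat set)" "\<exists>f. bij_betw f B2 (UNIV :: nat set)"
      using fin assms(1,2) by (blast intro: to_nat_on_infinite)+
    then have "|B1| =o |UNIV :: nat set|" "|B2| =o |UNIV :: nat set|"
      using card_of_ordIso by blast+
    then show ?thesis using ordIso_symmetric ordIso_transitive by blast
  qed
qed

lemma (in residue_quotient) dimension_rank:
  assumes C: "countable C" "Modules.module.span (\<lambda>c. act [:c:]) C = UNIV"
  shows "\<exists>B. dimension (residue_field p) W = |B| \<and> countable B \<and>
    (\<forall>n. rank_ge act A Q n \<longleftrightarrow> infinite B \<or> n \<le> card B * degree p)"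
proof -
  define B where "B = (SOME B. KW.basis B)"
  have B: "KW.basis B" unfolding B_def using ex_basis by (rule someI_ex)
  then have "\<forall>b. \<exists>x. b \<in> B \<longrightarrow> x \<in> A \<and> \<rho> x = b" unfolding KW.basis_def carrier_W by blast
  then obtain x where x: "\<And>b. b \<in> B \<Longrightarrow> x b \<in> A \<and> \<rho> (x b) = b" by metis
  show ?thesis
    using rank_basis[OF B x] countable_basis[OF B x C] by (intro exI[of _ B]) (simp add: dimension_def B_def)
qed

lemma prime_dvd_mult_poly:
  fixes p :: "'a::field poly"
  assumes p: "irreducible p" and d: "p dvd f * g" "\<not> p dvd f"
  shows "p dvd g"
proof -
  obtain a b where ab: "a * p + b * f = 1" using irreducible_poly_bezout[OF p d(2)] by blast
  have "g = (a * p + b * f) * g" by (simp add: ab)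
  also have "\<dots> = p * (a * g) + b * (f * g)" by (simp add: algebra_simps)
  finally show ?thesis using d(1) by (metis dvd_add dvd_mult dvd_triv_left)
qed

lemma Irr_coeff_0:
  assumes p: "p \<in> Irr - {[:0, 1:]}"
  shows "coeff p 0 \<noteq> 0"
proof
  assume "coeff p 0 = 0"
  then have "[:0, 1:] dvd p" using poly_eq_0_iff_dvd[of p 0] by (simp add: poly_0_coeff_0)
  then obtain k where k: "p = [:0, 1:] * k" by (auto elim: dvdE)
  have "\<not> is_unit ([:0, 1:] :: 'a poly)" by (simp add: is_unit_iff_degree)
  then have "is_unit k" using p k unfolding Irr_def irreducible_def by blast
  then have "degree k = 0" using is_unit_iff_degree[of k] by (cases "k = 0") auto
  then obtain c where c: "k = [:c:]" by (rule degree_eq_zeroE)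
  then have "p = [:0, c:]" using k by simp
  moreover have "lead_coeff p = 1" "p \<noteq> 0" using p by (auto simp: Irr_def irreducible_def)
  ultimately show False using p by (auto split: if_splits)
qed

text \<open>Reversing coefficients is multiplicative, and on polynomials with nonzero constant term
  it is an involution preserving the degree. Factorisations therefore transfer in both
  directions.\<close>

lemma reciprocal_props:
  assumes p: "p \<in> Irr - {[:0, 1:]}"
  shows "reciprocal p \<in> Irr - {[:0, 1:]}" and "degree (reciprocal p) = degree p"
    and "reciprocal (reciprocal p) = p"
proof -
  have c: "coeff p 0 \<noteq> 0" by (rule Irr_coeff_0[OF p])
  have irr: "irreducible p" and lc: "lead_coeff p = 1" using p by (auto simp: Irr_def)
  have p0: "p \<noteq> 0" using irr by (auto simp: irreducible_def)
  have r0: "coeff (reflect_poly p) 0 = 1" using lc by (simp add: coeff_0_reflect_poly)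
  show deg: "degree (reciprocal p) = degree p" using c by (simp add: reciprocal_def poly_0_coeff_0)
  show rr: "reciprocal (reciprocal p) = p"
    using c r0 by (simp add: reciprocal_def poly_0_coeff_0 reflect_poly_smult)
  have "irreducible (reflect_poly p)"
  proof (rule irreducibleI)
    show "reflect_poly p \<noteq> 0" using p0 by simp
    have "degree p > 0" by (rule irreducible_poly_degree_pos[OF irr])
    then show "\<not> is_unit (reflect_poly p)" using c p0 by (simp add: is_unit_iff_degree)
    fix a b assume ab: "reflect_poly p = a * b"
    then have n0: "coeff a 0 \<noteq> 0" "coeff b 0 \<noteq> 0" using r0 by (auto simp: coeff_mult_0)
    have "p = reflect_poly a * reflect_poly b"
      using arg_cong[OF ab, of reflect_poly] c by (simp add: reflect_poly_mult)
    then have "is_unit (reflect_poly a) \<or> is_unit (reflect_poly b)" using irr unfolding irreducible_def by blast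
    moreover have "a \<noteq> 0" "b \<noteq> 0" using n0 by auto
    ultimately show "is_unit a \<or> is_unit b"
      using n0 by (simp add: is_unit_iff_degree)
  qed
  moreover have "is_unit [:inverse (coeff p 0):]" using c by (simp add: is_unit_iff_degree)
  ultimately have "irreducible ([:inverse (coeff p 0):] * reflect_poly p)"
    by (simp only: irreducible_mult_unit_left)
  then have "irreducible (reciprocal p)" by (simp add: reciprocal_def poly_0_coeff_0)
  moreover have "lead_coeff (reciprocal p) = 1"
    using c by (simp add: reciprocal_def poly_0_coeff_0 lead_coeff_smult coeff_reflect_poly)
  moreover have "reciprocal p \<noteq> [:0, 1:]"
    using c r0 by (auto simp: reciprocal_def poly_0_coeff_0 dest: arg_cong[where f = "\<lambda>q. coeff q 0"])
  ultimately show "reciprocal p \<in> Irr - {[:0, 1:]}" by (simp add: Irr_def)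
qed

text \<open>A bijective factor that commutes with \<open>g\<close> preserves every image of
  \<open>g\<close>, so it cannot be seen in the images of \<open>f\<close>. At limits its
  injectivity lets it pass through the intersection.\<close>

lemma iterated_image_bij:
  assumes w: "bij w" and comm: "\<And>x. w (g x) = g (w x)" and f: "\<And>x. f x = w (g x)"
  shows "iterated_image f a = iterated_image g a \<and> w ` iterated_image g a = iterated_image g a"
proof (induction a rule: omega1_induct)
  case zero
  then show ?case using w by (simp add: iterated_image_ozero bij_is_surj)
next
  case (succ a)
  have wg: "w ` g ` S = g ` w ` S" for S using comm by (simp add: image_image)
  have "f ` S = w ` g ` S" for S using f by (simp add: image_image)
  then show ?case using succ wg by (simp add: iterated_image_osucc)
next
  case (limit a)
  have "a \<noteq> ozero" using limit(1) by (simp add: is_limit_def)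
  then have ne: "ozero \<in> {..<a}" using ozero_le[of a] by simp
  have "w ` (\<Inter>b\<in>{..<a}. iterated_image g b) = (\<Inter>b\<in>{..<a}. w ` iterated_image g b)"
    using bij_is_inj[OF w] ne by (intro image_INT[of w UNIV _ _ ozero]) auto
  then show ?case using limit(2) by (simp add: iterated_image_limit[OF limit(1)])
qed

locale automorphism = endomorphism scale u + V: endomorphism scale v
  for scale :: "'a::field \<Rightarrow> 'v::ab_group_add \<Rightarrow> 'v" and u v :: "'v \<Rightarrow> 'v" +
  assumes uv [simp]: "u (v x) = x" and vu [simp]: "v (u x) = x"
begin

abbreviation "act_u \<equiv> \<lambda>r. poly_apply scale r u"
abbreviation "act_v \<equiv> \<lambda>r. poly_apply scale r v"

sublocale MU: Modules.module act_u
  by (rule poly_apply_module[OF vector_space_axioms U.linear_axioms])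

sublocale MV: Modules.module act_v
  by (rule poly_apply_module[OF vector_space_axioms V.U.linear_axioms])

lemma funpow_uv [simp]: "(u ^^ n) ((v ^^ n) x) = x" "(v ^^ n) ((u ^^ n) x) = x"
proof -
  show "(u ^^ n) ((v ^^ n) x) = x"
    by (induction n arbitrary: x) (simp_all add: funpow_swap1)
  show "(v ^^ n) ((u ^^ n) x) = x"
    by (induction n arbitrary: x) (simp_all add: funpow_swap1)
qed

lemma funpow_linear: "(u ^^ n) (x + y) = (u ^^ n) x + (u ^^ n) y" "(u ^^ n) (scale c x) = scale c ((u ^^ n) x)"
  "(u ^^ n) 0 = 0" "(u ^^ n) (sum f I) = (\<Sum>i\<in>I. (u ^^ n) (f i))"
proof -
  show add: "(u ^^ n) (x + y) = (u ^^ n) x + (u ^^ n) y" for x y by (induction n) (simp_all add: U.add)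
  show "(u ^^ n) (scale c x) = scale c ((u ^^ n) x)" by (induction n) (simp_all add: U.scale)
  show z: "(u ^^ n) 0 = 0" by (induction n) (simp_all add: U.zero)
  show "(u ^^ n) (sum f I) = (\<Sum>i\<in>I. (u ^^ n) (f i))"
    by (induction I rule: infinite_finite_induct) (simp_all add: z add)
qed

text \<open>Evaluation of \<open>t^d r(1/t)\<close> at \<open>u\<close>, with \<open>v\<close> in
  the place of \<open>1/u\<close>.\<close>

lemma poly_apply_reflect:
  "act_u (reflect_poly r) x = (u ^^ degree r) (act_v r x)"
proof -
  have "act_u (reflect_poly r) x = (\<Sum>k\<le>degree r. scale (coeff (reflect_poly r) k) ((u ^^ k) x))"
    unfolding poly_apply_def
    by (rule sum.mono_neutral_left) (auto simp: coeff_eq_0 intro: order.trans[OF _ degree_reflect_poly_le])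
  also have "\<dots> = (\<Sum>k\<le>degree r. scale (coeff r (degree r - k)) ((u ^^ k) x))"
    by (intro sum.cong refl) (simp add: coeff_reflect_poly)
  also have "\<dots> = (\<Sum>k\<le>degree r. scale (coeff r k) ((u ^^ (degree r - k)) x))"
    by (rule sum.reindex_bij_witness[where i = "\<lambda>k. degree r - k" and j = "\<lambda>k. degree r - k"]) auto
  also have "\<dots> = (\<Sum>k\<le>degree r. scale (coeff r k) ((u ^^ degree r) ((v ^^ k) x)))"
  proof (intro sum.cong refl)
    fix k assume "k \<in> {..degree r}"
    then have "(u ^^ degree r) ((v ^^ k) x) = (u ^^ (degree r - k)) ((u ^^ k) ((v ^^ k) x))"
      by (simp flip: funpow_add comp_apply[of "u ^^ (degree r - k)"] add: funpow_add[symmetric] del: funpow_uv)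
    then show "scale (coeff r k) ((u ^^ (degree r - k)) x) = scale (coeff r k) ((u ^^ degree r) ((v ^^ k) x))"
      by simp
  qed
  also have "\<dots> = (u ^^ degree r) (act_v r x)"
    by (simp add: poly_apply_def funpow_linear)
  finally show ?thesis .
qed

lemma u_poly_v: "u (act_v r x) = act_v r (u x)"
proof -
  have "v (act_v r (u x)) = act_v r (v (u x))"
    by (metis MV.scale_left_commute V.U.linear_axioms poly_apply_X vector_space_axioms)
  then show ?thesis by (metis uv vu)
qed

lemma funpow_poly_v: "(u ^^ n) (act_v r x) = act_v r ((u ^^ n) x)"
  by (induction n) (simp_all add: u_poly_v)

text \<open>The bijection by which the reciprocal of \<open>p\<close> at \<open>u\<close> differs
  from \<open>p\<close> at \<open>v\<close>.\<close>

definition reciprocal_twist :: "'a poly \<Rightarrow> 'v \<Rightarrow> 'v"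
  where "reciprocal_twist p x = scale (inverse (coeff p 0)) ((u ^^ degree p) x)"

lemma poly_apply_reciprocal:
  "act_u (reciprocal p) x = reciprocal_twist p (act_v p x)"
proof -
  have "act_u (reciprocal p) x
      = poly_apply scale ([:inverse (coeff p 0):] * reflect_poly p) u x"
    by (simp add: reciprocal_def poly_0_coeff_0)
  also have "\<dots> = scale (inverse (coeff p 0)) (act_u (reflect_poly p) x)"
    unfolding MU.scale_scale[symmetric] poly_apply_const[OF vector_space_axioms U.linear_axioms] ..
  finally show ?thesis by (simp add: reciprocal_twist_def poly_apply_reflect)
qed

lemma twist_commute: "reciprocal_twist q (act_v r x) = act_v r (reciprocal_twist q x)"
proof -
  have "act_v r (scale c y) = scale c (act_v r y)" for c y
    by (metis MV.scale_left_commute V.U.linear_axioms poly_apply_const vector_space_axioms)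
  then show ?thesis by (simp add: reciprocal_twist_def funpow_poly_v)
qed

lemma bij_twist:
  assumes "coeff p 0 \<noteq> 0"
  shows "bij (reciprocal_twist p)"
proof (rule bijI')
  fix x y
  show "(reciprocal_twist p x = reciprocal_twist p y) = (x = y)"
    using assms by (auto simp: reciprocal_twist_def dest: arg_cong[where f = "v ^^ degree p"])
next
  fix y
  show "\<exists>x. y = reciprocal_twist p x"
    using assms by (intro exI[of _ "scale (coeff p 0) ((v ^^ degree p) y)"])
      (simp add: reciprocal_twist_def funpow_linear)
qed

lemma const_span: "Modules.module.span (\<lambda>c. act_u [:c:]) C = span C"
proof -
  have "(\<lambda>c. act_u [:c:]) = scale"
    by (intro ext) (rule poly_apply_const[OF vector_space_axioms U.linear_axioms])
  then show ?thesis by simp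
qed

context
  fixes p :: "'a poly" assumes p: "p \<in> Irr - {[:0, 1:]}"
begin

lemma irreducible_Irr: "irreducible p" "irreducible (reciprocal p)"
  using p reciprocal_props(1)[OF p] by (auto simp: Irr_def)

interpretation TU: torsion_base act_u p
  by (rule torsion_base_poly_apply[OF irreducible_Irr(1)])
interpretation TV: torsion_base act_v p
  by (rule V.torsion_base_poly_apply[OF irreducible_Irr(1)])
interpretation TR: torsion_base act_u "reciprocal p"
  by (rule torsion_base_poly_apply[OF irreducible_Irr(2)])

lemma img_reciprocal: "TR.img a = TV.img a" and twist_img: "reciprocal_twist p ` TV.img a = TV.img a"
  using iterated_image_bij[of "reciprocal_twist p" "act_v p" "act_u (reciprocal p)",
      OF bij_twist[OF Irr_coeff_0[OF p]] twist_commute poly_apply_reciprocal]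
  by (simp_all add: TR.img_def TV.img_def)

lemma twist_mem_img: "reciprocal_twist p x \<in> TV.img a \<longleftrightarrow> x \<in> TV.img a"
proof -
  have "reciprocal_twist p x \<in> reciprocal_twist p ` TV.img a \<longleftrightarrow> x \<in> TV.img a"
    by (rule inj_image_mem_iff[OF bij_is_inj[OF bij_twist[OF Irr_coeff_0[OF p]]]])
  then show ?thesis by (simp add: twist_img)
qed

lemma twist_eq_0: "reciprocal_twist p x = 0 \<longleftrightarrow> x = 0"
proof -
  have "reciprocal_twist p 0 = 0" by (simp add: reciprocal_twist_def funpow_linear)
  then show ?thesis using inj_eq[OF bij_is_inj[OF bij_twist[OF Irr_coeff_0[OF p]]], of x 0] by simp
qed

lemma layer_set_reciprocal: "TR.layer_set a = TV.layer_set a"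
  and final_socle_reciprocal: "TR.final_socle a = TV.final_socle a"
  and stable_reciprocal: "TR.stable a = TV.stable a"
  by (simp_all add: TR.layer_set_def TV.layer_set_def TR.final_socle_def TV.final_socle_def
      TR.stable_def TV.stable_def img_reciprocal poly_apply_reciprocal twist_mem_img twist_eq_0)

lemma rank_ge_uv: "rank_ge act_u A Q n \<longleftrightarrow> rank_ge act_v A Q n"
  unfolding rank_ge_def independent_mod_def
  by (simp only: poly_apply_const[OF vector_space_axioms U.linear_axioms] poly_apply_const[OF vector_space_axioms V.U.linear_axioms])

text \<open>Over the ground field, the layer of \<open>u\<close> at the reciprocal is literally the
  layer of \<open>v\<close> at \<open>p\<close>. The degrees coincide, so equal dimensions amount to
  equal ranks.\<close>

lemma kappa_eq_iff:
  assumes C: "countable C" "span C = UNIV"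
  shows "kappa scale \<alpha> u p =o kappa scale \<alpha> u (reciprocal p) \<longleftrightarrow>
    (\<forall>n. rank_ge act_u (TU.layer_set \<alpha>) (TU.img (osucc \<alpha>)) n \<longleftrightarrow>
      rank_ge act_v (TV.layer_set \<alpha>) (TV.img (osucc \<alpha>)) n)"
proof -
  have C': "Modules.module.span (\<lambda>c. act_u [:c:]) C = UNIV" using C(2) by (simp add: const_span)
  obtain B1 where B1: "kappa scale \<alpha> u p = |B1|" "countable B1"
    "\<And>n. rank_ge act_u (TU.layer_set \<alpha>) (TU.img (osucc \<alpha>)) n \<longleftrightarrow> infinite B1 \<or> n \<le> card B1 * degree p"
    using residue_quotient.dimension_rank[OF kappa_quotient[OF irreducible_Irr(1), of \<alpha>] C(1) C']
    unfolding kappa_def by blast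
  obtain B2 where B2: "kappa scale \<alpha> u (reciprocal p) = |B2|" "countable B2"
    "\<And>n. rank_ge act_u (TR.layer_set \<alpha>) (TR.img (osucc \<alpha>)) n \<longleftrightarrow> infinite B2 \<or> n \<le> card B2 * degree (reciprocal p)"
    using residue_quotient.dimension_rank[OF kappa_quotient[OF irreducible_Irr(2), of \<alpha>] C(1) C']
    unfolding kappa_def by blast
  show ?thesis
    unfolding B1(1) B2(1) card_eq_if_countable[OF B1(2) B2(2) TU.degree_p] B1(3)
    using B2(3) by (simp add: reciprocal_props(2)[OF p] rank_ge_uv layer_set_reciprocal img_reciprocal)
qed

lemma kappa_infinity_eq_iff:
  assumes C: "countable C" "span C = UNIV" and lam: "TU.stable lam" "TV.stable lam"
  shows "kappa_infinity scale u p =o kappa_infinity scale u (reciprocal p) \<longleftrightarrow>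
    (\<forall>n. rank_ge act_u (TU.final_socle lam) {0} n \<longleftrightarrow>
      rank_ge act_v (TV.final_socle lam) {0} n)"
proof -
  have C': "Modules.module.span (\<lambda>c. act_u [:c:]) C = UNIV" using C(2) by (simp add: const_span)
  obtain B1 where B1: "kappa_infinity scale u p = |B1|" "countable B1"
    "\<And>n. rank_ge act_u (TU.final_socle lam) {0} n \<longleftrightarrow> infinite B1 \<or> n \<le> card B1 * degree p"
    using residue_quotient.dimension_rank[OF kappa_infinity_quotient[OF irreducible_Irr(1) lam(1)] C(1) C']
    unfolding kappa_infinity_def by blast
  have st: "TR.stable lam" using lam(2) stable_reciprocal by simp
  obtain B2 where B2: "kappa_infinity scale u (reciprocal p) = |B2|" "countable B2"
    "\<And>n. rank_ge act_u (TR.final_socle lam) {0} n \<longleftrightarrow> infinite B2 \<or> n \<le> card B2 * degree (reciprocal p)"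
    using residue_quotient.dimension_rank[OF kappa_infinity_quotient[OF irreducible_Irr(2) st] C(1) C']
    unfolding kappa_infinity_def by blast
  show ?thesis
    unfolding B1(1) B2(1) card_eq_if_countable[OF B1(2) B2(2) TU.degree_p] B1(3)
    using B2(3) by (simp add: reciprocal_props(2)[OF p] rank_ge_uv final_socle_reciprocal)
qed

end

end

lemma rank_ge_image:
  assumes \<phi>: "bij \<phi>" "\<And>x y. \<phi> (x + y) = \<phi> x + \<phi> y" "\<And>c x. \<phi> (act [:c:] x) = act' [:c:] (\<phi> x)"
  shows "rank_ge act' (\<phi> ` A) (\<phi> ` Q) n \<longleftrightarrow> rank_ge act A Q n"
proof -
  have zero: "\<phi> 0 = 0" using \<phi>(2)[of 0 0] by simp
  have sum: "\<phi> (sum f I) = (\<Sum>i\<in>I. \<phi> (f i))" for f :: "nat \<Rightarrow> _" and I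
    by (induction I rule: infinite_finite_induct) (simp_all add: zero \<phi>(2))
  have inj: "\<phi> x \<in> \<phi> ` S \<longleftrightarrow> x \<in> S" for x S using bij_is_inj[OF \<phi>(1)] by (rule inj_image_mem_iff)
  have eq: "(\<forall>i<n. \<phi> (f i) \<in> \<phi> ` A) \<and> independent_mod act' (\<phi> ` Q) n (\<lambda>i. \<phi> (f i)) \<longleftrightarrow>
      (\<forall>i<n. f i \<in> A) \<and> independent_mod act Q n f" for f
    by (simp only: independent_mod_def \<phi>(3)[symmetric] sum[symmetric] inj)
  show ?thesis
  proof
    assume "rank_ge act' (\<phi> ` A) (\<phi> ` Q) n"
    then obtain g where g: "(\<forall>i<n. g i \<in> \<phi> ` A) \<and> independent_mod act' (\<phi> ` Q) n g"
      unfolding rank_ge_def by blast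
    define f where "f i = inv_into UNIV \<phi> (g i)" for i
    have "\<phi> (f i) = g i" for i unfolding f_def by (rule surj_f_inv_f[OF bij_is_surj[OF \<phi>(1)]])
    then show "rank_ge act A Q n" unfolding rank_ge_def using g eq[of f] by (intro exI[of _ f]) simp
  next
    assume "rank_ge act A Q n"
    then obtain f where "(\<forall>i<n. f i \<in> A) \<and> independent_mod act Q n f" unfolding rank_ge_def ..
    then show "rank_ge act' (\<phi> ` A) (\<phi> ` Q) n"
      unfolding rank_ge_def using eq[of f] by (intro exI[of _ "\<lambda>i. \<phi> (f i)"]) blast
  qed
qed

section \<open>Primary decomposition\<close>

lemma ex_irreducible_factor:
  fixes f :: "'a::field poly"
  assumes "degree f > 0"
  shows "\<exists>p. p \<in> Irr \<and> p dvd f"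
proof -
  let ?P = "\<lambda>d. \<exists>g. g dvd f \<and> degree g = d \<and> d > 0"
  define d where "d = (LEAST d. ?P d)"
  have "?P (degree f)" using assms by (intro exI[of _ f]) simp
  then have "?P d" unfolding d_def by (rule LeastI)
  then obtain g where g: "g dvd f" "degree g = d" "d > 0" by blast
  have min: "\<not> ?P e" if "e < d" for e using not_less_Least that unfolding d_def by blast
  have g0: "g \<noteq> 0" using g by auto
  have "irreducible g"
  proof (rule irreducibleI)
    show "g \<noteq> 0" by (rule g0)
    show "\<not> is_unit g" using g g0 by (simp add: is_unit_iff_degree)
    fix a b assume ab: "g = a * b"
    then have n: "a \<noteq> 0" "b \<noteq> 0" using g0 by auto
    have "degree a = 0 \<or> degree a = d"
    proof (rule ccontr)
      assume "\<not> ?thesis"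
      moreover have "degree a \<le> d" using ab n g(2) by (simp add: degree_mult_eq)
      ultimately have "degree a < d" "degree a > 0" by auto
      moreover have "a dvd f" using ab g(1) by (auto intro: dvd_mult_left)
      ultimately show False using min by blast
    qed
    then show "is_unit a \<or> is_unit b" using ab n g(2) by (auto simp: is_unit_iff_degree degree_mult_eq)
  qed
  define p where "p = [:inverse (lead_coeff g):] * g"
  have u: "is_unit [:inverse (lead_coeff g):]" using g0 by (simp add: is_unit_iff_degree)
  have "irreducible p" unfolding p_def using \<open>irreducible g\<close> irreducible_mult_unit_left[OF u] by simp
  moreover have "lead_coeff p = 1" using g0 by (simp add: p_def lead_coeff_smult)
  moreover have "p dvd f" unfolding p_def using g(1) u by (simp only: mult_unit_dvd_iff')
  ultimately show ?thesis unfolding Irr_def by blast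
qed

lemma Irr_dvd_eq:
  assumes "p \<in> Irr" "q \<in> Irr" "q dvd p"
  shows "q = p"
proof -
  obtain k where k: "p = q * k" using assms(3) by (auto elim: dvdE)
  have "\<not> is_unit q" using assms(2) by (auto simp: Irr_def irreducible_def)
  then have "is_unit k" using assms(1) k by (auto simp: Irr_def irreducible_def)
  then have "degree k = 0" using is_unit_iff_degree[of k] by (cases "k = 0") auto
  then obtain c where c: "k = [:c:]" by (rule degree_eq_zeroE)
  then have "lead_coeff p = c * lead_coeff q" using k by simp
  then have "c = 1" using assms(1,2) by (simp add: Irr_def)
  then show ?thesis using k c by simp
qed

lemma Irr_factor_out:
  fixes f :: "'a::field poly"
  assumes p: "p \<in> Irr" and f: "f \<noteq> 0"
  shows "\<exists>k g. f = p ^ k * g \<and> \<not> p dvd g"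
  using f
proof (induction "degree f" arbitrary: f rule: less_induct)
  case less
  show ?case
  proof (cases "p dvd f")
    case False
    then show ?thesis by (intro exI[of _ 0] exI[of _ f]) simp
  next
    case True
    then obtain g where g: "f = p * g" by (auto elim: dvdE)
    then have "g \<noteq> 0" "p \<noteq> 0" using less.prems by auto
    moreover have "degree p > 0" using p irreducible_poly_degree_pos by (auto simp: Irr_def)
    ultimately have "degree g < degree f" by (simp add: g degree_mult_eq)
    then obtain k h where "g = p ^ k * h" "\<not> p dvd h" using less.hyps[of g] \<open>g \<noteq> 0\<close> by blast
    then show ?thesis by (intro exI[of _ "Suc k"] exI[of _ h]) (simp add: g)
  qed
qed

context poly_module
begin

text \<open>A product of powers of the members of \<open>P\<close> annihilates the sum, and the
  irreducible \<open>q\<close> divides none of its factors.\<close>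

lemma primary_sum_annihilator:
  assumes "finite P" "P \<subseteq> Irr" "q \<in> Irr" "q \<notin> P" "\<And>p. p \<in> P \<Longrightarrow> x p \<in> torsion act p"
  shows "\<exists>h. act h (\<Sum>p\<in>P. x p) = 0 \<and> \<not> q dvd h"
  using assms
proof (induction P rule: finite_induct)
  case empty
  then have "\<not> q dvd 1" by (auto simp: Irr_def irreducible_def)
  then show ?case by (intro exI[of _ 1]) simp
next
  case (insert p P)
  then obtain h where h: "act h (\<Sum>p\<in>P. x p) = 0" "\<not> q dvd h" by auto
  obtain k where k: "act (p ^ k) (x p) = 0" using insert.prems(4)[of p] by (auto simp: torsion_def)
  have q: "irreducible q" using insert.prems(2) by (simp add: Irr_def)
  have "\<not> q dvd p" using Irr_dvd_eq[of p q] insert.prems by auto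
  have "\<not> q dvd p ^ j" for j
  proof (induction j)
    case 0
    show ?case using q by (simp add: irreducible_def)
  next
    case (Suc j)
    then show ?case using prime_dvd_mult_poly[OF q, of p "p ^ j"] \<open>\<not> q dvd p\<close> by auto
  qed
  then have "\<not> q dvd h * p ^ k" using prime_dvd_mult_poly[OF q, of h "p ^ k"] h(2) by blast
  moreover have "act h (act (p ^ k) (x p)) + act (p ^ k) (act h (\<Sum>p\<in>P. x p)) = 0"
    by (simp add: h k del: scale_scale)
  then have "act (h * p ^ k) (x p + (\<Sum>p\<in>P. x p)) = 0" by (simp add: scale_right_distrib mult.commute)
  ultimately show ?case using insert.hyps by (intro exI[of _ "h * p ^ k"]) simp
qed

lemma primary_sum_independent:
  assumes P: "finite P" "P \<subseteq> Irr" and x: "\<And>p. p \<in> P \<Longrightarrow> x p \<in> torsion act p"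
    and sum: "(\<Sum>p\<in>P. x p) = 0" and q: "q \<in> P"
  shows "x q = 0"
proof -
  have "\<exists>h. act h (\<Sum>p\<in>P - {q}. x p) = 0 \<and> \<not> q dvd h"
    by (rule primary_sum_annihilator) (use assms in auto)
  then obtain h where h: "act h (\<Sum>p\<in>P - {q}. x p) = 0" "\<not> q dvd h" by blast
  have "x q = - (\<Sum>p\<in>P - {q}. x p)"
    using sum sum.remove[OF P(1) q, of x] by (simp add: eq_neg_iff_add_eq_0)
  then have hq: "act h (x q) = 0" using h(1) by simp
  obtain k where k: "act (q ^ k) (x q) = 0" using x[OF q] by (auto simp: torsion_def)
  have "irreducible q" using q P(2) by (auto simp: Irr_def)
  then obtain a b where ab: "a * q ^ k + b * h = 1" using irreducible_poly_bezout_power[OF _ h(2)] by blast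
  have "x q = act (a * q ^ k + b * h) (x q)" by (simp add: ab)
  also have "\<dots> = act a (act (q ^ k) (x q)) + act b (act h (x q))" by (simp add: scale_left_distrib)
  finally show ?thesis by (simp add: k hq del: scale_scale)
qed

text \<open>Stated for arbitrary families \<open>T\<close> because it serves both the torsion
  submodules and the graphs between them.\<close>

lemma primary_sum_add:
  assumes P: "finite P" "finite P'"
    and f: "\<And>p. f p \<in> T p" "\<And>p. f' p \<in> T p"
    and T: "\<And>p. 0 \<in> T p" "\<And>p x y. x \<in> T p \<Longrightarrow> y \<in> T p \<Longrightarrow> x + y \<in> T p"
  shows "\<exists>g. (\<forall>p. g p \<in> T p) \<and> (\<Sum>p\<in>P. f p) + (\<Sum>p\<in>P'. f' p) = (\<Sum>p\<in>P \<union> P'. g p :: 'c::ab_group_add)"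
proof (intro exI conjI allI)
  let ?g = "\<lambda>p. (if p \<in> P then f p else 0) + (if p \<in> P' then f' p else 0)"
  show "?g p \<in> T p" for p using f T by auto
  have "(\<Sum>p\<in>P. f p) = (\<Sum>p\<in>P \<union> P'. if p \<in> P then f p else 0)"
    using P by (intro sum.mono_neutral_cong_left) auto
  moreover have "(\<Sum>p\<in>P'. f' p) = (\<Sum>p\<in>P \<union> P'. if p \<in> P' then f' p else 0)"
    using P by (intro sum.mono_neutral_cong_left) auto
  ultimately show "(\<Sum>p\<in>P. f p) + (\<Sum>p\<in>P'. f' p) = (\<Sum>p\<in>P \<union> P'. ?g p)"
    by (simp add: sum.distrib)
qed

text \<open>Write \<open>f = p^k g\<close> with \<open>g\<close> prime to \<open>p\<close> and
  \<open>1 = a p^k + b g\<close>. Then \<open>b g x\<close> is \<open>p\<close>-torsion, while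
  \<open>a p^k x\<close> is annihilated by \<open>g\<close>, of smaller degree. The nonzero constant
  term passes to \<open>g\<close> and excludes t from the primes.\<close>

lemma primary_decomposition:
  assumes "f \<noteq> 0" "coeff f 0 \<noteq> 0" "act f x = 0"
  shows "\<exists>P y. finite P \<and> P \<subseteq> Irr - {[:0, 1:]} \<and> (\<forall>p. y p \<in> torsion act p) \<and> x = (\<Sum>p\<in>P. y p)"
  using assms
proof (induction "degree f" arbitrary: f x rule: less_induct)
  case less
  show ?case
  proof (cases "degree f = 0")
    case True
    then obtain c where c: "f = [:c:]" by (rule degree_eq_zeroE)
    then have "x = act ([:inverse c:] * f) x" using less.prems by (simp add: one_pCons[symmetric])
    also have "\<dots> = act [:inverse c:] (act f x)" by simp
    also have "\<dots> = 0" by (simp add: less.prems(3) del: scale_scale)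
    finally show ?thesis by (intro exI[of _ "{}"] exI[of _ "\<lambda>_. 0"]) (simp add: torsion_def)
  next
    case False
    then obtain p where p: "p \<in> Irr" "p dvd f" using ex_irreducible_factor[of f] by blast
    have irr: "irreducible p" and deg: "degree p > 0" using p irreducible_poly_degree_pos by (auto simp: Irr_def)
    obtain k g where kg: "f = p ^ k * g" "\<not> p dvd g" using Irr_factor_out[OF p(1) less.prems(1)] by blast
    have g0: "g \<noteq> 0" "p \<noteq> 0" using less.prems(1) deg kg(1) by auto
    have "k > 0" using kg p(2) by (cases k) auto
    then have "degree g < degree f" using g0 deg by (simp add: kg(1) degree_mult_eq degree_power_eq)
    have cg: "coeff g 0 \<noteq> 0" using less.prems(2) kg(1) by (auto simp: coeff_mult_0)
    obtain h where h: "f = p * h" using p(2) by (auto elim: dvdE)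
    then have "p \<noteq> [:0, 1:]" using less.prems(2) by auto
    obtain a b where ab: "a * p ^ k + b * g = 1" using irreducible_poly_bezout_power[OF irr kg(2)] by blast
    have "act (p ^ k) (act (b * g) x) = act b (act f x)" by (simp add: kg(1) algebra_simps)
    then have t: "act (b * g) x \<in> torsion act p" unfolding torsion_def using less.prems(3) by auto
    have "act g (act (a * p ^ k) x) = act a (act f x)" by (simp add: kg(1) algebra_simps)
    then have "act g (act (a * p ^ k) x) = 0" using less.prems(3) by (simp del: scale_scale)
    from less.hyps[OF \<open>degree g < degree f\<close> g0(1) cg this]
    obtain P y where P: "finite P" "P \<subseteq> Irr - {[:0, 1:]}" "\<And>p. y p \<in> torsion act p"
      "act (a * p ^ k) x = (\<Sum>p\<in>P. y p)" by blast
    define y' where "y' q = (if q = p then act (b * g) x else 0)" for q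
    note T = subspace_0[OF subspace_torsion] subspace_add[OF subspace_torsion]
    have y': "y' q \<in> torsion act q" for q using t T(1) by (simp add: y'_def)
    obtain z where z: "\<forall>q. z q \<in> torsion act q"
      "(\<Sum>q\<in>P. y q) + (\<Sum>q\<in>{p}. y' q) = (\<Sum>q\<in>P \<union> {p}. z q)"
      using primary_sum_add[of P "{p}" y "torsion act" y', OF P(1) _ P(3) y' T] by auto
    have "x = act (a * p ^ k + b * g) x" by (simp add: ab)
    also have "\<dots> = (\<Sum>q\<in>P. y q) + (\<Sum>q\<in>{p}. y' q)" unfolding scale_left_distrib P(4) by (simp add: y'_def)
    finally have "x = (\<Sum>q\<in>P \<union> {p}. z q)" using z(2) by simp
    then show ?thesis
      using P(1,2) p(1) \<open>p \<noteq> [:0, 1:]\<close> z(1) by (intro exI[of _ "P \<union> {p}"] exI[of _ z]) auto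
  qed
qed

end

section \<open>Conjugating an automorphism to its inverse\<close>

context automorphism
begin

abbreviation "act_uv \<equiv> pair_act act_u act_v"

lemma swapped: "automorphism scale v u"
  by unfold_locales simp_all

sublocale PU: poly_module act_u by unfold_locales

sublocale PM: poly_module act_uv
proof
  fix x y r s
  show "act_uv r (x + y) = act_uv r x + act_uv r y"
    by (simp add: prod_eq_iff MU.scale_right_distrib MV.scale_right_distrib)
  show "act_uv (r + s) x = act_uv r x + act_uv s x"
    by (simp add: prod_eq_iff MU.scale_left_distrib MV.scale_left_distrib)
  show "act_uv r (act_uv s x) = act_uv (r * s) x" by (simp add: prod_eq_iff)
  show "act_uv 1 x = x" by (simp add: prod_eq_iff)
qed

lemma poly_v_commute: "v (act_u r x) = act_u r (v x)"
  using automorphism.u_poly_v[OF swapped] .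

lemmas act_u_pCons = poly_apply_pCons[OF vector_space_axioms U.linear_axioms]
  and act_v_pCons = poly_apply_pCons[OF vector_space_axioms V.U.linear_axioms]
  and act_u_const = poly_apply_const[OF vector_space_axioms U.linear_axioms]
  and act_v_const = poly_apply_const[OF vector_space_axioms V.U.linear_axioms]
  and act_u_X = poly_apply_X[OF vector_space_axioms U.linear_axioms]
  and act_v_X = poly_apply_X[OF vector_space_axioms V.U.linear_axioms]

text \<open>Powers of the reciprocal at \<open>u\<close> are powers of \<open>p\<close> at
  \<open>v\<close> followed by an injective operator.\<close>

lemma torsion_reciprocal:
  assumes p: "p \<in> Irr - {[:0, 1:]}"
  shows "torsion act_u (reciprocal p) = torsion act_v p"
proof -
  have c: "coeff p 0 \<noteq> 0" by (rule Irr_coeff_0[OF p])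
  have "act_u (reciprocal p ^ k) x = 0 \<longleftrightarrow> act_v (p ^ k) x = 0" for k x
  proof -
    have "reciprocal p ^ k = [:inverse (coeff p 0) ^ k:] * reflect_poly (p ^ k)"
      by (simp add: reciprocal_def poly_0_coeff_0 reflect_poly_power smult_power)
    then have "act_u (reciprocal p ^ k) x = act_u [:inverse (coeff p 0) ^ k:] (act_u (reflect_poly (p ^ k)) x)"
      by (simp only: MU.scale_scale)
    also have "\<dots> = scale (inverse (coeff p 0) ^ k) ((u ^^ degree (p ^ k)) (act_v (p ^ k) x))"
      unfolding act_u_const poly_apply_reflect ..
    also have "\<dots> = 0 \<longleftrightarrow> act_v (p ^ k) x = 0"
    proof
      assume "scale (inverse (coeff p 0) ^ k) ((u ^^ degree (p ^ k)) (act_v (p ^ k) x)) = 0"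
      then have "(u ^^ degree (p ^ k)) (act_v (p ^ k) x) = (u ^^ degree (p ^ k)) 0"
        using c by (simp add: funpow_linear)
      then show "act_v (p ^ k) x = 0" by (metis funpow_uv(2))
    qed (simp add: funpow_linear)
    finally show ?thesis .
  qed
  then show ?thesis by (simp add: torsion_def)
qed

text \<open>The graph of an isomorphism between the \<open>p\<close>-torsion for \<open>u\<close>
  and for \<open>v\<close>. In a submodule, the last clause expresses single-valuedness and
  injectivity.\<close>

definition inverse_graph :: "'a poly \<Rightarrow> ('v \<times> 'v) set \<Rightarrow> bool"
  where "inverse_graph p G \<longleftrightarrow> PM.subspace G \<and> fst ` G = torsion act_u p \<and> snd ` G = torsion act_v p \<and>
    (\<forall>w\<in>G. fst w = 0 \<longleftrightarrow> snd w = 0)"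

text \<open>A submodule of pairs is closed under applying \<open>u\<close> on the left and
  \<open>v\<close> on the right; this supplies closure under the inverse operators, without which
  the converse of a graph would not be a submodule again.\<close>

lemma graph_backward:
  assumes G: "PM.subspace G" "fst ` G = torsion act_u p" "\<And>w. w \<in> G \<Longrightarrow> fst w = 0 \<Longrightarrow> snd w = 0"
    and w: "w \<in> G"
  shows "(act_v r (fst w), act_u r (snd w)) \<in> G"
proof (induction r)
  case 0
  then show ?case using PM.subspace_0[OF G(1)] by (simp add: zero_prod_def)
next
  case (pCons a r)
  have shift_back: "(v (fst w), u (snd w)) \<in> G" if w: "w \<in> G" for w
  proof -
    have "fst w \<in> torsion act_u p" using G(2) w by blast
    then obtain k where "act_u (p ^ k) (fst w) = 0" by (auto simp: torsion_def)
    then have "act_u (p ^ k) (v (fst w)) = 0" by (simp add: poly_v_commute[symmetric] V.U.zero)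
    then have "v (fst w) \<in> fst ` G" unfolding G(2) torsion_def by blast
    then obtain w' where w': "w' \<in> G" "fst w' = v (fst w)" by auto
    \<comment> \<open>Its first component is \<open>u (v (fst w)) - fst w = 0\<close>, so its second
      component vanishes as well and identifies \<open>snd w'\<close>.\<close>
    have "act_uv [:0, 1:] w' - w \<in> G" by (intro PM.subspace_diff[OF G(1)] PM.subspace_scale[OF G(1)] w' w)
    then have "v (snd w') - snd w = 0"
      using G(3)[of "act_uv [:0, 1:] w' - w"] by (simp add: w'(2) act_u_X act_v_X)
    then have "snd w' = u (snd w)" by (metis eq_iff_diff_eq_0 uv)
    then show ?thesis using w' by (metis prod.collapse)
  qed
  have "act_uv [:a:] w + (v (act_v r (fst w)), u (act_u r (snd w))) \<in> G"
    using shift_back[OF pCons.IH] by (intro PM.subspace_add[OF G(1)] PM.subspace_scale[OF G(1)] w) simp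
  moreover have "act_uv [:a:] w + (v (act_v r (fst w)), u (act_u r (snd w))) =
      (act_v (pCons a r) (fst w), act_u (pCons a r) (snd w))"
    by (simp add: prod_eq_iff act_u_const act_v_const act_u_pCons
        act_v_pCons)
  ultimately show ?case by simp
qed

lemma inverse_graph_swap:
  assumes p: "p \<in> Irr - {[:0, 1:]}" and G: "inverse_graph p G"
  shows "inverse_graph (reciprocal p) (prod.swap ` G)"
proof -
  have G': "PM.subspace G" "fst ` G = torsion act_u p" "snd ` G = torsion act_v p"
    "\<And>w. w \<in> G \<Longrightarrow> fst w = 0 \<longleftrightarrow> snd w = 0" using G by (auto simp: inverse_graph_def)
  have "PM.subspace (prod.swap ` G)" unfolding PM.subspace_def
  proof (intro conjI ballI allI)
    show "0 \<in> prod.swap ` G"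
      using PM.subspace_0[OF G'(1)] by (rule rev_image_eqI) (simp add: zero_prod_def)
    fix x y assume "x \<in> prod.swap ` G" "y \<in> prod.swap ` G"
    then obtain w w' where w: "w \<in> G" "w' \<in> G" "x = prod.swap w" "y = prod.swap w'" by blast
    show "x + y \<in> prod.swap ` G"
      using PM.subspace_add[OF G'(1) w(1,2)] by (rule rev_image_eqI) (simp add: w prod_eq_iff)
  next
    fix r x assume "x \<in> prod.swap ` G"
    then obtain w where w: "w \<in> G" "x = prod.swap w" by blast
    have "(act_v r (fst w), act_u r (snd w)) \<in> G"
      by (rule graph_backward[OF G'(1,2) _ w(1)]) (use G'(4) in blast)
    then show "act_uv r x \<in> prod.swap ` G" by (rule rev_image_eqI) (simp add: w prod_eq_iff)
  qed
  moreover have "fst ` prod.swap ` G = torsion act_u (reciprocal p)"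
    using G'(3) by (simp add: image_image torsion_reciprocal[OF p])
  moreover have "snd ` prod.swap ` G = torsion act_v (reciprocal p)"
    using G'(2) torsion_reciprocal[OF reciprocal_props(1)[OF p]]
    by (simp add: image_image reciprocal_props(3)[OF p])
  ultimately show ?thesis using G'(4) by (auto simp: inverse_graph_def)
qed

text \<open>A basis of the torsion over the ground field generates it, and is countable by
  \<open>countable_independent\<close>.\<close>

lemma torsion_generators:
  assumes C: "countable C" "span C = UNIV"
  shows "\<exists>C'. countable C' \<and> torsion act_u p \<subseteq> MU.span C' \<and> C' \<subseteq> torsion act_u p"
proof -
  obtain C' where C': "C' \<subseteq> torsion act_u p" "independent C'" "torsion act_u p \<subseteq> span C'"
    using maximal_independent_subset by blast
  have "span C' \<subseteq> MU.span C'"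
  proof
    fix x assume "x \<in> span C'"
    then show "x \<in> MU.span C'"
    proof (induction rule: span_induct_alt)
      case base
      show ?case by (rule MU.span_zero)
    next
      case (step c x y)
      have "act_u [:c:] x + y \<in> MU.span C'"
        by (intro MU.span_add MU.span_scale MU.span_base step)
      then show ?case by (simp only: act_u_const)
    qed
  qed
  then show ?thesis using C' countable_independent[OF C C'(2)] by blast
qed

text \<open>The invariants of \<open>u\<close> and of \<open>v\<close> are compared at the same
  \<open>p\<close>. Beyond stability the socles do not depend on \<open>lam\<close>, so any common
  stable ordinal may be used.\<close>

definition ranks_agree :: "'a poly \<Rightarrow> bool"
  where "ranks_agree p \<longleftrightarrow>
    (\<forall>\<alpha> n. rank_ge act_u (torsion_base.layer_set act_u p \<alpha>) (torsion_base.img act_u p (osucc \<alpha>)) n \<longleftrightarrow>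
      rank_ge act_v (torsion_base.layer_set act_v p \<alpha>) (torsion_base.img act_v p (osucc \<alpha>)) n) \<and>
    (\<forall>lam n. torsion_base.stable act_u p lam \<longrightarrow> torsion_base.stable act_v p lam \<longrightarrow>
      (rank_ge act_u (torsion_base.final_socle act_u p lam) {0} n \<longleftrightarrow>
       rank_ge act_v (torsion_base.final_socle act_v p lam) {0} n))"

lemma ex_common_stable:
  assumes C: "countable C" "span C = UNIV" and p: "irreducible p"
  shows "\<exists>lam. torsion_base.stable act_u p lam \<and> torsion_base.stable act_v p lam"
proof -
  interpret S: automorphism scale v u by (rule swapped)
  interpret TU: torsion_base act_u p by (rule torsion_base_poly_apply[OF p])
  interpret TV: torsion_base act_v p by (rule V.torsion_base_poly_apply[OF p])
  obtain l where l: "TU.stable l" using TU.ex_stable[OF C(1)] C(2) by (auto simp: const_span)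
  obtain m where m: "TV.stable m" using TV.ex_stable[OF C(1)] C(2) by (auto simp: S.const_span)
  show ?thesis
    using TU.stable_mono[OF l, of "max l m"] TV.stable_mono[OF m, of "max l m"] by auto
qed

lemma kappa_agree_iff:
  assumes C: "countable C" "span C = UNIV" and p: "p \<in> Irr - {[:0, 1:]}"
  shows "(\<forall>\<alpha>. kappa scale \<alpha> u p =o kappa scale \<alpha> u (reciprocal p)) \<and>
    kappa_infinity scale u p =o kappa_infinity scale u (reciprocal p) \<longleftrightarrow> ranks_agree p"
proof -
  have irr: "irreducible p" using p by (simp add: Irr_def)
  obtain lam where lam: "torsion_base.stable act_u p lam" "torsion_base.stable act_v p lam"
    using ex_common_stable[OF C irr] by blast
  show ?thesis
    using kappa_eq_iff[OF p C] kappa_infinity_eq_iff[OF p C] lam unfolding ranks_agree_def by blast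
qed

lemma height_pair_uv:
  assumes p: "irreducible p" and r: "ranks_agree p"
    and lam: "torsion_base.stable act_u p lam" "torsion_base.stable act_v p lam"
  shows "height_pair act_u act_v p (torsion_base.height act_u p lam) (torsion_base.height act_v p lam) lam"
proof -
  interpret TU: torsion_base act_u p by (rule torsion_base_poly_apply[OF p])
  interpret TV: torsion_base act_v p by (rule V.torsion_base_poly_apply[OF p])
  show ?thesis
  proof (intro height_pair.intro height_pair_axioms.intro TU.height_module_height TV.height_module_height lam)
    fix a n assume a: "a \<le> lam"
    show "rank_ge act_u (valued_module.layer_rep act_u p (TU.height lam) lam a) (valued_module.above (TU.height lam) (osucc a)) n \<longleftrightarrow>
      rank_ge act_v (valued_module.layer_rep act_v p (TV.height lam) lam a) (valued_module.above (TV.height lam) (osucc a)) n"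
      using r lam unfolding ranks_agree_def TU.layer_rep_height[OF lam(1) a] TV.layer_rep_height[OF lam(2) a]
      by auto
  qed
qed

lemma ex_inverse_graph:
  assumes C: "countable C" "span C = UNIV" and p: "irreducible p" and r: "ranks_agree p"
  shows "\<exists>G. inverse_graph p G"
proof -
  interpret S: automorphism scale v u by (rule swapped)
  obtain lam where lam: "torsion_base.stable act_u p lam" "torsion_base.stable act_v p lam"
    using ex_common_stable[OF C p] by blast
  interpret H: height_pair act_u act_v p "torsion_base.height act_u p lam" "torsion_base.height act_v p lam" lam
    by (rule height_pair_uv[OF p r lam])
  obtain C1 C2 where C1: "countable C1" "torsion act_u p \<subseteq> MU.span C1" "C1 \<subseteq> torsion act_u p"
    and C2: "countable C2" "torsion act_v p \<subseteq> MV.span C2" "C2 \<subseteq> torsion act_v p"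
    using torsion_generators[OF C, of p] S.torsion_generators[OF C, of p] by blast
  show ?thesis using H.isomorphism_graph[OF C1 C2] unfolding inverse_graph_def .
qed

text \<open>For \<open>p\<close> equal to its reciprocal, the polynomial \<open>E = t\<^sup>d / p(0)\<close> satisfies \<open>E(u) p(v) = p(u)\<close> and
  \<open>E(u) E(v) = 1\<close>. Sending each basis element \<open>x\<close> to \<open>E(u)\<^sup>k x\<close>, where \<open>p\<^sup>k\<close> is the order of \<open>x\<close>, is
  therefore compatible with multiplication by \<open>p\<close> and squares to the identity.\<close>

lemma ex_symmetric_graph:
  assumes C: "countable C" "span C = UNIV" and p: "p \<in> Irr - {[:0, 1:]}" and r: "ranks_agree p"
    and self: "reciprocal p = p"
  shows "\<exists>G. inverse_graph p G \<and> prod.swap ` G = G"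
proof -
  interpret S: automorphism scale v u by (rule swapped)
  have irr: "irreducible p" using p by (simp add: Irr_def)
  obtain lam where lam: "torsion_base.stable act_u p lam" "torsion_base.stable act_v p lam"
    using ex_common_stable[OF C irr] by blast
  interpret H: height_pair act_u act_v p "torsion_base.height act_u p lam" "torsion_base.height act_v p lam" lam
    by (rule height_pair_uv[OF irr r lam])
  obtain C1 C2 where C1: "countable C1" "torsion act_u p \<subseteq> MU.span C1" "C1 \<subseteq> torsion act_u p"
    and C2: "countable C2" "torsion act_v p \<subseteq> MV.span C2" "C2 \<subseteq> torsion act_v p"
    using torsion_generators[OF C, of p] S.torsion_generators[OF C, of p] by blast
  obtain X where X: "incseq X" "\<And>n::nat. finite (X n)" "\<And>n. H.V.p_closed (X n)"
    "\<And>n c x. reduced p c \<Longrightarrow> H.V.comb c (X n) = 0 \<Longrightarrow> x \<in> X n \<Longrightarrow> c x = 0"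
    "torsion act_u p = (\<Union>n. MU.span (X n))"
    using H.simply_presented[OF C1 C2] by metis
  have c: "coeff p 0 \<noteq> 0" by (rule Irr_coeff_0[OF p])
  \<comment> \<open>The reciprocal of a monic \<open>p\<close> has constant term
    \<open>1 / p(0)\<close>, so self-reciprocity forces \<open>p(0)\<close> to square to 1. This is
    what makes E(v) inverse to E(u).\<close>
  have "coeff (reciprocal p) 0 = coeff p 0" by (simp add: self)
  then have c2: "inverse (coeff p 0) * inverse (coeff p 0) = 1"
    using p c by (simp add: reciprocal_def poly_0_coeff_0 Irr_def field_simps)
  define E where "E = monom (inverse (coeff p 0)) (degree p)"
  have monom_u: "act_u (monom a n) x = scale a ((u ^^ n) x)" for a n x
    by (induction n) (simp_all add: monom_0 monom_Suc act_u_const U.scale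
        act_u_pCons)
  have Eu: "act_u E x = reciprocal_twist p x" for x by (simp add: E_def monom_u reciprocal_twist_def)
  have Ep: "act_u E (act_v p x) = act_u p x" for x using poly_apply_reciprocal[of p x] by (simp add: Eu self)
  have monom_v: "act_v (monom a n) x = scale a ((v ^^ n) x)" for a n x
    by (induction n) (simp_all add: monom_0 monom_Suc act_v_const V.U.scale
        act_v_pCons)
  have EE: "act_v E (act_u E x) = x" for x
    using c2 by (simp add: E_def monom_u monom_v S.funpow_linear)
  have comm: "act_v s (act_u (E ^ k) x) = act_u (E ^ k) (act_v s x)" for s k x
  proof (induction k arbitrary: x)
    case (Suc k)
    have "act_v s (act_u E y) = act_u E (act_v s y)" for y by (simp only: Eu twist_commute)
    then show ?case by (simp only: power_Suc MU.scale_scale[symmetric] Suc)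
  qed simp
  have EEk: "act_v (E ^ k) (act_u (E ^ k) x) = x" for k x
  proof (induction k arbitrary: x)
    case (Suc k)
    have "act_v (E ^ Suc k) y = act_v E (act_v (E ^ k) y)" for y by (simp only: power_Suc MV.scale_scale)
    moreover have "act_u (E ^ Suc k) x = act_u (E ^ k) (act_u E x)" by (simp only: power_Suc2 MU.scale_scale)
    ultimately show ?case by (simp only: Suc EE)
  qed simp
  define k where "k x = (LEAST k. act_u (p ^ k) x = 0)" for x
  define g where "g x = (x, act_u (E ^ k x) x)" for x
  have g0: "g 0 = 0" by (simp add: g_def zero_prod_def)
  have tors: "x \<in> torsion act_u p" if "x \<in> X n" for x n using that X(5) MU.span_base by blast
  have pg: "act_uv p (g x) = g (act_u p x)" if x: "x \<in> torsion act_u p" for x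
  proof (cases "x = 0")
    case False
    obtain m where "act_u (p ^ m) x = 0" using x by (auto simp: torsion_def)
    then have kx: "act_u (p ^ k x) x = 0" unfolding k_def by (rule LeastI)
    then obtain j where j: "k x = Suc j" using False by (cases "k x") auto
    have k_le: "k y \<le> i" if "act_u (p ^ i) y = 0" for i y using that unfolding k_def by (rule Least_le)
    have pj: "act_u (p ^ j) (act_u p x) = 0" using kx by (simp add: j mult.commute)
    have "k (act_u p x) = j"
    proof (rule antisym)
      show "k (act_u p x) \<le> j" by (rule k_le[OF pj])
      have "act_u (p ^ k (act_u p x)) (act_u p x) = 0" using pj unfolding k_def by (rule LeastI)
      then have "act_u (p ^ Suc (k (act_u p x))) x = 0" by (simp add: mult.commute)
      then show "j \<le> k (act_u p x)" using k_le j by fastforce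
    qed
    \<comment> \<open>One factor \<open>E\<close> turns p(v) into p(u); the remaining
      \<open>j\<close> factors are the right number for \<open>p x\<close>, whose order is one
      exponent lower.\<close>
    have "act_v p (act_u (E ^ Suc j) x) = act_u (E ^ j) (act_u E (act_v p x))"
      unfolding comm by (simp only: power_Suc2 MU.scale_scale)
    then have "act_v p (act_u (E ^ Suc j) x) = act_u (E ^ j) (act_u p x)" by (simp only: Ep)
    then show ?thesis using j \<open>k (act_u p x) = j\<close> by (simp add: g_def prod_eq_iff del: power_Suc MU.scale_scale)
  qed (simp add: g0)
  have inj: "inj_on g S" for S by (rule inj_onI) (simp add: g_def)
  have Zc: "finite (g ` X n)" "H.L.p_closed (g ` X n)" for n
  proof -
    show "finite (g ` X n)" using X(2) by simp
    show "H.L.p_closed (g ` X n)" unfolding H.L.p_closed_def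
    proof (rule ballI)
      fix z assume "z \<in> g ` X n"
      then obtain x where x: "x \<in> X n" "z = g x" by blast
      then have "act_u p x = 0 \<or> act_u p x \<in> X n" using X(3)[of n] by (auto simp: H.V.p_closed_def)
      then show "act_uv p z \<in> insert 0 (g ` X n)"
        unfolding x(2) pg[OF tors[OF x(1)]] by (elim disjE) (simp_all add: g0)
    qed
  qed
  have spans: "fst ` PM.span (g ` X n) = MU.span (X n)" for n
  proof -
    have lin: "Modules.module_hom act_uv act_u fst" by unfold_locales simp_all
    show ?thesis using module_hom.span_image[OF lin, of "g ` X n"] by (simp add: image_image g_def)
  qed
  \<comment> \<open>A combination of the pairs \<open>g x\<close> has the same coefficients as its
    first component, and those are unique over \<open>X n\<close>.\<close>
  have zero: "w = 0" if w: "w \<in> PM.span (g ` X n)" "fst w = 0" for w n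
  proof -
    obtain e where e: "reduced p e" "w = H.L.comb e (g ` X n)" using w(1) H.L.span_eq_reduced_combs[OF Zc] by auto
    have "fst w = H.V.comb (e \<circ> g) (X n)"
      unfolding e(2) H.L.comb_def H.V.comb_def sum.reindex[OF inj] fst_sum by (simp add: g_def)
    moreover have "reduced p (e \<circ> g)" using e(1) unfolding reduced_def comp_def by blast
    ultimately have "\<And>x. x \<in> X n \<Longrightarrow> e (g x) = 0" using X(4)[of "e \<circ> g" n] w(2) by simp
    then show ?thesis unfolding e(2) H.L.comb_def sum.reindex[OF inj] by (intro sum.neutral) auto
  qed
  define G where "G = (\<Union>n. PM.span (g ` X n))"
  have "incseq (\<lambda>n. g ` X n)" using X(1) by (auto simp: incseq_def)
  then have G: "PM.subspace G" unfolding G_def PM.span_UN_incseq[OF \<open>incseq (\<lambda>n. g ` X n)\<close>]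
    by (intro PM.subspace_span)
  have fG: "fst ` G = torsion act_u p" unfolding G_def image_UN spans X(5) ..
  have Gz: "w = 0" if "w \<in> G" "fst w = 0" for w using zero that unfolding G_def by blast
  have shift_back: "(act_v s (fst w), act_u s (snd w)) \<in> G" if "w \<in> G" for w s
    by (rule graph_backward[OF G fG _ that]) (metis Gz snd_zero)
  have swap_sub: "prod.swap w \<in> G" if w: "w \<in> G" for w
  proof -
    obtain n where "w \<in> PM.span (g ` X n)" using w by (auto simp: G_def)
    then show ?thesis
    proof (induction rule: PM.span_induct_alt)
      case base
      then show ?case using PM.subspace_0[OF G] by (simp add: zero_prod_def)
    next
      case (step r z w)
      then obtain x where x: "x \<in> X n" "z = g x" by blast
      have "g x \<in> PM.span (g ` X n)" using x(1) by (intro PM.span_base imageI)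
      then have "g x \<in> G" unfolding G_def by (rule UN_I[OF UNIV_I])
      then have "act_uv (E ^ k x) (g x) \<in> G" by (rule PM.subspace_scale[OF G])
      \<comment> \<open>The components become E(u)^k x and E(v)^k E(u)^k x = x, so the swapped
        generator is a multiple of the generator.\<close>
      moreover have "act_uv (E ^ k x) (g x) = prod.swap (g x)"
        using EEk by (simp add: g_def prod_eq_iff)
      ultimately have "prod.swap (g x) \<in> G" by simp
      from shift_back[OF this, of r] have "prod.swap (act_uv r z) \<in> G"
        by (simp add: x(2) prod.swap_def)
      then have "prod.swap (act_uv r z) + prod.swap w \<in> G" using step.IH by (rule PM.subspace_add[OF G])
      moreover have "prod.swap (act_uv r z) + prod.swap w = prod.swap (act_uv r z + w)" by (simp add: prod_eq_iff)
      ultimately show ?case by simp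
    qed
  qed
  have sG: "prod.swap ` G = G"
  proof
    show "prod.swap ` G \<subseteq> G" using swap_sub by blast
    show "G \<subseteq> prod.swap ` G"
    proof
      fix w assume "w \<in> G"
      from swap_sub[OF this] show "w \<in> prod.swap ` G" by (rule rev_image_eqI) simp
    qed
  qed
  have "snd ` G = fst ` prod.swap ` G" by (simp add: image_image)
  then have "snd ` G = torsion act_v p" using fG torsion_reciprocal[OF p] by (simp add: sG self)
  moreover have "fst w = 0 \<longleftrightarrow> snd w = 0" if "w \<in> G" for w
    using Gz[OF that] Gz[OF swap_sub[OF that]] by (auto simp: zero_prod_def prod_eq_iff)
  ultimately show ?thesis using G fG sG by (auto simp: inverse_graph_def)
qed

end

text \<open>A dependence among the iterates gives a nonzero annihilating polynomial; factors t can
  be cancelled since \<open>u\<close> is injective.\<close>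

lemma locally_finite_annihilator:
  assumes "vector_space scale" and u: "Vector_Spaces.linear scale scale u" and inj: "inj u"
    and lf: "locally_finite scale u"
  shows "\<exists>f. f \<noteq> 0 \<and> coeff f 0 \<noteq> 0 \<and> poly_apply scale f u x = 0"
proof -
  interpret vector_space scale by fact
  interpret U: Vector_Spaces.linear scale scale u by fact
  have red: "\<exists>g. g \<noteq> 0 \<and> coeff g 0 \<noteq> 0 \<and> poly_apply scale g u x = 0"
    if "f \<noteq> 0" "poly_apply scale f u x = 0" for f
    using that
  proof (induction f)
    case (pCons a f)
    show ?case
    proof (cases "a = 0")
      case True
      then have "u (poly_apply scale f u x) = u 0"
        using pCons.prems by (simp add: poly_apply_pCons[OF assms(1) u] U.zero)
      then have "poly_apply scale f u x = 0" by (rule injD[OF inj])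
      moreover have "f \<noteq> 0" using pCons.prems True by auto
      ultimately show ?thesis using pCons.IH by blast
    next
      case False
      then show ?thesis using pCons.prems by (intro exI[of _ "pCons a f"]) simp
    qed
  qed simp
  have "\<exists>n c. (\<exists>k\<le>n. c k \<noteq> 0) \<and> (\<Sum>k\<le>n. scale (c k) ((u ^^ k) x)) = 0"
    using lf unfolding locally_finite_def by (rule spec)
  then obtain n c where nc: "(\<exists>k\<le>n. c k \<noteq> 0) \<and> (\<Sum>k\<le>n. scale (c k) ((u ^^ k) x)) = 0"
    by (elim exE)
  then obtain k where c: "k \<le> n" "c k \<noteq> 0" by blast
  define f where "f = (\<Sum>k\<le>n. monom (c k) k)"
  have cf: "coeff f i = (if i \<le> n then c i else 0)" for i
    by (simp add: f_def coeff_sum)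
  have "degree f \<le> n" by (rule degree_le) (simp add: cf)
  then have "poly_apply scale f u x = (\<Sum>k\<le>n. scale (coeff f k) ((u ^^ k) x))"
    unfolding poly_apply_def by (intro sum.mono_neutral_left) (auto simp: coeff_eq_0)
  also have "\<dots> = 0" using nc by (simp add: cf)
  finally have "poly_apply scale f u x = 0" .
  moreover have "f \<noteq> 0" using c(1,2) cf[of k] by auto
  ultimately show ?thesis using red by blast
qed

section \<open>Gluing the primary graphs into an involution, and invariance under
  conjugation\<close>

context automorphism
begin

lemma ex_graph_family:
  assumes C: "countable C" "span C = UNIV" and r: "\<And>p. p \<in> Irr - {[:0, 1:]} \<Longrightarrow> ranks_agree p"
  shows "\<exists>G. \<forall>p\<in>Irr - {[:0, 1:]}. inverse_graph p (G p) \<and> G (reciprocal p) = prod.swap ` G p"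
proof -
  let ?I = "Irr - {[:0, 1:]} :: 'a poly set"
  define S where "S p = (SOME G. inverse_graph p G \<and> (reciprocal p = p \<longrightarrow> prod.swap ` G = G))" for p
  have S: "inverse_graph p (S p)" "reciprocal p = p \<Longrightarrow> prod.swap ` S p = S p" if p: "p \<in> ?I" for p
  proof -
    have "\<exists>G. inverse_graph p G \<and> (reciprocal p = p \<longrightarrow> prod.swap ` G = G)"
    proof (cases "reciprocal p = p")
      case True
      then show ?thesis using ex_symmetric_graph[OF C p r[OF p]] by blast
    next
      case False
      have "irreducible p" using p by (simp add: Irr_def)
      then show ?thesis using ex_inverse_graph[OF C _ r[OF p]] False by blast
    qed
    from someI_ex[OF this] show "inverse_graph p (S p)" "reciprocal p = p \<Longrightarrow> prod.swap ` S p = S p"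
      unfolding S_def by blast+
  qed
  \<comment> \<open>The choice depends only on the unordered pair, so \<open>p\<close> and its
    reciprocal select the same member; the other member receives the converse graph.\<close>
  define rep where "rep p = (SOME q. q \<in> {p, reciprocal p})" for p :: "'a poly"
  have rep: "rep p = p \<or> rep p = reciprocal p" for p
    unfolding rep_def using someI[of "\<lambda>q. q \<in> {p, reciprocal p}" p] by blast
  have rep_reciprocal: "rep (reciprocal p) = rep p" if "p \<in> ?I" for p
    unfolding rep_def reciprocal_props(3)[OF that] by (simp add: insert_commute)
  define G where "G p = (if rep p = p then S p else prod.swap ` S (reciprocal p))" for p
  show ?thesis
  proof (intro exI[of _ G] ballI)
    fix p assume p: "p \<in> ?I"
    note rp = reciprocal_props(1)[OF p] and rr = reciprocal_props(3)[OF p]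
    have "inverse_graph p (G p)"
      using S(1)[OF p] inverse_graph_swap[OF rp S(1)[OF rp]] by (simp add: G_def rr)
    moreover have "G (reciprocal p) = prod.swap ` G p"
    proof (cases "reciprocal p = p")
      case True
      then show ?thesis using S(2)[OF p True] rep[of p] by (simp add: G_def)
    next
      case False
      then show ?thesis using rep[of p] by (auto simp: G_def rep_reciprocal[OF p] rr image_image)
    qed
    ultimately show "inverse_graph p (G p) \<and> G (reciprocal p) = prod.swap ` G p" ..
  qed
qed

text \<open>The sum \<open>R\<close> of all primary graphs is the graph of the involution: local
  finiteness makes it total, independence of primary parts single-valued, its symmetry gives
  \<open>a (a x) = x\<close>, and closure under t gives \<open>a (u x) = v (a x)\<close>.\<close>

lemma ex_conjugating_involution:
  assumes C: "countable C" "span C = UNIV" and r: "\<And>p. p \<in> Irr - {[:0, 1:]} \<Longrightarrow> ranks_agree p"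
    and lf: "locally_finite scale u"
  shows "\<exists>a. Vector_Spaces.linear scale scale a \<and> (\<forall>x. a (a x) = x) \<and> (\<forall>x. a (u x) = v (a x))"
proof -
  define I where "I = (Irr - {[:0, 1:]} :: 'a poly set)"
  have I_rec: "reciprocal p \<in> I" "reciprocal (reciprocal p) = p" if "p \<in> I" for p
    using reciprocal_props(1,3)[of p] that unfolding I_def by blast+
  obtain G where G: "\<And>p. p \<in> I \<Longrightarrow> inverse_graph p (G p)"
    "\<And>p. p \<in> I \<Longrightarrow> G (reciprocal p) = prod.swap ` G p"
    using ex_graph_family[OF C r] unfolding I_def by blast
  have Gs: "PM.subspace (G p)" "fst ` G p = torsion act_u p" "\<And>w. w \<in> G p \<Longrightarrow> fst w = 0 \<longleftrightarrow> snd w = 0"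
    if "p \<in> I" for p using G(1)[OF that] by (auto simp: inverse_graph_def)
  \<comment> \<open>Extended by zero outside \<open>I\<close>, so that families can be indexed by
    all polynomials.\<close>
  define T where "T p = (if p \<in> I then G p else {0})" for p
  have T: "PM.subspace (T p)" for p using Gs(1) by (simp add: T_def PM.subspace_single_0)
  define R where "R = {w. \<exists>P f. finite P \<and> P \<subseteq> I \<and> (\<forall>p. f p \<in> T p) \<and> w = (\<Sum>p\<in>P. f p)}"
  have R_E: "\<exists>P f. finite P \<and> P \<subseteq> I \<and> (\<forall>p. f p \<in> T p) \<and> w = (\<Sum>p\<in>P. f p)" if "w \<in> R" for w
    using that unfolding R_def by (rule CollectD)
  have R_I: "(\<Sum>p\<in>P. f p) \<in> R" if "finite P" "P \<subseteq> I" "\<And>p. f p \<in> T p" for P f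
    using that unfolding R_def by (intro CollectI exI[of _ P] exI[of _ f]) simp
  have R_add: "w + w' \<in> R" if ww: "w \<in> R" "w' \<in> R" for w w'
  proof -
    obtain P f where P: "finite P" "P \<subseteq> I" "\<And>p. f p \<in> T p" "w = (\<Sum>p\<in>P. f p)"
      using R_E[OF ww(1)] by blast
    obtain P' f' where P': "finite P'" "P' \<subseteq> I" "\<And>p. f' p \<in> T p" "w' = (\<Sum>p\<in>P'. f' p)"
      using R_E[OF ww(2)] by blast
    obtain g where "\<forall>p. g p \<in> T p" "w + w' = (\<Sum>p\<in>P \<union> P'. g p)"
      using PU.primary_sum_add[of P P' f T f', OF P(1) P'(1) P(3) P'(3) PM.subspace_0[OF T] PM.subspace_add[OF T]]
      unfolding P(4) P'(4) by auto
    then show ?thesis using R_I[of "P \<union> P'" g] P(1,2) P'(1,2) by simp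
  qed
  have R_scale: "act_uv s w \<in> R" if w: "w \<in> R" for w s
  proof -
    obtain P f where P: "finite P" "P \<subseteq> I" "\<And>p. f p \<in> T p" "w = (\<Sum>p\<in>P. f p)"
      using R_E[OF w] by blast
    have "act_uv s w = (\<Sum>p\<in>P. act_uv s (f p))" by (simp only: P(4) PM.scale_sum_right)
    moreover have "\<And>p. act_uv s (f p) \<in> T p" using P(3) PM.subspace_scale[OF T] by blast
    ultimately show ?thesis using R_I[OF P(1,2), of "\<lambda>p. act_uv s (f p)"] by simp
  qed
  have R_swap: "prod.swap w \<in> R" if w: "w \<in> R" for w
  proof -
    obtain P f where P: "finite P" "P \<subseteq> I" "\<And>p. f p \<in> T p" "w = (\<Sum>p\<in>P. f p)"
      using R_E[OF w] by blast
    \<comment> \<open>Swapping moves the summand at \<open>p\<close> to the reciprocal of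
      \<open>p\<close>, hence the reindexing.\<close>
    define f' where "f' q = (if q \<in> I then prod.swap (f (reciprocal q)) else 0)" for q
    have f': "f' q \<in> T q" for q
    proof (cases "q \<in> I")
      case True
      note rq = I_rec(1)[OF True]
      have "f (reciprocal q) \<in> G (reciprocal q)" using P(3)[of "reciprocal q"] rq by (simp add: T_def)
      then have "prod.swap (f (reciprocal q)) \<in> G q" using G(2)[OF True] by auto
      then show ?thesis using True by (simp add: T_def f'_def)
    next
      case False
      then show ?thesis using PM.subspace_0[OF T] by (simp add: f'_def)
    qed
    have inj: "inj_on reciprocal P"
      by (rule inj_on_inverseI[where g = reciprocal]) (use P(2) I_rec(2) in blast)
    have "prod.swap w = (\<Sum>p\<in>P. prod.swap (f p))" unfolding P(4) by (simp add: prod_eq_iff fst_sum snd_sum)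
    also have "\<dots> = (\<Sum>p\<in>P. f' (reciprocal p))"
    proof (intro sum.cong refl)
      fix p assume "p \<in> P"
      then have p: "p \<in> I" using P(2) by blast
      then show "prod.swap (f p) = f' (reciprocal p)"
        using I_rec(1)[OF p] by (simp add: f'_def I_rec(2)[OF p])
    qed
    also have "\<dots> = (\<Sum>q\<in>reciprocal ` P. f' q)" by (simp add: sum.reindex[OF inj])
    finally have "prod.swap w = (\<Sum>q\<in>reciprocal ` P. f' q)" .
    moreover have "reciprocal ` P \<subseteq> I" using P(2) I_rec(1) by blast
    moreover have "finite (reciprocal ` P)" using P(1) by simp
    ultimately show ?thesis using R_I[of "reciprocal ` P" f'] f' by simp
  qed
  have R_zero: "w = 0" if w: "w \<in> R" "fst w = 0" for w
  proof -
    obtain P f where P: "finite P" "P \<subseteq> I" "\<And>p. f p \<in> T p" "w = (\<Sum>p\<in>P. f p)"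
      using R_E[OF w(1)] by blast
    have fp: "f p \<in> G p" if "p \<in> P" for p using P(2) P(3)[of p] that by (auto simp: T_def)
    have "f p = 0" if p: "p \<in> P" for p
    proof -
      have "fst (f p) = 0"
      proof (rule PU.primary_sum_independent[where P = P])
        show "finite P" "P \<subseteq> Irr" "p \<in> P" using P(1,2) p by (auto simp: I_def)
        show "fst (f q) \<in> torsion act_u q" if "q \<in> P" for q using fp[OF that] Gs(2)[of q] P(2) that by blast
        show "(\<Sum>q\<in>P. fst (f q)) = 0" using w(2) unfolding P(4) fst_sum .
      qed
      then show ?thesis using Gs(3)[of p "f p"] fp[OF p] P(2) p by (auto simp: prod_eq_iff)
    qed
    then show ?thesis by (simp add: P(4))
  qed
  have R_total: "\<exists>y. (x, y) \<in> R" for x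
  proof -
    have "inj u" by (rule inj_on_inverseI[where g = v]) simp
    then obtain f where f: "f \<noteq> 0" "coeff f 0 \<noteq> 0" "act_u f x = 0"
      using locally_finite_annihilator[OF vector_space_axioms U.linear_axioms _ lf] by blast
    then obtain P y where P: "finite P" "P \<subseteq> I" "\<And>p. y p \<in> torsion act_u p" "x = (\<Sum>p\<in>P. y p)"
      using PU.primary_decomposition[OF f] unfolding I_def by blast
    have "\<exists>w. w \<in> T p \<and> (p \<in> P \<longrightarrow> fst w = y p)" for p
    proof (cases "p \<in> P")
      case True
      then have "p \<in> I" using P(2) by blast
      then have "y p \<in> fst ` G p" using Gs(2) P(3) by blast
      then show ?thesis using \<open>p \<in> I\<close> by (auto simp: T_def)
    next
      case False
      then show ?thesis using PM.subspace_0[OF T] by blast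
    qed
    then obtain w where w: "\<And>p. w p \<in> T p" "\<And>p. p \<in> P \<Longrightarrow> fst (w p) = y p" by metis
    have "(\<Sum>p\<in>P. w p) \<in> R" by (rule R_I[OF P(1,2) w(1)])
    moreover have "fst (\<Sum>p\<in>P. w p) = x" unfolding fst_sum P(4) using w(2) by (intro sum.cong refl)
    ultimately show ?thesis by (metis prod.collapse)
  qed
  have R_unique: "y = y'" if "(x, y) \<in> R" "(x, y') \<in> R" for x y y'
  proof -
    have "(x, y) + act_uv (- 1) (x, y') \<in> R" using R_add[OF that(1) R_scale[OF that(2)]] .
    moreover have "(x, y) + act_uv (- 1) (x, y') = (0, y - y')" by (simp add: prod_eq_iff)
    ultimately show ?thesis using R_zero[of "(0, y - y')"] by (simp add: zero_prod_def)
  qed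
  define a where "a x = (SOME y. (x, y) \<in> R)" for x
  have aR: "(x, a x) \<in> R" for x unfolding a_def using R_total by (rule someI_ex)
  have a_eq: "a x = y" if "(x, y) \<in> R" for x y using R_unique[OF aR that] .
  show ?thesis
  proof (intro exI[of _ a] conjI allI)
    show "Vector_Spaces.linear scale scale a"
    proof unfold_locales
      show "a (x + y) = a x + a y" for x y using R_add[OF aR[of x] aR[of y]] by (intro a_eq) simp
      show "a (scale c x) = scale c (a x)" for c x
        using R_scale[OF aR[of x], of "[:c:]"] by (intro a_eq) (simp add: pair_act_def act_u_const act_v_const)
    qed
    show "a (a x) = x" for x using R_swap[OF aR[of x]] by (intro a_eq) simp
    show "a (u x) = v (a x)" for x
      using R_scale[OF aR[of x], of "[:0, 1:]"] by (intro a_eq) (simp add: pair_act_def act_u_X act_v_X)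
  qed
qed

text \<open>All sets in \<open>ranks_agree\<close> are built from p(u), which \<open>\<phi>\<close>
  carries to p(v). Injectivity is needed at limits, where intersections must be mapped to
  intersections.\<close>

lemma ranks_agree_if_conjugate:
  assumes \<phi>: "Vector_Spaces.linear scale scale \<phi>" "bij \<phi>" "\<And>x. \<phi> (u x) = v (\<phi> x)"
    and p: "irreducible p"
  shows "ranks_agree p"
proof -
  interpret TU: torsion_base act_u p by (rule torsion_base_poly_apply[OF p])
  interpret TV: torsion_base act_v p by (rule V.torsion_base_poly_apply[OF p])
  interpret P: Vector_Spaces.linear scale scale \<phi> by (rule \<phi>(1))
  have act: "\<phi> (act_u r x) = act_v r (\<phi> x)" for r x
    by (induction r) (simp_all add: P.zero P.add P.scale \<phi>(3) act_u_pCons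
        act_v_pCons)
  have inj: "inj \<phi>" by (rule bij_is_inj[OF \<phi>(2)])
  have img: "\<phi> ` TU.img a = TV.img a" for a
  proof (induction a rule: omega1_induct)
    case zero
    show ?case using bij_is_surj[OF \<phi>(2)] by (simp add: TU.img_simps TV.img_simps)
  next
    case (succ a)
    have "\<phi> ` act_u p ` TU.img a = act_v p ` \<phi> ` TU.img a" by (simp add: image_image act)
    then show ?case by (simp add: TU.img_simps TV.img_simps succ)
  next
    case (limit a)
    have "a \<noteq> ozero" using limit(1) by (simp add: is_limit_def)
    then have "ozero \<in> {..<a}" using ozero_le[of a] by simp
    then have "\<phi> ` (\<Inter>b\<in>{..<a}. TU.img b) = (\<Inter>b\<in>{..<a}. \<phi> ` TU.img b)"
      using inj by (intro image_INT[of \<phi> UNIV _ _ ozero]) auto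
    then show ?case using limit by (simp add: TU.img_simps TV.img_simps)
  qed
  have mem: "\<phi> x \<in> TV.img a \<longleftrightarrow> x \<in> TU.img a" for x a
    using inj_image_mem_iff[OF inj, of x "TU.img a"] by (simp add: img)
  have surj: "\<exists>x. y = \<phi> x" for y using bij_is_surj[OF \<phi>(2)] by (auto simp: surj_def)
  have zero: "\<phi> x = 0 \<longleftrightarrow> x = 0" for x using inj_eq[OF inj, of x 0] by (simp add: P.zero)
  have layer: "\<phi> ` TU.layer_set a = TV.layer_set a" for a
  proof (intro equalityI subsetI)
    fix y assume y: "y \<in> TV.layer_set a"
    obtain x where x: "y = \<phi> x" using surj by blast
    then show "y \<in> \<phi> ` TU.layer_set a"
      using y by (auto simp: TU.layer_set_def TV.layer_set_def mem simp flip: act)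
  qed (auto simp: TU.layer_set_def TV.layer_set_def mem simp flip: act)
  have socle: "\<phi> ` TU.final_socle a = TV.final_socle a" for a
  proof (intro equalityI subsetI)
    fix y assume y: "y \<in> TV.final_socle a"
    obtain x where x: "y = \<phi> x" using surj by blast
    then show "y \<in> \<phi> ` TU.final_socle a"
      using y by (auto simp: TU.final_socle_def TV.final_socle_def mem zero simp flip: act)
  qed (auto simp: TU.final_socle_def TV.final_socle_def mem zero simp flip: act)
  have rank: "rank_ge act_v (\<phi> ` A) (\<phi> ` Q) n \<longleftrightarrow> rank_ge act_u A Q n" for A Q n
    by (rule rank_ge_image[OF \<phi>(2)]) (simp_all add: P.add act)
  have "\<phi> ` {0} = {0}" by (simp add: P.zero)
  then show ?thesis unfolding ranks_agree_def
    using rank[of "TU.layer_set _" "TU.img (osucc _)"] rank[of "TU.final_socle _" "{0}"] by (simp add: layer img socle)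
qed

end

theorem theorem6p1:
  fixes scale :: "'a::field \<Rightarrow> 'v::ab_group_add \<Rightarrow> 'v"
    and u :: "'v \<Rightarrow> 'v"
  assumes "vector_space scale"
    and "countable_dimension scale"
    and "u \<in> GL scale"
    and "locally_finite scale u"
  shows "((\<exists>a \<in> involutions scale. \<exists>b \<in> involutions scale. u = a \<circ> b)
            \<longleftrightarrow> similar scale u (inv_into UNIV u))
       \<and> (similar scale u (inv_into UNIV u)
            \<longleftrightarrow> (\<forall>p \<in> Irr - {[:0, 1:]}.
                  (\<forall>\<alpha>::omega1. kappa scale \<alpha> u p =o kappa scale \<alpha> u (reciprocal p))
                  \<and> kappa_infinity scale u p =o kappa_infinity scale u (reciprocal p)))"
proof -
  interpret vector_space scale by fact
  define v where "v = inv_into UNIV u"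
  have lu: "Vector_Spaces.linear scale scale u" and bu: "bij u" using assms(3) by (auto simp: GL_def)
  interpret U: Vector_Spaces.linear scale scale u by (rule lu)
  have uv: "u (v x) = x" and vu: "v (u x) = x" for x
    using bu by (simp_all add: v_def bij_is_surj surj_f_inv_f bij_is_inj)
  have lv: "Vector_Spaces.linear scale scale v"
  proof unfold_locales
    show "v (x + y) = v x + v y" for x y by (metis U.add uv vu)
    show "v (scale c x) = scale c (v x)" for c x by (metis U.scale uv vu)
  qed
  interpret A: automorphism scale u v
    by (intro automorphism.intro endomorphism.intro automorphism_axioms.intro vector_space_axioms lu lv uv vu)
  obtain C where C: "countable C" "span C = UNIV"
    using assms(2) unfolding countable_dimension_def by blast
  let ?kappa = "\<forall>p \<in> Irr - {[:0, 1:]}. (\<forall>\<alpha>::omega1. kappa scale \<alpha> u p =o kappa scale \<alpha> u (reciprocal p))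
    \<and> kappa_infinity scale u p =o kappa_infinity scale u (reciprocal p)"
  have kappa: "?kappa \<longleftrightarrow> (\<forall>p \<in> Irr - {[:0, 1:]}. A.ranks_agree p)"
    using A.kappa_agree_iff[OF C] by blast
  have 1: "similar scale u v" if inv: "\<exists>a \<in> involutions scale. \<exists>b \<in> involutions scale. u = a \<circ> b"
  proof -
    obtain a b where ab: "a \<in> GL scale" "a \<circ> a = id" "b \<circ> b = id" "u = a \<circ> b"
      using inv by (auto simp: involutions_def)
    have aa: "a (a x) = x" and bb: "b (b x) = x" for x using ab(2,3) by (simp_all add: fun_eq_iff)
    have "inv_into UNIV a = a" by (rule inv_unique_comp) (simp_all add: ab(2))
    moreover have "v y = b (a y)" for y
      using vu[of "b (a y)"] by (simp add: ab(4) aa bb)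
    ultimately have "v = a \<circ> u \<circ> inv_into UNIV a" by (simp add: fun_eq_iff ab(4) aa)
    then show ?thesis using ab(1) unfolding similar_def by blast
  qed
  have 2: "?kappa" if sim: "similar scale u v"
  proof -
    obtain \<phi> where \<phi>: "\<phi> \<in> GL scale" "v = \<phi> \<circ> u \<circ> inv_into UNIV \<phi>" using sim unfolding similar_def by blast
    then have l: "Vector_Spaces.linear scale scale \<phi>" "bij \<phi>" by (auto simp: GL_def)
    have "\<phi> (u x) = v (\<phi> x)" for x using l(2) by (simp add: \<phi>(2) bij_is_inj)
    then show ?thesis unfolding kappa using A.ranks_agree_if_conjugate[OF l] by (auto simp: Irr_def)
  qed
  have 3: "\<exists>a \<in> involutions scale. \<exists>b \<in> involutions scale. u = a \<circ> b" if "?kappa"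
  proof -
    have "\<And>p. p \<in> Irr - {[:0, 1:]} \<Longrightarrow> A.ranks_agree p" using that unfolding kappa by blast
    from A.ex_conjugating_involution[OF C this assms(4)] obtain a where
      a: "Vector_Spaces.linear scale scale a" "\<And>x. a (a x) = x" "\<And>x. a (u x) = v (a x)" by blast
    have inv: "f \<in> involutions scale" if "Vector_Spaces.linear scale scale f" "\<And>x. f (f x) = x" for f
      using that by (auto simp: involutions_def GL_def fun_eq_iff intro: o_bij[of f f])
    \<comment> \<open>The square of \<open>a u\<close> is \<open>v (a (a u)) = v u\<close>, the
      identity.\<close>
    have "Vector_Spaces.linear scale scale (a \<circ> u)" by (rule Vector_Spaces.linear_compose[OF lu a(1)])
    then have "a \<circ> u \<in> involutions scale" by (rule inv) (simp add: a vu)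
    moreover have "a \<in> involutions scale" using a by (intro inv)
    moreover have "u = a \<circ> (a \<circ> u)" by (simp add: fun_eq_iff a(2))
    ultimately show ?thesis by blast
  qed
  show ?thesis using 1 2 3 unfolding v_def[symmetric] by blast
qed

end
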